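(* Let $(X,J)$ be a lattice one-sided (skip-free downward) Markov additive process as described in the context, and let $\Xi(k)$, $k\ge1$, be the matrix with entries $\Xi(k)_{ij}=\mathrm E_i[L_j(0,\tau_k^+)]$. If $A_{-1}$ is nonsingular, the matrices $W(k)=\Xi(k)R^{-k}$, $k\ge1$, satisfy the recursion $$W(1)=(A_{-1})^{-1},\qquad W(k+1)=-(A_{-1})^{-1}\sum_{1\le\nu\le k}A_{k-\nu}W(\nu)\quad(k\ge1).$$ Furthermore, $$\sum_{k\ge1}W(k)z^k=zF(z)^{-1}$$ for $|z|<\min\{|\lambda|:\lambda\in\mathrm{sp}(G)\}$, where $\mathrm{sp}(G)$ is the set of eigenvalues of $G$.
   Context: Setting. $E=\{1,\dots,N\}$ is finite. $(X_t,J_t)_{t\ge0}$ is a continuous-time Markov chain on $\mathbb Z\times E$, possibly killed, with transition rates that are translation-invariant in the level: for every $k$, $A_m$ is the $N\times N$ block of transition rates from level $k$ to level $k+m$, with $A_m=0$ for $m\le-2$. The diagonal of $A_0$ is strictly negative, all other rates are nonnegative. $Q=\sum_{m\ge-1}A_m$, the transition rate matrix of $J$, is irreducible with row sums $\le0$, and $\boldsymbol q=-Q\boldsymbol 1\ge0$ is the vector of killing rates, at which the process is sent to a cemetery state forever. The chain $(X,J)$ on $\mathbb Z\times E$ is assumed irreducible. $\mathrm P_i,\mathrm E_i$ refer to $X_0=0,J_0=i$. $F(z)=z\sum_{m=-1}^\infty z^mA_m$. $\tau_x=\inf\{t\ge0:X_t=x\}$, $\tau_x^+=\inf\{t\ge0:X_t\ge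 x\}$, $L_j(x,t)=\int_0^t\mathbf 1\{X_s=x,J_s=j\}\,ds$. $G$ is the matrix with entries $G_{ij}=\mathrm P_i[\tau_{-1}<\infty,J_{\tau_{-1}}=j]$. $R$ is the minimal nonnegative solution of $A_{-1}+RA_0+R^2A_1+R^3A_2+\cdots=0$; equivalently, for $k\ge1$, $(R^k)_{ij}=\mathrm E_i[L_j(-k,\tau'_0)]/\mathrm E_i[L_i(0,\tau_0')]$, where $\tau_0'=\inf\{t\ge\tau^*:X_t=0\}$ and $\tau^*$ is the first jump time of $(X,J)$. The matrix $R$ is nonsingular if and only if $A_{-1}$ is. *)

theory Defs
  imports "HOL-Probability.Probability"
begin

text \<open>
  A continuous-time Markov chain on a countable set with (stable) generator \<open>q\<close> is a
  right-continuous process whose jump chain is a Markov chain with the jump matrix of \<open>q\<close> and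
  whose holding times are, conditionally on the jump chain, independent and exponential with
  rate \<open>- q x x\<close> in state \<open>x\<close> (Norris, Markov Chains, Section 2.6).  Jump times and
  holding times are extended reals; a holding time with rate \<open>0\<close> is infinite, and from
  then on the jump chain is constant.  Only times \<open>t \<ge> 0\<close> of a path matter.
\<close>

primrec jump_time :: "(real \<Rightarrow> 's) \<Rightarrow> nat \<Rightarrow> ereal" where
  "jump_time f 0 = 0"
| "jump_time f (Suc n) =
     (if jump_time f n = \<infinity> then \<infinity>
      else Inf {ereal t | t. jump_time f n \<le> ereal t \<and> f t \<noteq> f (real_of_ereal (jump_time f n))})"

primrec jump_chain :: "(real \<Rightarrow> 's) \<Rightarrow> nat \<Rightarrow> 's" where
  "jump_chain f 0 = f 0"
| "jump_chain f (Suc n) =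
     (if jump_time f (Suc n) = \<infinity> then jump_chain f n
      else f (real_of_ereal (jump_time f (Suc n))))"

definition holding_time :: "(real \<Rightarrow> 's) \<Rightarrow> nat \<Rightarrow> ereal" where
  "holding_time f n =
     (if jump_time f n = \<infinity> then \<infinity> else jump_time f (Suc n) - jump_time f n)"

definition jump_prob :: "('s \<Rightarrow> 's \<Rightarrow> real) \<Rightarrow> 's \<Rightarrow> 's \<Rightarrow> real" where
  "jump_prob q x y =
     (if q x x = 0 then (if x = y then 1 else 0)
      else (if x = y then 0 else q x y / - q x x))"

text \<open>
  The process \<open>Z\<close> is, under the probability measure \<open>M\<close>, a Markov chain with
  generator \<open>q\<close> started at \<open>x\<close>.  Right-continuity refers to the discrete topology.
\<close>

definition markov_chain ::
  "'w measure \<Rightarrow> (real \<Rightarrow> 'w \<Rightarrow> 's) \<Rightarrow> ('s \<Rightarrow> 's \<Rightarrow> real) \<Rightarrow> 's \<Rightarrow> bool" where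
  "markov_chain M Z q x \<longleftrightarrow>
     prob_space M \<and>
     (\<forall>t\<ge>0. Z t \<in> measurable M (count_space UNIV)) \<and>
     (\<forall>\<omega>\<in>space M. \<forall>t\<ge>0. eventually (\<lambda>s. Z s \<omega> = Z t \<omega>) (at_right t)) \<and>
     (\<forall>n y s. (\<forall>m\<le>n. 0 \<le> s m) \<longrightarrow>
        measure M {\<omega> \<in> space M. \<forall>m\<le>n. jump_chain (\<lambda>t. Z t \<omega>) m = y m \<and>
                                       ereal (s m) < holding_time (\<lambda>t. Z t \<omega>) m}
        = (if y 0 = x then 1 else 0)
          * (\<Prod>m<n. jump_prob q (y m) (y (Suc m)))
          * (\<Prod>m\<le>n. exp (q (y m) (y m) * s m)))"

text \<open>
  The phase space \<open>E\<close> is the finite type \<open>'n\<close>.  The state \<open>Some (k, i)\<close> means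
  level \<open>k\<close> and phase \<open>i\<close>; \<open>None\<close> is the cemetery.
\<close>

type_synonym 'n state = "(int \<times> 'n) option"

definition phase_gen :: "(int \<Rightarrow> real^'n^'n) \<Rightarrow> real^'n^'n" where
  "phase_gen A = (\<Sum>n. A (int n - 1))"

definition killing_rate :: "(int \<Rightarrow> real^'n^'n) \<Rightarrow> real^'n" where
  "killing_rate A = - (phase_gen A *v 1)"

fun generator :: "(int \<Rightarrow> real^'n^'n) \<Rightarrow> 'n state \<Rightarrow> 'n state \<Rightarrow> real" where
  "generator A (Some (k, i)) (Some (l, j)) = A (l - k) $ i $ j"
| "generator A (Some (k, i)) None = killing_rate A $ i"
| "generator A None _ = 0"

definition irreducible_on :: "'s set \<Rightarrow> ('s \<Rightarrow> 's \<Rightarrow> real) \<Rightarrow> bool" where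
  "irreducible_on S q \<longleftrightarrow>
     (\<forall>x\<in>S. \<forall>y\<in>S. (x, y) \<in> {(u, v). u \<in> S \<and> v \<in> S \<and> u \<noteq> v \<and> q u v > 0}\<^sup>*)"

definition skip_free_rates :: "(int \<Rightarrow> real^'n^'n) \<Rightarrow> bool" where
  "skip_free_rates A \<longleftrightarrow>
     (\<forall>m\<le>-2. A m = 0) \<and>
     (\<forall>i. A 0 $ i $ i < 0) \<and>
     (\<forall>m i j. m \<noteq> 0 \<or> i \<noteq> j \<longrightarrow> A m $ i $ j \<ge> 0) \<and>
     summable (\<lambda>n. A (int n - 1)) \<and>
     irreducible_on UNIV (\<lambda>i j. phase_gen A $ i $ j) \<and>
     (\<forall>i. killing_rate A $ i \<ge> 0) \<and>
     irreducible_on (range Some) (generator A)"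

definition skip_free_MAP ::
  "(int \<Rightarrow> real^'n^'n) \<Rightarrow> ('n \<Rightarrow> 'w measure) \<Rightarrow> (real \<Rightarrow> 'w \<Rightarrow> 'n state) \<Rightarrow> bool" where
  "skip_free_MAP A P Z \<longleftrightarrow>
     skip_free_rates A \<and> (\<forall>i. markov_chain (P i) Z (generator A) (Some (0, i)))"

text \<open>The infimum of the empty set is \<open>\<infinity>\<close>, and a killed process has no level.\<close>

definition hit_time :: "(real \<Rightarrow> 'n state) \<Rightarrow> int \<Rightarrow> ereal" where
  "hit_time f x = Inf {ereal t | t. 0 \<le> t \<and> (\<exists>j. f t = Some (x, j))}"

definition up_time :: "(real \<Rightarrow> 'n state) \<Rightarrow> int \<Rightarrow> ereal" where
  "up_time f x = Inf {ereal t | t. 0 \<le> t \<and> (\<exists>l j. f t = Some (l, j) \<and> l \<ge> x)}"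

definition local_time :: "(real \<Rightarrow> 'n state) \<Rightarrow> 'n \<Rightarrow> int \<Rightarrow> ereal \<Rightarrow> ennreal" where
  "local_time f j x t =
     (\<integral>\<^sup>+ s. indicator {s. 0 \<le> s \<and> ereal s \<le> t \<and> f s = Some (x, j)} s \<partial>lborel)"

definition G_mat :: "('n \<Rightarrow> 'w measure) \<Rightarrow> (real \<Rightarrow> 'w \<Rightarrow> 'n state) \<Rightarrow> real^'n^'n" where
  "G_mat P Z = (\<chi> i j. measure (P i)
     {\<omega> \<in> space (P i). hit_time (\<lambda>t. Z t \<omega>) (-1) < \<infinity> \<and>
        map_option snd (Z (real_of_ereal (hit_time (\<lambda>t. Z t \<omega>) (-1))) \<omega>) = Some j})"

definition expected_local_time ::
  "('n \<Rightarrow> 'w measure) \<Rightarrow> (real \<Rightarrow> 'w \<Rightarrow> 'n state) \<Rightarrow> nat \<Rightarrow> 'n \<Rightarrow> 'n \<Rightarrow> ennreal" where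
  "expected_local_time P Z k i j =
     (\<integral>\<^sup>+ \<omega>. local_time (\<lambda>t. Z t \<omega>) j 0 (up_time (\<lambda>t. Z t \<omega>) (int k)) \<partial>P i)"

definition Xi_mat :: "('n \<Rightarrow> 'w measure) \<Rightarrow> (real \<Rightarrow> 'w \<Rightarrow> 'n state) \<Rightarrow> nat \<Rightarrow> real^'n^'n" where
  "Xi_mat P Z k = (\<chi> i j. enn2real (expected_local_time P Z k i j))"

text \<open>Matrix powers; the power operation of the type \<open>real^'n^'n\<close> is entrywise.\<close>

primrec matpow :: "'a::semiring_1^'n^'n \<Rightarrow> nat \<Rightarrow> 'a^'n^'n" where
  "matpow M 0 = mat 1"
| "matpow M (Suc k) = M ** matpow M k"

definition complex_mat :: "real^'n^'m \<Rightarrow> complex^'n^'m" where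
  "complex_mat M = (\<chi> i j. complex_of_real (M $ i $ j))"

definition sp :: "real^'n^'n \<Rightarrow> complex set" where
  "sp M = {c. \<exists>v. v \<noteq> 0 \<and> complex_mat M *v v = c *s v}"

definition nonneg_solution :: "(int \<Rightarrow> real^'n^'n) \<Rightarrow> real^'n^'n \<Rightarrow> bool" where
  "nonneg_solution A R \<longleftrightarrow>
     (\<forall>i j. R $ i $ j \<ge> 0) \<and> (\<lambda>n. matpow R n ** A (int n - 1)) sums 0"

definition R_mat :: "(int \<Rightarrow> real^'n^'n) \<Rightarrow> real^'n^'n" where
  "R_mat A = (THE R. nonneg_solution A R \<and>
     (\<forall>R'. nonneg_solution A R' \<longrightarrow> (\<forall>i j. R $ i $ j \<le> R' $ i $ j)))"

text \<open>
  \<open>z\<close> times the sum of \<open>z^m A\<^sub>m\<close> over \<open>m \<ge> -1\<close>, with the factor \<open>z\<close> multiplied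
  into the series, so that the value at \<open>z = 0\<close> is \<open>A\<^sub>-\<^sub>1\<close>.
\<close>

definition F_mat :: "(int \<Rightarrow> real^'n^'n) \<Rightarrow> complex \<Rightarrow> complex^'n^'n" where
  "F_mat A z = (\<chi> i j. \<Sum>n. z ^ n * complex_of_real (A (int n - 1) $ i $ j))"

definition W_mat ::
  "(int \<Rightarrow> real^'n^'n) \<Rightarrow> ('n \<Rightarrow> 'w measure) \<Rightarrow> (real \<Rightarrow> 'w \<Rightarrow> 'n state) \<Rightarrow> nat \<Rightarrow> real^'n^'n" where
  "W_mat A P Z k = Xi_mat P Z k ** matpow (matrix_inv (R_mat A)) k"

end

theory Submission
  imports Defs
    "HOL-Complex_Analysis.Cauchy_Integral_Formula"
    "HOL-Computational_Algebra.Fundamental_Theorem_Algebra"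
begin

text \<open>
  Count levels downwards, so that a state has depth \<open>n \<ge> 1\<close> when its level is \<open>-n\<close>, and let
  \<open>g(x,y)\<close> be the matrix of expected occupation times at depth \<open>y\<close>, starting at depth \<open>x\<close>, before
  level \<open>0\<close> or a higher one is reached.  By translation invariance \<open>\<Xi>(k) = g(k,k)\<close>.

  Depth grows by at most one per jump.  Hence a path from depth \<open>x \<le> y\<close> to depth \<open>y+1\<close> leaves
  depth \<open>y\<close> for a last time, which gives
  \<open>g(x,y+1) = g(x,y) A\<^sub>-\<^sub>1 g(1,1)\<close> (\<open>occ_step\<close>).  Put \<open>R\<^sub>0 = A\<^sub>-\<^sub>1 g(1,1)\<close>, so that
  \<open>g(x,y) = g(x,x) R\<^sub>0\<^sup>y\<^sup>-\<^sup>x\<close>.  The forward equation at depth 1 (\<open>occ_forward\<close>) says that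
  \<open>g(1,1)\<close> is invertible and that \<open>R\<^sub>0\<close> solves the equation defining \<open>R\<close>; every nonnegative solution \<open>R'\<close>
  yields a supersolution \<open>n \<mapsto> R'\<^sup>n\<close> of that forward equation with source \<open>A\<^sub>-\<^sub>1\<close> at depth 1, so
  \<open>R\<^sub>0 \<le> R'\<close> by minimality of Green functions, and \<open>R = R\<^sub>0\<close> (\<open>R_mat_eq\<close>).  Since
  \<open>g(n,k+1) = W(n) R\<^sup>k\<^sup>+\<^sup>1\<close> for \<open>n \<le> k+1\<close>, the backward equation for \<open>g(k,k+1)\<close>, whose sum is finite,
  is the asserted recursion (\<open>scale_recursion\<close>).

  For the generating function, let \<open>0 < |z| < 1\<close> and \<open>F(z) v = 0\<close>.  Then \<open>z\<^sup>l v\<close> is harmonic at the levels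
  \<open>l \<ge> 0\<close>.  Subtract from it the harmonic function with the same values at level \<open>-1\<close> that is given by
  the hitting probabilities of that level.  The modulus of the difference is subharmonic for the process
  killed at level \<open>-1\<close>, and it vanishes along the iterates of the killed kernel, because the killed
  process leaves every finite set and \<open>|z|\<^sup>l\<close> is small at high levels.  So the difference is zero,
  and at level 0 this says \<open>G v = z v\<close> (\<open>kernel_F_mat_eigenvector\<close>).  As \<open>G\<close> is substochastic, its
  eigenvalues have modulus at most 1, so \<open>F(z)\<close> is invertible for \<open>|z| < min |sp(G)|\<close>.  There its
  inverse is holomorphic, and the Taylor coefficients of the inverse satisfy the same recursion as \<open>W\<close>.

  The probabilistic input is \<open>expected_occupation\<close> and \<open>entrance_distribution\<close>: the expected
  occupation times of the process, and its place of entrance into a set, are expressed by the Green function of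
  the killed jump chain.  The rates are bounded, so the process does not explode.
\<close>

section \<open>Right-continuous paths and their jump times\<close>

text \<open>
  Right-continuity for the discrete topology, and a sufficient condition for the absence of explosion:
  infinitely many holding times exceed 1.
\<close>

definition right_cont :: "(real \<Rightarrow> 's) \<Rightarrow> bool" where
  "right_cont f \<longleftrightarrow> (\<forall>t\<ge>0. eventually (\<lambda>s. f s = f t) (at_right t))"

definition nonexplosive :: "(real \<Rightarrow> 's) \<Rightarrow> bool" where
  "nonexplosive f \<longleftrightarrow> (\<forall>a. \<exists>m\<ge>a. 1 < holding_time f m)"

text \<open>The first time in \<open>B\<close>; both \<open>hit_time\<close> and \<open>up_time\<close> are of this form.\<close>

definition entrance_time :: "(real \<Rightarrow> 's) \<Rightarrow> 's set \<Rightarrow> ereal" where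
  "entrance_time f B = Inf {ereal t | t. 0 \<le> t \<and> f t \<in> B}"

declare jump_time.simps(2) [simp del]

lemma jump_time_Suc_infinite [simp]:
  "jump_time f n = \<infinity> \<Longrightarrow> jump_time f (Suc n) = \<infinity>"
  by (simp add: jump_time.simps(2))

lemma right_contD:
  assumes "right_cont f" "0 \<le> t"
  obtains b where "t < b" "\<And>s. t \<le> s \<Longrightarrow> s < b \<Longrightarrow> f s = f t"
proof -
  have "eventually (\<lambda>s. f s = f t) (at_right t)"
    using assms by (auto simp: right_cont_def)
  then obtain b where "t < b" "\<forall>s>t. s < b \<longrightarrow> f s = f t"
    by (auto simp: eventually_at_right_field)
  then have "\<And>s. t \<le> s \<Longrightarrow> s < b \<Longrightarrow> f s = f t"
    by (metis order_le_less)
  with \<open>t < b\<close> that show thesis by blast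
qed

lemma jump_time_Suc_finite:
  assumes "right_cont f" "jump_time f n = ereal t" "0 \<le> t"
  shows "jump_time f n < jump_time f (Suc n)"
    and "t \<le> s \<Longrightarrow> ereal s < jump_time f (Suc n) \<Longrightarrow> f s = f t"
proof -
  let ?S = "{ereal u | u. ereal t \<le> ereal u \<and> f u \<noteq> f t}"
  have eq: "jump_time f (Suc n) = Inf ?S"
    using assms by (simp add: jump_time.simps(2))
  obtain b where b: "t < b" "\<And>s. t \<le> s \<Longrightarrow> s < b \<Longrightarrow> f s = f t"
    using right_contD assms by metis
  have "ereal t < ereal b" using b(1) by simp
  also have "ereal b \<le> Inf ?S"
    by (intro Inf_greatest) (clarsimp, meson b(2) leI)
  finally show "jump_time f n < jump_time f (Suc n)"
    unfolding eq assms(2) .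
  assume "t \<le> s" and less: "ereal s < jump_time f (Suc n)"
  show "f s = f t"
  proof (rule ccontr)
    assume "f s \<noteq> f t"
    then have "Inf ?S \<le> ereal s"
      using \<open>t \<le> s\<close> by (intro Inf_lower) auto
    with less show False unfolding eq by (meson not_le)
  qed
qed

lemma jump_time_nonneg:
  assumes "right_cont f" shows "0 \<le> jump_time f n"
proof (induction n)
  case (Suc n)
  show ?case
  proof (cases "jump_time f n = \<infinity>")
    case False
    then obtain t where "jump_time f n = ereal t" "0 \<le> t"
      using Suc by (cases "jump_time f n") auto
    with jump_time_Suc_finite(1)[OF assms this] Suc show ?thesis by order
  qed simp
qed simp

lemma jump_time_cases:
  assumes "right_cont f"
  obtains "jump_time f n = \<infinity>" | t where "jump_time f n = ereal t" "0 \<le> t"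
  using jump_time_nonneg[OF assms, of n] by (cases "jump_time f n") auto

lemma jump_time_mono:
  assumes "right_cont f" "m \<le> n" shows "jump_time f m \<le> jump_time f n"
proof -
  have "jump_time f n \<le> jump_time f (Suc n)" for n
  proof (cases rule: jump_time_cases[OF assms(1), of n])
    case 2
    then show ?thesis using jump_time_Suc_finite(1)[OF assms(1), of n] by (simp add: less_imp_le)
  qed simp
  then show ?thesis using \<open>m \<le> n\<close> by (rule lift_Suc_mono_le)
qed

lemma jump_chain_eq:
  "jump_time f n = ereal t \<Longrightarrow> jump_chain f n = f t"
  by (cases n) (auto)

lemma nonexplosive_interval:
  assumes f: "right_cont f" "nonexplosive f" and "0 \<le> t"
  obtains n where "jump_time f n \<le> ereal t" "ereal t < jump_time f (Suc n)"
proof -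
  have large: "\<exists>n. ereal (real N) \<le> jump_time f n" for N
  proof (induction N)
    case 0
    show ?case by (intro exI[of _ 0]) simp
  next
    case (Suc N)
    then obtain n where n: "ereal (real N) \<le> jump_time f n" ..
    obtain m where m: "n \<le> m" "1 < holding_time f m"
      using f(2) by (auto simp: nonexplosive_def)
    have le: "ereal (real N) \<le> jump_time f m"
      using n jump_time_mono[OF f(1) m(1)] by order
    show ?case
    proof (cases rule: jump_time_cases[OF f(1), of m])
      case 1
      then show ?thesis by (intro exI[of _ m]) simp
    next
      case (2 u)
      have "1 < jump_time f (Suc m) - jump_time f m"
        using m(2) 2 by (simp add: holding_time_def)
      then have "ereal (real (Suc N)) \<le> jump_time f (Suc m)"
        using le 2 by (cases "jump_time f (Suc m)") auto
      then show ?thesis ..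
    qed
  qed
  obtain N :: nat where "t < real N" using reals_Archimedean2 by blast
  with large[of N] obtain n0 where "ereal t < jump_time f n0"
    by (metis less_ereal.simps(1) order_less_le_trans)
  define n where "n = (LEAST n. ereal t < jump_time f n)"
  have n: "ereal t < jump_time f n" unfolding n_def by (rule LeastI) fact
  have "n \<noteq> 0" using n \<open>0 \<le> t\<close> by (intro notI) simp
  then obtain m where m: "n = Suc m" by (cases n) auto
  then have "\<not> ereal t < jump_time f m"
    unfolding n_def using not_less_Least by (metis lessI)
  with n m that[of m] show thesis by simp
qed

lemma entrance_time_attained:
  assumes f: "right_cont f" and h: "entrance_time f B = ereal t"
  shows "0 \<le> t" "f t \<in> B"
proof -
  let ?S = "{ereal t | t. 0 \<le> t \<and> f t \<in> B}"
  have "0 \<le> Inf ?S" by (intro Inf_greatest) auto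
  then show t: "0 \<le> t" using h by (simp add: entrance_time_def)
  obtain b where b: "t < b" "\<And>s. t \<le> s \<Longrightarrow> s < b \<Longrightarrow> f s = f t"
    using right_contD[OF f t] by metis
  have "Inf ?S < ereal b" using h b by (simp add: entrance_time_def)
  then obtain s where s: "0 \<le> s" "f s \<in> B" "s < b"
    by (auto simp: Inf_less_iff)
  have "Inf ?S \<le> ereal s" using s by (intro Inf_lower) auto
  then have "t \<le> s" using h by (simp add: entrance_time_def)
  with s b show "f t \<in> B" by metis
qed

lemma entrance_time_le:
  "0 \<le> t \<Longrightarrow> f t \<in> B \<Longrightarrow> entrance_time f B \<le> ereal t"
  unfolding entrance_time_def by (intro Inf_lower) auto

lemma value_on_interval:
  assumes f: "right_cont f" and n: "jump_time f n \<le> ereal t" "ereal t < jump_time f (Suc n)"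
  shows "f t = jump_chain f n"
proof (cases rule: jump_time_cases[OF f, of n])
  case 1
  then show ?thesis using n by auto
next
  case (2 u)
  then show ?thesis
    using n jump_time_Suc_finite(2)[OF f 2] jump_chain_eq[OF 2(1)]
    by simp
qed

text \<open>
  At a time outside \<open>B\<close>, the time is at most the entrance time into \<open>B\<close> exactly when the jump chain has
  avoided \<open>B\<close> so far.
\<close>

lemma le_entrance_time_iff:
  assumes f: "right_cont f" "nonexplosive f"
    and n: "jump_time f n \<le> ereal t" "ereal t < jump_time f (Suc n)" and "f t \<notin> B"
  shows "ereal t \<le> entrance_time f B \<longleftrightarrow> (\<forall>m\<le>n. jump_chain f m \<notin> B)"
proof
  assume le: "ereal t \<le> entrance_time f B"
  show "\<forall>m\<le>n. jump_chain f m \<notin> B"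
  proof (intro allI impI notI)
    fix m assume m: "m \<le> n" "jump_chain f m \<in> B"
    have mn: "jump_time f m \<le> ereal t"
      using jump_time_mono[OF f(1) m(1)] n(1) by order
    then obtain u where u: "jump_time f m = ereal u" "0 \<le> u"
      by (cases rule: jump_time_cases[OF f(1), of m]) auto
    have "f u \<in> B" using m(2) jump_chain_eq[OF u(1)] by simp
    from entrance_time_le[of u f B, OF u(2) this] le have "ereal t \<le> ereal u"
      by (rule order_trans[rotated])
    with mn u have "u = t" by simp
    with \<open>f u \<in> B\<close> \<open>f t \<notin> B\<close> show False by simp
  qed
next
  assume avoid: "\<forall>m\<le>n. jump_chain f m \<notin> B"
  show "ereal t \<le> entrance_time f B"
    unfolding entrance_time_def
  proof (rule Inf_greatest, clarify)
    fix s assume s: "0 \<le> s" "f s \<in> B"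
    obtain m where m: "jump_time f m \<le> ereal s" "ereal s < jump_time f (Suc m)"
      using nonexplosive_interval[OF f s(1)] .
    have "jump_chain f m \<in> B" using value_on_interval[OF f(1) m] s by simp
    then have "n < m" using avoid by (meson not_less)
    then have "jump_time f (Suc n) \<le> jump_time f m"
      by (intro jump_time_mono f) simp
    with m n show "ereal t \<le> ereal s" by order
  qed
qed

text \<open>
  The length of the \<open>n\<close>-th visit.  Unlike \<open>holding_time\<close>, it is 0 once the last jump has happened and
  \<open>jump_time f n = \<infinity>\<close>.
\<close>

definition sojourn :: "(real \<Rightarrow> 's) \<Rightarrow> nat \<Rightarrow> ennreal" where
  "sojourn f n = emeasure lborel {s. jump_time f n \<le> ereal s \<and> ereal s < jump_time f (Suc n)}"

lemma sets_ereal_interval [measurable]: "{s::real. a \<le> ereal s \<and> ereal s < b} \<in> sets borel"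
  by measurable

lemma occupation_eq_suminf:
  assumes f: "right_cont f" "nonexplosive f" and "y \<notin> B"
  shows "(\<integral>\<^sup>+ s. indicator {s. 0 \<le> s \<and> ereal s \<le> entrance_time f B \<and> f s = y} s \<partial>lborel)
    = (\<Sum>n. if jump_chain f n = y \<and> (\<forall>m\<le>n. jump_chain f m \<notin> B) then sojourn f n else 0)"
proof -
  let ?I = "\<lambda>n. {s. jump_time f n \<le> ereal s \<and> ereal s < jump_time f (Suc n)}"
  let ?good = "\<lambda>n. jump_chain f n = y \<and> (\<forall>m\<le>n. jump_chain f m \<notin> B)"
  let ?X = "{s. 0 \<le> s \<and> ereal s \<le> entrance_time f B \<and> f s = y}"
  define U where "U n = (if ?good n then ?I n else {})" for n
  have disj: "disjoint_family U"
  proof -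
    have "U m \<inter> U n = {}" if "m < n" for m n
    proof -
      have "jump_time f (Suc m) \<le> jump_time f n"
        using that by (intro jump_time_mono f) simp
      then show ?thesis by (auto simp: U_def)
    qed
    then show ?thesis unfolding disjoint_family_on_def
      by (metis inf_commute linorder_neqE_nat)
  qed
  have eq: "?X = (\<Union>n. U n)"
  proof (intro equalityI subsetI)
    fix s assume "s \<in> ?X"
    then have s: "0 \<le> s" "ereal s \<le> entrance_time f B" "f s = y" by auto
    obtain n where n: "jump_time f n \<le> ereal s" "ereal s < jump_time f (Suc n)"
      using nonexplosive_interval[OF f s(1)] .
    have "?good n"
      using le_entrance_time_iff[OF f n, of B] value_on_interval[OF f(1) n] s \<open>y \<notin> B\<close> by simp
    then show "s \<in> (\<Union>n. U n)" using n by (auto simp: U_def)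
  next
    fix s assume "s \<in> (\<Union>n. U n)"
    then obtain n where n: "?good n" "jump_time f n \<le> ereal s" "ereal s < jump_time f (Suc n)"
      by (auto simp: U_def split: if_splits)
    have "0 \<le> ereal s" using jump_time_nonneg[OF f(1), of n] n by order
    then show "s \<in> ?X"
      using le_entrance_time_iff[OF f n(2,3), of B] value_on_interval[OF f(1) n(2,3)] n(1) \<open>y \<notin> B\<close>
      by simp
  qed
  have [measurable]: "U n \<in> sets borel" for n by (simp add: U_def)
  have "(\<integral>\<^sup>+ s. indicator ?X s \<partial>lborel) = emeasure lborel (\<Union>n. U n)"
    unfolding eq by (rule nn_integral_indicator) simp
  also have "\<dots> = (\<Sum>n. emeasure lborel (U n))"
    by (rule suminf_emeasure[symmetric]) (auto simp: disj)
  also have "(\<lambda>n. emeasure lborel (U n)) = (\<lambda>n. if ?good n then sojourn f n else 0)"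
    unfolding U_def sojourn_def if_distrib[of "emeasure lborel"] emeasure_empty by (rule refl)
  finally show ?thesis .
qed

lemma sojourn_eq_holding_time:
  assumes f: "right_cont f" and fin: "jump_time f n \<noteq> \<infinity>"
  shows "sojourn f n = (\<integral>\<^sup>+ u. indicator {u. 0 \<le> u \<and> ereal u < holding_time f n} u \<partial>lborel)"
proof -
  obtain t where t: "jump_time f n = ereal t"
    using fin by (cases rule: jump_time_cases[OF f, of n]) auto
  have ht: "holding_time f n = jump_time f (Suc n) - ereal t"
    by (simp add: holding_time_def t)
  let ?I = "{s. jump_time f n \<le> ereal s \<and> ereal s < jump_time f (Suc n)}"
  have "sojourn f n = emeasure (distr lborel borel ((+) t)) ?I"
    unfolding sojourn_def using lborel_distr_plus[of t] by simp
  also have "\<dots> = emeasure lborel ((+) t -` ?I \<inter> space lborel)"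
    by (rule emeasure_distr) auto
  also have "(+) t -` ?I \<inter> space lborel = {u. 0 \<le> u \<and> ereal u < holding_time f n}"
    unfolding ht t
    by (cases "jump_time f (Suc n)") auto
  also have "emeasure lborel {u. 0 \<le> u \<and> ereal u < holding_time f n}
      = (\<integral>\<^sup>+ u. indicator {u. 0 \<le> u \<and> ereal u < holding_time f n} u \<partial>lborel)"
    by (rule nn_integral_indicator[symmetric]) measurable
  finally show ?thesis .
qed

lemma entrance_time_eq_jump_time:
  assumes f: "right_cont f" "nonexplosive f"
    and n: "jump_chain f n \<in> B" "\<forall>m<n. jump_chain f m \<notin> B"
  shows "jump_time f n \<noteq> \<infinity>" "entrance_time f B = jump_time f n"
proof -
  show fin: "jump_time f n \<noteq> \<infinity>"
  proof
    assume inf: "jump_time f n = \<infinity>"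
    then obtain m where m: "n = Suc m" by (cases n) auto
    with inf have "jump_chain f n = jump_chain f m" by simp
    with n m show False by auto
  qed
  then obtain t where t: "jump_time f n = ereal t" "0 \<le> t"
    using fin by (cases rule: jump_time_cases[OF f(1), of n]) auto
  have "entrance_time f B \<le> jump_time f n"
    using entrance_time_le[of t f B] n(1) jump_chain_eq[OF t(1)] t by simp
  moreover have "jump_time f n \<le> entrance_time f B"
    unfolding entrance_time_def
  proof (rule Inf_greatest, clarify)
    fix s assume s: "0 \<le> s" "f s \<in> B"
    obtain m where m: "jump_time f m \<le> ereal s" "ereal s < jump_time f (Suc m)"
      using nonexplosive_interval[OF f s(1)] .
    have "jump_chain f m \<in> B" using value_on_interval[OF f(1) m] s by simp
    then have "n \<le> m" using n(2) by (meson not_less)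
    then have "jump_time f n \<le> jump_time f m"
      by (intro jump_time_mono f)
    with m show "jump_time f n \<le> ereal s" by order
  qed
  ultimately show "entrance_time f B = jump_time f n" by order
qed

lemma entrance_place_iff:
  assumes f: "right_cont f" "nonexplosive f" and "y \<in> B"
  shows "entrance_time f B < \<infinity> \<and> f (real_of_ereal (entrance_time f B)) = y \<longleftrightarrow>
    (\<exists>n. jump_chain f n = y \<and> (\<forall>m<n. jump_chain f m \<notin> B))"
proof
  assume h: "entrance_time f B < \<infinity> \<and> f (real_of_ereal (entrance_time f B)) = y"
  have "0 \<le> entrance_time f B"
    unfolding entrance_time_def by (intro Inf_greatest) auto
  with h obtain t where t: "entrance_time f B = ereal t"
    by (cases "entrance_time f B") auto
  note ft = entrance_time_attained[OF f(1) t]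
  obtain n where n: "jump_time f n \<le> ereal t" "ereal t < jump_time f (Suc n)"
    using nonexplosive_interval[OF f ft(1)] .
  have "jump_chain f n \<in> B" using value_on_interval[OF f(1) n] ft by simp
  define k where "k = (LEAST k. jump_chain f k \<in> B)"
  have k: "jump_chain f k \<in> B" unfolding k_def by (rule LeastI) fact
  have k': "\<forall>m<k. jump_chain f m \<notin> B" unfolding k_def using not_less_Least by blast
  have "jump_time f k = ereal t" using entrance_time_eq_jump_time(2)[OF f k k'] t by simp
  then have "jump_chain f k = y" using jump_chain_eq[of f k t] h t by simp
  with k' show "\<exists>n. jump_chain f n = y \<and> (\<forall>m<n. jump_chain f m \<notin> B)" by blast
next
  assume "\<exists>n. jump_chain f n = y \<and> (\<forall>m<n. jump_chain f m \<notin> B)"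
  then obtain n where n: "jump_chain f n = y" "\<forall>m<n. jump_chain f m \<notin> B" by blast
  with \<open>y \<in> B\<close> have "jump_chain f n \<in> B" by simp
  note e = entrance_time_eq_jump_time[OF f this n(2)]
  then obtain t where t: "jump_time f n = ereal t" "0 \<le> t"
    using e(1) by (cases rule: jump_time_cases[OF f(1), of n]) auto
  show "entrance_time f B < \<infinity> \<and> f (real_of_ereal (entrance_time f B)) = y"
    using e(2) t jump_chain_eq[OF t(1)] n(1) by simp
qed

section \<open>Green functions of nonnegative kernels\<close>

text \<open>
  Sums over countable types are written as integrals with respect to the counting measure, so that
  they can be interchanged without convergence conditions.
\<close>

abbreviation csum :: "('s \<Rightarrow> ennreal) \<Rightarrow> ennreal" where
  "csum f \<equiv> (\<integral>\<^sup>+ z. f z \<partial>count_space UNIV)"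

text \<open>Powers of a kernel, its Green function, and its restriction to a domain.\<close>

primrec kpow :: "('s \<Rightarrow> 's \<Rightarrow> ennreal) \<Rightarrow> nat \<Rightarrow> 's \<Rightarrow> 's \<Rightarrow> ennreal" where
  "kpow K 0 x y = (if x = y then 1 else 0)"
| "kpow K (Suc n) x y = csum (\<lambda>z. kpow K n x z * K z y)"

definition green :: "('s \<Rightarrow> 's \<Rightarrow> ennreal) \<Rightarrow> 's \<Rightarrow> 's \<Rightarrow> ennreal" where
  "green K x y = (\<Sum>n. kpow K n x y)"

definition killed :: "('s \<Rightarrow> 's \<Rightarrow> ennreal) \<Rightarrow> 's set \<Rightarrow> 's \<Rightarrow> 's \<Rightarrow> ennreal" where
  "killed K D x y = (if x \<in> D \<and> y \<in> D then K x y else 0)"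

lemma csum_swap:
  fixes f :: "'s::countable \<Rightarrow> 't \<Rightarrow> ennreal"
  shows "csum (\<lambda>y. csum (\<lambda>x. f x y)) = csum (\<lambda>x. csum (f x))"
  by (rule nn_integral_count_space_nn_integral) auto

lemma csum_cmult: "csum (\<lambda>z. c * f z) = c * csum f"
  by (rule nn_integral_cmult) simp

lemma csum_multc: "csum (\<lambda>z. f z * c) = csum f * c"
  by (rule nn_integral_multc) simp

lemma csum_add: "csum (\<lambda>z. f z + g z) = csum f + csum g"
  by (rule nn_integral_add) auto

lemma csum_suminf: "csum (\<lambda>z. \<Sum>n. f n z) = (\<Sum>n. csum (f n))"
  by (rule nn_integral_suminf) simp

lemma csum_finite_support:
  assumes "finite S" "\<And>z. z \<notin> S \<Longrightarrow> f z = 0"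
  shows "csum f = sum f S"
  using assms by (intro nn_integral_count_space') auto

lemma csum_delta: "csum (\<lambda>z. (if x = z then 1 else 0) * f z) = f x"
proof -
  have "csum (\<lambda>z. (if x = z then 1 else 0) * f z) = (\<Sum>z\<in>{x}. (if x = z then 1 else 0) * f z)"
    by (rule csum_finite_support) auto
  then show ?thesis by simp
qed

lemma csum_mult_assoc:
  fixes a :: "'s::countable \<Rightarrow> ennreal"
  shows "csum (\<lambda>z. csum (\<lambda>u. a u * k u z) * b z) = csum (\<lambda>u. a u * csum (\<lambda>z. k u z * b z))"
proof -
  have "csum (\<lambda>z. csum (\<lambda>u. a u * k u z) * b z) = csum (\<lambda>z. csum (\<lambda>u. a u * (k u z * b z)))"
    by (simp add: csum_multc[symmetric] mult.assoc)
  also have "\<dots> = csum (\<lambda>u. csum (\<lambda>z. a u * (k u z * b z)))"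
    by (rule csum_swap)
  finally show ?thesis by (simp add: csum_cmult)
qed

lemma kpow_Suc_left:
  fixes K :: "'s::countable \<Rightarrow> 's \<Rightarrow> ennreal"
  shows "kpow K (Suc n) x y = csum (\<lambda>z. K x z * kpow K n z y)"
proof (induction n arbitrary: y)
  case 0
  have "csum (\<lambda>z. K x z * kpow K 0 z y) = csum (\<lambda>z. (if y = z then 1 else 0) * K x z)"
    by (intro nn_integral_cong) auto
  then show ?case by (simp add: csum_delta)
next
  case (Suc n)
  have "kpow K (Suc (Suc n)) x y = csum (\<lambda>z. csum (\<lambda>u. K x u * kpow K n u z) * K z y)"
    by (subst kpow.simps(2)) (simp only: Suc.IH)
  then show ?case by (simp add: csum_mult_assoc)
qed

lemma suminf_split_first:
  fixes f :: "nat \<Rightarrow> ennreal"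
  shows "(\<Sum>n. f n) = f 0 + (\<Sum>n. f (Suc n))"
  using suminf_offset[of f 1] by (simp add: add.commute)

lemma green_forward:
  fixes K :: "'s::countable \<Rightarrow> 's \<Rightarrow> ennreal"
  shows "green K x y = (if x = y then 1 else 0) + csum (\<lambda>z. green K x z * K z y)"
  unfolding green_def
  by (subst suminf_split_first)
     (simp add: csum_suminf[symmetric])

lemma green_backward:
  fixes K :: "'s::countable \<Rightarrow> 's \<Rightarrow> ennreal"
  shows "green K x y = (if x = y then 1 else 0) + csum (\<lambda>z. K x z * green K z y)"
  unfolding green_def
  by (subst suminf_split_first)
     (simp add: csum_suminf[symmetric] kpow_Suc_left del: kpow.simps(2))

text \<open>
  The Green function applied to a source is the least solution of the Poisson inequality, for measures
  (kernel acting from the right) and for functions (kernel acting from the left).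
\<close>

lemma green_minimal_measure:
  fixes K :: "'s::countable \<Rightarrow> 's \<Rightarrow> ennreal"
  assumes super: "\<And>y. \<mu> y + csum (\<lambda>z. \<nu> z * K z y) \<le> \<nu> y"
  shows "csum (\<lambda>z. \<mu> z * green K z y) \<le> \<nu> y"
proof -
  have partial: "(\<Sum>k<n. csum (\<lambda>z. \<mu> z * kpow K k z y)) \<le> \<nu> y" for n y
  proof (induction n arbitrary: y)
    case (Suc n)
    have *: "csum (\<lambda>z. \<mu> z * kpow K (Suc k) z y)
        = csum (\<lambda>u. csum (\<lambda>z. \<mu> z * kpow K k z u) * K u y)" for k
      by (simp add: csum_mult_assoc)
    have z: "csum (\<lambda>z. \<mu> z * kpow K 0 z y) = \<mu> y"
    proof -
      have "csum (\<lambda>z. \<mu> z * kpow K 0 z y) = csum (\<lambda>z. (if y = z then 1 else 0) * \<mu> z)"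
        by (intro nn_integral_cong) auto
      then show ?thesis by (simp add: csum_delta)
    qed
    have "(\<Sum>k<Suc n. csum (\<lambda>z. \<mu> z * kpow K k z y))
        = \<mu> y + (\<Sum>k<n. csum (\<lambda>z. \<mu> z * kpow K (Suc k) z y))"
      by (simp only: sum.lessThan_Suc_shift z)
    also have "(\<Sum>k<n. csum (\<lambda>z. \<mu> z * kpow K (Suc k) z y))
        = csum (\<lambda>u. (\<Sum>k<n. csum (\<lambda>z. \<mu> z * kpow K k z u)) * K u y)"
      unfolding * by (simp add: sum_distrib_right nn_integral_sum)
    also have "\<dots> \<le> csum (\<lambda>u. \<nu> u * K u y)"
      by (intro nn_integral_mono mult_right_mono Suc.IH) simp
    finally show ?case using super[of y] by (meson add_left_mono order_trans)
  qed simp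
  have "csum (\<lambda>z. \<mu> z * green K z y) = (\<Sum>k. csum (\<lambda>z. \<mu> z * kpow K k z y))"
    unfolding green_def by (simp add: csum_suminf[symmetric])
  also have "\<dots> \<le> \<nu> y" by (intro suminf_le_const summableI partial)
  finally show ?thesis .
qed

lemma green_minimal_function:
  fixes K :: "'s::countable \<Rightarrow> 's \<Rightarrow> ennreal"
  assumes super: "\<And>x. h x + csum (\<lambda>z. K x z * f z) \<le> f x"
  shows "csum (\<lambda>z. green K x z * h z) \<le> f x"
proof -
  have partial: "(\<Sum>k<n. csum (\<lambda>z. kpow K k x z * h z)) \<le> f x" for n x
  proof (induction n arbitrary: x)
    case (Suc n)
    have *: "csum (\<lambda>z. kpow K (Suc k) x z * h z)
        = csum (\<lambda>u. K x u * csum (\<lambda>z. kpow K k u z * h z))" for k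
      by (simp add: csum_mult_assoc kpow_Suc_left del: kpow.simps(2))
    have "(\<Sum>k<Suc n. csum (\<lambda>z. kpow K k x z * h z))
        = csum (\<lambda>z. kpow K 0 x z * h z) + (\<Sum>k<n. csum (\<lambda>z. kpow K (Suc k) x z * h z))"
      by (simp only: sum.lessThan_Suc_shift)
    also have "csum (\<lambda>z. kpow K 0 x z * h z) = h x"
      by (simp add: csum_delta)
    also have "(\<Sum>k<n. csum (\<lambda>z. kpow K (Suc k) x z * h z))
        = csum (\<lambda>u. K x u * (\<Sum>k<n. csum (\<lambda>z. kpow K k u z * h z)))"
      unfolding * by (simp add: sum_distrib_left nn_integral_sum)
    also have "\<dots> \<le> csum (\<lambda>u. K x u * f u)"
      by (intro nn_integral_mono mult_left_mono Suc.IH) simp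
    finally show ?case using super[of x] by (meson add_left_mono order_trans)
  qed simp
  have "csum (\<lambda>z. green K x z * h z) = (\<Sum>k. csum (\<lambda>z. kpow K k x z * h z))"
    unfolding green_def by (simp add: csum_suminf[symmetric])
  also have "\<dots> \<le> f x" by (intro suminf_le_const summableI partial)
  finally show ?thesis .
qed

text \<open>Finiteness of the Green function at \<open>w\<close> propagates to the states that lead to \<open>w\<close>.\<close>

lemma green_finite_along_path:
  fixes K :: "'s::countable \<Rightarrow> 's \<Rightarrow> ennreal"
  assumes "(y, w) \<in> {(u, v). K u v > 0}\<^sup>*" and "green K x w < \<infinity>"
  shows "green K x y < \<infinity>"
  using assms
proof (induction rule: converse_rtrancl_induct)
  case (step u v)
  then have fin: "green K x v < \<infinity>" and pos: "K u v > 0" by auto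
  have "green K x u * K u v \<le> csum (\<lambda>z. green K x z * K z v)"
    by (rule nn_integral_ge_point) simp
  also have "\<dots> \<le> green K x v"
    by (subst (2) green_forward) simp
  finally have "green K x u * K u v < \<infinity>" using fin by simp
  with pos show ?case by (auto simp: ennreal_mult_less_top less_top)
qed

text \<open>A state from which the kernel loses mass has a finite Green function.\<close>

lemma green_finite_at_leak:
  fixes K :: "'s::countable \<Rightarrow> 's \<Rightarrow> ennreal"
  assumes sub: "\<And>x. csum (K x) \<le> 1" and leak: "csum (K w) < 1"
  shows "green K x w < \<infinity>"
proof -
  define h where "h z = (if w = z then 1 else 0) * (1 - csum (K w))" for z
  have "csum (\<lambda>z. green K x z * h z) \<le> 1"
  proof (rule green_minimal_function)
    fix x show "h x + csum (\<lambda>z. K x z * 1) \<le> 1"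
      using sub[of x] leak
      by (auto simp: h_def) (metis add.commute add_diff_inverse_ennreal less_imp_le order_refl)
  qed
  moreover have "csum (\<lambda>z. green K x z * h z) = green K x w * (1 - csum (K w))"
  proof -
    have "csum (\<lambda>z. green K x z * h z)
        = csum (\<lambda>z. (if w = z then 1 else 0) * (green K x z * (1 - csum (K w))))"
      by (intro nn_integral_cong) (simp add: h_def)
    then show ?thesis by (simp add: csum_delta)
  qed
  ultimately have "green K x w * (1 - csum (K w)) < \<infinity>"
    by (metis ennreal_one_less_top infinity_ennreal_def order_le_less_trans)
  moreover have "1 - csum (K w) > 0" using leak by (simp add: diff_gr0_ennreal)
  ultimately show ?thesis by (auto simp: ennreal_mult_less_top less_top)
qed

lemma killed_kpow_outside:
  assumes "y \<notin> D" "x \<in> D" shows "kpow (killed K D) n x y = 0"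
  using assms by (cases n) (auto simp: killed_def)

text \<open>
  Last-exit decomposition: a path from outside \<open>D'\<close> to a state of \<open>D'\<close> enters
  \<open>D'\<close> for a last time.
\<close>

lemma last_exit_decomposition:
  fixes K :: "'s::countable \<Rightarrow> 's \<Rightarrow> ennreal"
  assumes "D' \<subseteq> D" "x \<in> D - D'" "y \<in> D'"
  defines "src \<equiv> \<lambda>u. if u \<in> D' then csum (\<lambda>z. if z \<in> D - D' then green (killed K D) x z * K z u else 0) else 0"
  shows "green (killed K D) x y = csum (\<lambda>u. src u * green (killed K D') u y)"
proof (rule antisym)
  let ?G = "green (killed K D)" and ?G' = "green (killed K D')"
  let ?s = "\<lambda>u. csum (\<lambda>z. src z * ?G' z u)"
  have split: "csum (\<lambda>z. g z * killed K D z u)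
      = src' u + csum (\<lambda>z. g z * killed K D' z u)"
    if "u \<in> D'" "src' u = csum (\<lambda>z. if z \<in> D - D' then g z * K z u else 0)" for g u src'
    unfolding that csum_add[symmetric] using that(1) \<open>D' \<subseteq> D\<close>
    by (intro nn_integral_cong) (auto simp: killed_def)
  \<comment> \<open>Restricted to \<open>D'\<close>, the Green measure solves the forward equation with source \<open>src\<close>.\<close>
  have eqG: "?G x u = src u + csum (\<lambda>z. ?G x z * killed K D' z u)" if "u \<in> D'" for u
  proof -
    have "?G x u = csum (\<lambda>z. ?G x z * killed K D z u)"
      using that assms by (subst green_forward) auto
    also have "\<dots> = src u + csum (\<lambda>z. ?G x z * killed K D' z u)"
      by (rule split[OF that]) (simp add: src_def that)
    finally show ?thesis .
  qed
  have le: "?s u \<le> ?G x u" for u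
  proof (rule green_minimal_measure)
    fix u
    show "src u + csum (\<lambda>z. ?G x z * killed K D' z u) \<le> ?G x u"
    proof (cases "u \<in> D'")
      case True then show ?thesis using eqG by simp
    qed (simp add: src_def killed_def)
  qed
  then show "?s y \<le> ?G x y" .
  \<comment> \<open>Conversely, gluing the two sides along \<open>D'\<close> gives a supersolution on all of \<open>D\<close>.\<close>
  define \<nu> where "\<nu> u = (if u \<in> D' then ?s u else ?G x u)" for u
  have "csum (\<lambda>z. (if x = z then 1 else 0) * ?G z y) \<le> \<nu> y"
  proof (rule green_minimal_measure)
    fix u
    show "(if x = u then 1 else 0) + csum (\<lambda>z. \<nu> z * killed K D z u) \<le> \<nu> u"
    proof (cases "u \<in> D'")
      case True
      have "csum (\<lambda>z. \<nu> z * killed K D z u) = src u + csum (\<lambda>z. \<nu> z * killed K D' z u)"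
        by (rule split[OF True]) (auto simp: src_def True \<nu>_def intro!: nn_integral_cong)
      also have "csum (\<lambda>z. \<nu> z * killed K D' z u) = csum (\<lambda>z. ?s z * killed K D' z u)"
        by (intro nn_integral_cong) (auto simp: \<nu>_def killed_def)
      also have "\<dots> = csum (\<lambda>z. src z * csum (\<lambda>v. ?G' z v * killed K D' v u))"
        by (rule csum_mult_assoc)
      also have "src u + \<dots> = csum (\<lambda>z. src z * ((if z = u then 1 else 0) + csum (\<lambda>v. ?G' z v * killed K D' v u)))"
      proof -
        have "src u = csum (\<lambda>z. (if u = z then 1 else 0) * src z)" by (simp add: csum_delta)
        also have "\<dots> = csum (\<lambda>z. src z * (if z = u then 1 else 0))"
          by (intro nn_integral_cong) auto
        finally show ?thesis by (simp add: distrib_left csum_add)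
      qed
      also have "\<dots> = ?s u"
        by (subst green_forward[symmetric]) (rule refl)
      finally show ?thesis using True assms by (auto simp: \<nu>_def)
    next
      case False
      have "(if x = u then 1 else 0) + csum (\<lambda>z. \<nu> z * killed K D z u)
          \<le> (if x = u then 1 else 0) + csum (\<lambda>z. ?G x z * killed K D z u)"
        using le by (intro add_left_mono nn_integral_mono mult_right_mono) (auto simp: \<nu>_def)
      also have "\<dots> = ?G x u" by (rule green_forward[symmetric])
      finally show ?thesis using False by (simp add: \<nu>_def)
    qed
  qed
  then show "?G x y \<le> ?s y" using \<open>y \<in> D'\<close> by (simp add: csum_delta \<nu>_def)
qed

text \<open>
  Two domains give the same potentials of \<open>b\<close> if each excess state cannot be reached in one step from \<open>D'\<close> or
  does not lead to the support of \<open>b\<close>.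
\<close>

lemma kpow_killed_cong:
  fixes K :: "'s::countable \<Rightarrow> 's \<Rightarrow> ennreal"
  assumes "D' \<subseteq> D"
    and irrelevant: "\<And>x z n. x \<in> D' \<Longrightarrow> z \<in> D - D' \<Longrightarrow> K x z = 0 \<or> csum (\<lambda>u. kpow (killed K D) n z u * b u) = 0"
    and "x \<in> D'"
  shows "csum (\<lambda>u. kpow (killed K D) n x u * b u) = csum (\<lambda>u. kpow (killed K D') n x u * b u)"
  using \<open>x \<in> D'\<close>
proof (induction n arbitrary: x)
  case (Suc n)
  have step: "csum (\<lambda>u. kpow (killed K E) (Suc n) x u * b u)
      = csum (\<lambda>z. killed K E x z * csum (\<lambda>u. kpow (killed K E) n z u * b u))" for E
    unfolding kpow_Suc_left by (rule csum_mult_assoc)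
  show ?case
    unfolding step
  proof (intro nn_integral_cong)
    fix z
    show "killed K D x z * csum (\<lambda>u. kpow (killed K D) n z u * b u)
        = killed K D' x z * csum (\<lambda>u. kpow (killed K D') n z u * b u)"
      using Suc.prems Suc.IH[of z] irrelevant[of x z n] \<open>D' \<subseteq> D\<close>
      by (auto simp: killed_def[of K D x z] killed_def[of K D' x z])
  qed
qed simp

section \<open>The law of the jump chain\<close>

lemma csum_reindex:
  assumes "inj h" "\<And>z. z \<notin> range h \<Longrightarrow> f z = 0"
  shows "csum f = csum (\<lambda>z. f (h z))"
proof -
  have "csum f = (\<integral>\<^sup>+ z. f z \<partial>count_space (range h))"
    using assms(2) by (auto simp: nn_integral_count_space_indicator indicator_def intro!: nn_integral_cong)
  also have "\<dots> = csum (\<lambda>z. f (h z))"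
    using assms(1) by (intro nn_integral_bij_count_space[symmetric] inj_on_imp_bij_betw)
  finally show ?thesis .
qed

lemma csum_restrict: "(\<integral>\<^sup>+ z. f z \<partial>count_space A) = csum (\<lambda>z. if z \<in> A then f z else 0)"
proof -
  have "(\<integral>\<^sup>+ z. f z \<partial>count_space A) = csum (\<lambda>z. f z * indicator A z)"
    by (rule nn_integral_count_space_indicator) (simp add: NO_MATCH_def)
  also have "\<dots> = csum (\<lambda>z. if z \<in> A then f z else 0)"
    by (rule nn_integral_cong) simp
  finally show ?thesis .
qed

lemma holding_time_pos:
  assumes "right_cont f" shows "0 < holding_time f n"
proof (cases rule: jump_time_cases[OF assms, of n])
  case (2 t)
  with jump_time_Suc_finite(1)[OF assms this] show ?thesis
    by (cases "jump_time f (Suc n)") (auto simp: holding_time_def)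
qed (simp add: holding_time_def)

text \<open>A Markov chain on a countable set with bounded rates and a stochastic jump matrix.\<close>

locale bounded_chain =
  fixes M :: "'w measure" and Z :: "real \<Rightarrow> 'w \<Rightarrow> 's::countable"
    and q :: "'s \<Rightarrow> 's \<Rightarrow> real" and x :: 's and \<Lambda> :: real
  assumes chain: "markov_chain M Z q x"
    and rate: "\<And>y. q y y \<le> 0" "\<And>y. - q y y \<le> \<Lambda>"
    and jump_nonneg: "\<And>y z. 0 \<le> jump_prob q y z"
    and jump_sum: "\<And>y. csum (\<lambda>z. ennreal (jump_prob q y z)) = 1"
begin

abbreviation "path_of \<omega> \<equiv> (\<lambda>t. Z t \<omega>)"
abbreviation "Y n \<omega> \<equiv> jump_chain (path_of \<omega>) n"
abbreviation "H n \<omega> \<equiv> holding_time (path_of \<omega>) n"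
abbreviation "p y z \<equiv> ennreal (jump_prob q y z)"

sublocale prob_space M
  using chain by (simp add: markov_chain_def)

lemma right_cont_path: "\<omega> \<in> space M \<Longrightarrow> right_cont (path_of \<omega>)"
  using chain by (simp add: markov_chain_def right_cont_def)

text \<open>
  The probability that the jump chain starts with the path \<open>l\<close>, and the event that it does while the
  \<open>m\<close>-th holding time exceeds \<open>s m\<close>.  Paths are nonempty lists of states.
\<close>

definition weight :: "'s list \<Rightarrow> real" where
  "weight l = (if hd l = x then 1 else 0) * (\<Prod>m<length l - 1. jump_prob q (l ! m) (l ! Suc m))"

definition cyl :: "'s list \<Rightarrow> (nat \<Rightarrow> real) \<Rightarrow> 'w set" where
  "cyl l s = {\<omega> \<in> space M. \<forall>m<length l. Y m \<omega> = l ! m \<and> ereal (s m) < H m \<omega>}"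

lemma weight_nonneg: "0 \<le> weight l"
  by (auto simp: weight_def intro!: prod_nonneg jump_nonneg)

lemma weight_single: "weight [y] = (if y = x then 1 else 0)"
  by (simp add: weight_def)

lemma weight_snoc:
  assumes "l \<noteq> []" shows "weight (l @ [z]) = weight l * jump_prob q (last l) z"
proof -
  obtain n where n: "length l = Suc n" using assms by (cases l) auto
  have "(\<Prod>m<Suc n. jump_prob q ((l @ [z]) ! m) ((l @ [z]) ! Suc m))
      = (\<Prod>m<n. jump_prob q (l ! m) (l ! Suc m)) * jump_prob q (last l) z"
    using n by (simp add: nth_append last_conv_nth assms)
  then show ?thesis using n assms by (simp add: weight_def)
qed

lemma prob_cyl:
  assumes "l \<noteq> []" "\<And>m. m < length l \<Longrightarrow> 0 \<le> s m"
  shows "prob (cyl l s) = weight l * (\<Prod>m<length l. exp (q (l ! m) (l ! m) * s m))"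
proof -
  obtain n where n: "length l = Suc n" using assms by (cases l) auto
  have "prob {\<omega> \<in> space M. \<forall>m\<le>n. Y m \<omega> = l ! m \<and> ereal (s m) < H m \<omega>}
     = (if l ! 0 = x then 1 else 0)
          * (\<Prod>m<n. jump_prob q (l ! m) (l ! Suc m))
          * (\<Prod>m\<le>n. exp (q (l ! m) (l ! m) * s m))"
    using chain assms(2) n by (simp add: markov_chain_def less_Suc_eq_le)
  then show ?thesis
    using n assms(1) by (simp add: cyl_def weight_def less_Suc_eq_le lessThan_Suc_atMost hd_conv_nth)
qed

text \<open>
  Cylinders of positive probability are measurable, and the others do not matter; thus the
  measurability of the jump times is not needed.
\<close>

lemma cyl_measurable:
  assumes "l \<noteq> []" "weight l > 0" "\<And>m. m < length l \<Longrightarrow> 0 \<le> s m"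
  shows "cyl l s \<in> events"
proof (rule ccontr)
  assume "cyl l s \<notin> events"
  then have "prob (cyl l s) = 0" by (rule measure_notin_sets)
  moreover have "prob (cyl l s) > 0"
    using prob_cyl[OF assms(1,3)] assms(2) by (simp add: prod_pos)
  ultimately show False by simp
qed

lemma emeasure_cyl_0:
  "l \<noteq> [] \<Longrightarrow> emeasure M (cyl l (\<lambda>_. 0)) = ennreal (weight l)"
  using prob_cyl[of l "\<lambda>_. 0"] by (simp add: emeasure_eq_measure)

lemma cyl_0_iff:
  assumes "\<omega> \<in> space M" "length l = Suc n"
  shows "\<omega> \<in> cyl l (\<lambda>_. 0) \<longleftrightarrow> l = map (\<lambda>m. Y m \<omega>) [0..<Suc n]"
proof -
  have "0 < H m \<omega>" for m using holding_time_pos right_cont_path assms(1) by blast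
  then show ?thesis using assms
    by (auto simp: cyl_def list_eq_iff_nth_eq zero_ereal_def[symmetric] simp del: upt_Suc)
qed

lemma cyl_disjoint:
  assumes "\<And>l. l \<in> T \<Longrightarrow> length l = Suc n"
  shows "disjoint_family_on (\<lambda>l. cyl l (\<lambda>_. 0)) T"
  unfolding disjoint_family_on_def
proof (intro ballI impI, rule ccontr)
  fix l l' assume l: "l \<in> T" "l' \<in> T" "l \<noteq> l'" "cyl l (\<lambda>_. 0) \<inter> cyl l' (\<lambda>_. 0) \<noteq> {}"
  then obtain \<omega> where "\<omega> \<in> cyl l (\<lambda>_. 0)" "\<omega> \<in> cyl l' (\<lambda>_. 0)" by blast
  moreover have "\<omega> \<in> space M" using calculation by (simp add: cyl_def)
  ultimately show False using l assms cyl_0_iff by metis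
qed

lemma cyl_update:
  assumes "k < length l" "s k \<le> r"
  shows "\<omega> \<in> cyl l (s(k := r)) \<longleftrightarrow> \<omega> \<in> cyl l s \<and> ereal r < H k \<omega>"
proof -
  have "ereal (s k) < H k \<omega>" if "ereal r < H k \<omega>"
    using that assms(2) by (meson ereal_less_eq(3) order_le_less_trans)
  then have "(ereal ((s(k := r)) m) < H m \<omega>) \<longleftrightarrow>
      (ereal (s m) < H m \<omega> \<and> (m = k \<longrightarrow> ereal r < H k \<omega>))" for m
    by (cases "m = k") auto
  then show ?thesis using assms(1) unfolding cyl_def by blast
qed

text \<open>Summing the weights of the paths inside \<open>D\<close> gives the powers of the restricted jump matrix.\<close>

lemma weight_sum:
  assumes "x \<in> D"
  shows "csum (\<lambda>l. if length l = Suc n \<and> set l \<subseteq> D \<and> last l = y then ennreal (weight l) else 0)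
    = kpow (killed p D) n x y"
proof (induction n arbitrary: y)
  case 0
  have "csum (\<lambda>l. if length l = Suc 0 \<and> set l \<subseteq> D \<and> last l = y then ennreal (weight l) else 0)
     = (\<Sum>l\<in>{[y]}. if length l = Suc 0 \<and> set l \<subseteq> D \<and> last l = y then ennreal (weight l) else 0)"
    by (rule csum_finite_support) (auto simp: length_Suc_conv)
  then show ?case using assms by (cases "y = x") (simp_all add: weight_single)
next
  case (Suc n)
  let ?P = "\<lambda>l. length l = Suc n \<and> set l \<subseteq> D"
  have "csum (\<lambda>l. if length l = Suc (Suc n) \<and> set l \<subseteq> D \<and> last l = y then ennreal (weight l) else 0)
     = csum (\<lambda>l. if length (l @ [y]) = Suc (Suc n) \<and> set (l @ [y]) \<subseteq> D \<and> last (l @ [y]) = y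
          then ennreal (weight (l @ [y])) else 0)"
  proof (rule csum_reindex)
    show "inj (\<lambda>l. l @ [y])" by (simp add: inj_def)
    show "(if length l = Suc (Suc n) \<and> set l \<subseteq> D \<and> last l = y then ennreal (weight l) else 0) = 0"
      if "l \<notin> range (\<lambda>l. l @ [y])" for l
      using that by (cases l rule: rev_cases) auto
  qed
  also have "\<dots> = csum (\<lambda>l. csum (\<lambda>z. (if last l = z then 1 else 0) *
      ((if ?P l then ennreal (weight l) else 0) * killed p D z y)))"
  proof (intro nn_integral_cong)
    fix l :: "'s list"
    have "l \<noteq> []" if "?P l" using that by auto
    then show "(if length (l @ [y]) = Suc (Suc n) \<and> set (l @ [y]) \<subseteq> D \<and> last (l @ [y]) = y
          then ennreal (weight (l @ [y])) else 0) = csum (\<lambda>z. (if last l = z then 1 else 0) *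
      ((if ?P l then ennreal (weight l) else 0) * killed p D z y))"
      unfolding csum_delta
      by (auto simp: weight_snoc killed_def ennreal_mult weight_nonneg jump_nonneg subset_iff)
  qed
  also have "\<dots> = csum (\<lambda>z. csum (\<lambda>l. (if last l = z then 1 else 0) *
      ((if ?P l then ennreal (weight l) else 0) * killed p D z y)))"
    by (rule csum_swap[symmetric])
  also have "\<dots> = csum (\<lambda>z. csum (\<lambda>l. if length l = Suc n \<and> set l \<subseteq> D \<and> last l = z
      then ennreal (weight l) else 0) * killed p D z y)"
    unfolding csum_multc[symmetric] by (intro nn_integral_cong) auto
  finally show ?case by (simp add: Suc.IH)
qed

text \<open>
  The paths with \<open>n\<close> jumps that have positive probability.  There are countably many, and together
  they have probability one.
\<close>

definition good :: "nat \<Rightarrow> 's list set" where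
  "good n = {l. length l = Suc n \<and> weight l > 0}"

lemma emeasure_good_paths:
  assumes "T \<subseteq> good n"
  shows "(\<Union>l\<in>T. cyl l (\<lambda>_. 0)) \<in> events"
    and "emeasure M (\<Union>l\<in>T. cyl l (\<lambda>_. 0)) = csum (\<lambda>l. if l \<in> T then ennreal (weight l) else 0)"
proof -
  have T: "length l = Suc n" "l \<noteq> []" "weight l > 0" if "l \<in> T" for l
    using that assms by (auto simp: good_def)
  have ev: "cyl l (\<lambda>_. 0) \<in> events" if "l \<in> T" for l
    using T[OF that] by (intro cyl_measurable) auto
  then show "(\<Union>l\<in>T. cyl l (\<lambda>_. 0)) \<in> events"
    by (intro sets.countable_UN') auto
  have disj: "disjoint_family_on (\<lambda>l. cyl l (\<lambda>_. 0)) T"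
    by (rule cyl_disjoint[OF T(1)])
  have "emeasure M (\<Union>l\<in>T. cyl l (\<lambda>_. 0)) = (\<integral>\<^sup>+ l. emeasure M (cyl l (\<lambda>_. 0)) \<partial>count_space T)"
    by (rule emeasure_UN_countable[OF ev _ disj]) auto
  also have "\<dots> = (\<integral>\<^sup>+ l. ennreal (weight l) \<partial>count_space T)"
    using T by (intro nn_integral_cong emeasure_cyl_0) auto
  finally show "emeasure M (\<Union>l\<in>T. cyl l (\<lambda>_. 0)) = csum (\<lambda>l. if l \<in> T then ennreal (weight l) else 0)"
    by (simp only: csum_restrict[where A = T])
qed

lemma kpow_sum: "csum (kpow p n y) = 1"
proof (induction n)
  case 0
  have "csum (kpow p 0 y) = csum (\<lambda>z. (if y = z then 1 else 0) * 1)"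
    by (intro nn_integral_cong) auto
  then show ?case by (simp only: csum_delta)
next
  case (Suc n)
  have "csum (kpow p (Suc n) y) = csum (\<lambda>u. csum (\<lambda>z. kpow p n y z * p z u))"
    by simp
  also have "\<dots> = csum (\<lambda>z. csum (\<lambda>u. kpow p n y z * p z u))"
    by (rule csum_swap)
  finally show ?case by (simp add: csum_cmult jump_sum Suc)
qed

lemma killed_UNIV: "killed K UNIV = K"
  by (intro ext) (simp add: killed_def)

lemma good_sum: "csum (\<lambda>l. if l \<in> good n then ennreal (weight l) else 0) = 1"
proof -
  have "csum (\<lambda>l. if l \<in> good n then ennreal (weight l) else 0)
      = csum (\<lambda>l. csum (\<lambda>y. (if last l = y then 1 else 0) * (if length l = Suc n then ennreal (weight l) else 0)))"
    unfolding csum_delta using weight_nonneg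
    by (intro nn_integral_cong) (auto simp: good_def less_le)
  also have "\<dots> = csum (\<lambda>y. csum (\<lambda>l. (if last l = y then 1 else 0) * (if length l = Suc n then ennreal (weight l) else 0)))"
    by (rule csum_swap[symmetric])
  also have "\<dots> = csum (\<lambda>y. csum (\<lambda>l. if length l = Suc n \<and> set l \<subseteq> UNIV \<and> last l = y then ennreal (weight l) else 0))"
    by (intro nn_integral_cong) auto
  also have "\<dots> = csum (kpow p n x)"
    by (subst weight_sum) (auto simp: killed_UNIV)
  finally show ?thesis by (simp add: kpow_sum)
qed

lemma AE_good: "AE \<omega> in M. \<forall>n. map (\<lambda>m. Y m \<omega>) [0..<Suc n] \<in> good n"
  unfolding AE_all_countable
proof
  fix n
  have "AE \<omega> in M. \<omega> \<in> (\<Union>l\<in>good n. cyl l (\<lambda>_. 0))"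
    using emeasure_good_paths[of "good n" n] good_sum[of n]
    by (intro AE_prob_1) (simp add: measure_def)
  then show "AE \<omega> in M. map (\<lambda>m. Y m \<omega>) [0..<Suc n] \<in> good n"
  proof (rule AE_mp, intro AE_I2 impI)
    fix \<omega> assume "\<omega> \<in> space M" "\<omega> \<in> (\<Union>l\<in>good n. cyl l (\<lambda>_. 0))"
    then obtain l where l: "l \<in> good n" "\<omega> \<in> cyl l (\<lambda>_. 0)" by auto
    then have "length l = Suc n" by (simp add: good_def)
    with l \<open>\<omega> \<in> space M\<close> cyl_0_iff show "map (\<lambda>m. Y m \<omega>) [0..<Suc n] \<in> good n" by metis
  qed
qed

text \<open>
  The hypothesis on the chain gives the probabilities that holding times are long; taking complements
  one index at a time adds the condition that those in \<open>S\<close> are short.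
\<close>

lemma prob_short_holding:
  assumes "finite S" "S \<subseteq> {..<length l}" "l \<noteq> []" "weight l > 0"
    "\<And>m. m < length l \<Longrightarrow> 0 \<le> s m" "\<And>m. m \<in> S \<Longrightarrow> s m = 0"
  shows "{\<omega> \<in> cyl l s. \<forall>m\<in>S. H m \<omega> \<le> 1} \<in> events \<and>
    prob {\<omega> \<in> cyl l s. \<forall>m\<in>S. H m \<omega> \<le> 1} =
    weight l * (\<Prod>m<length l. if m \<in> S then 1 - exp (q (l ! m) (l ! m)) else exp (q (l ! m) (l ! m) * s m))"
  using assms
proof (induction S arbitrary: s rule: finite_induct)
  case empty
  then show ?case using prob_cyl[of l s] cyl_measurable[of l s] by simp
next
  case (insert k S)
  let ?E = "\<lambda>s. {\<omega> \<in> cyl l s. \<forall>m\<in>S. H m \<omega> \<le> 1}"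
  let ?t = "\<lambda>S s m. if m \<in> S then 1 - exp (q (l ! m) (l ! m)) else exp (q (l ! m) (l ! m) * s m)"
  have k: "k < length l" "s k = 0" "k \<notin> S" using insert by auto
  have IH: "?E s' \<in> events" "prob (?E s') = weight l * (\<Prod>m<length l. ?t S s' m)"
    if "s' = s \<or> s' = s(k := 1)" for s'
  proof -
    have "0 \<le> s' m" if "m < length l" for m
      using insert.prems that \<open>s' = s \<or> s' = s(k := 1)\<close> by auto
    moreover have "s' m' = 0" if "m' \<in> S" for m'
      using insert.prems that \<open>k \<notin> S\<close> \<open>s' = s \<or> s' = s(k := 1)\<close> by auto
    moreover have "S \<subseteq> {..<length l}" using insert.prems by auto
    ultimately show "?E s' \<in> events" "prob (?E s') = weight l * (\<Prod>m<length l. ?t S s' m)"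
      using insert.IH[of s'] insert.prems(2,3) by blast+
  qed
  have upd: "\<omega> \<in> cyl l (s(k := 1)) \<longleftrightarrow> \<omega> \<in> cyl l s \<and> 1 < H k \<omega>" for \<omega>
    using cyl_update[of k l s 1 \<omega>] k by (simp add: one_ereal_def)
  have eq: "{\<omega> \<in> cyl l s. \<forall>m\<in>insert k S. H m \<omega> \<le> 1} = ?E s - ?E (s(k := 1))"
    unfolding upd by (auto simp: not_less)
  have sub: "?E (s(k := 1)) \<subseteq> ?E s"
    unfolding upd by auto
  have fac: "(\<Prod>m<length l. g m) = g k * (\<Prod>m\<in>{..<length l} - {k}. g m)" for g :: "nat \<Rightarrow> real"
    using k by (intro prod.remove) auto
  have rest: "(\<Prod>m\<in>{..<length l} - {k}. ?t S (s(k := 1)) m) = (\<Prod>m\<in>{..<length l} - {k}. ?t S s m)"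
    "(\<Prod>m\<in>{..<length l} - {k}. ?t (insert k S) s m) = (\<Prod>m\<in>{..<length l} - {k}. ?t S s m)"
    by (rule prod.cong; simp)+
  have ev: "?E s \<in> events" "?E (s(k := 1)) \<in> events"
    by (rule IH(1); simp)+
  have pr: "prob (?E s) = weight l * (\<Prod>m<length l. ?t S s m)"
    "prob (?E (s(k := 1))) = weight l * (\<Prod>m<length l. ?t S (s(k := 1)) m)"
    by (rule IH(2); simp)+
  have "prob (?E s - ?E (s(k := 1))) = prob (?E s) - prob (?E (s(k := 1)))"
    by (rule finite_measure_Diff[OF ev sub])
  also have "\<dots> = weight l * ((\<Prod>m<length l. ?t S s m) - (\<Prod>m<length l. ?t S (s(k := 1)) m))"
    unfolding pr by (rule right_diff_distrib[symmetric])
  also have "(\<Prod>m<length l. ?t S s m) - (\<Prod>m<length l. ?t S (s(k := 1)) m)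
      = (?t S s k - ?t S (s(k := 1)) k) * (\<Prod>m\<in>{..<length l} - {k}. ?t S s m)"
    using fac[of "?t S s"] fac[of "?t S (s(k := 1))"] unfolding rest
    by (simp only: left_diff_distrib)
  also have "?t S s k - ?t S (s(k := 1)) k = ?t (insert k S) s k" using k by simp
  also have "\<dots> * (\<Prod>m\<in>{..<length l} - {k}. ?t S s m) = (\<Prod>m<length l. ?t (insert k S) s m)"
    using fac[of "?t (insert k S) s"] unfolding rest by (rule sym)
  finally show ?case
    unfolding eq using ev by blast
qed

end

section \<open>Nonexplosion and holding times\<close>

context bounded_chain begin

lemma weight_short_holding_le:
  assumes l: "length l = a + L" "l \<noteq> []" "weight l > 0"
  defines "E \<equiv> {\<omega> \<in> cyl l (\<lambda>_. 0). \<forall>m\<in>{a..<a + L}. H m \<omega> \<le> 1}"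
  shows "E \<in> events" "prob E \<le> weight l * (1 - exp (- \<Lambda>)) ^ L"
proof -
  have S: "{a..<a + L} \<subseteq> {..<length l}" using l by auto
  note * = prob_short_holding[OF finite_atLeastLessThan S l(2,3), of "\<lambda>_. 0"]
  show "E \<in> events" using * by (simp add: E_def)
  have "prob E = weight l * (\<Prod>m<length l. if m \<in> {a..<a + L} then 1 - exp (q (l ! m) (l ! m)) else 1)"
    using * by (simp add: E_def cong: if_cong)
  also have "(\<Prod>m<length l. if m \<in> {a..<a + L} then 1 - exp (q (l ! m) (l ! m)) else 1)
      = (\<Prod>m\<in>{a..<a + L}. 1 - exp (q (l ! m) (l ! m)))"
    using S by (subst prod.inter_restrict[symmetric]) (auto simp: Int_absorb1)
  also have "\<dots> \<le> (\<Prod>m\<in>{a..<a + L}. 1 - exp (- \<Lambda>))"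
    using rate by (intro prod_mono) (force simp: minus_le_iff)
  finally show "prob E \<le> weight l * (1 - exp (- \<Lambda>)) ^ L"
    using weight_nonneg[of l] by (simp add: mult_left_mono)
qed

text \<open>
  \<open>L\<close> consecutive holding times are all at most 1 with probability at most \<open>(1 - exp (-\<Lambda>))\<^sup>L\<close>,
  so almost surely this does not happen for all \<open>L\<close>.
\<close>

lemma AE_nonexplosive: "AE \<omega> in M. nonexplosive (path_of \<omega>)"
proof -
  have rate_pos: "0 \<le> \<Lambda>" using rate[of undefined] by linarith
  define c where "c = 1 - exp (- \<Lambda>)"
  have c: "0 \<le> c" "c < 1" using rate_pos by (auto simp: c_def)
  define E where "E a l = {\<omega> \<in> cyl l (\<lambda>_. 0). \<forall>m\<in>{a..<length l}. H m \<omega> \<le> 1}" for a l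
  define B where "B a L = (\<Union>l\<in>good (a + L). E a l)" for a L
  have E: "E a l \<in> events" "emeasure M (E a l) \<le> ennreal (c ^ Suc L) * ennreal (weight l)"
    if "l \<in> good (a + L)" for a l L
  proof -
    have "length l = a + Suc L" "l \<noteq> []" "weight l > 0" using that by (auto simp: good_def)
    note * = weight_short_holding_le[OF this]
    show "E a l \<in> events" using *(1) \<open>length l = a + Suc L\<close> by (simp add: E_def)
    have "prob (E a l) \<le> c ^ Suc L * weight l"
      using *(2) \<open>length l = a + Suc L\<close> by (simp only: E_def c_def mult.commute)
    then show "emeasure M (E a l) \<le> ennreal (c ^ Suc L) * ennreal (weight l)"
      using c weight_nonneg by (simp add: emeasure_eq_measure ennreal_mult[symmetric] ennreal_leI del: power_Suc)
  qed
  have B: "B a L \<in> events" "emeasure M (B a L) \<le> ennreal (c ^ Suc L)" for a L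
  proof -
    show "B a L \<in> events" unfolding B_def using E by (intro sets.countable_UN') auto
    have disj: "disjoint_family_on (E a) (good (a + L))"
    proof (rule disjoint_family_on_bisimulation)
      show "disjoint_family_on (\<lambda>l. cyl l (\<lambda>_. 0)) (good (a + L))"
        by (rule cyl_disjoint) (simp add: good_def)
    qed (auto simp: E_def)
    have "emeasure M (B a L) = (\<integral>\<^sup>+ l. emeasure M (E a l) \<partial>count_space (good (a + L)))"
      unfolding B_def by (rule emeasure_UN_countable[OF _ _ disj]) (auto intro: E)
    also have "\<dots> \<le> (\<integral>\<^sup>+ l. ennreal (c ^ Suc L) * ennreal (weight l) \<partial>count_space (good (a + L)))"
      by (intro nn_integral_mono E(2)) simp
    also have "\<dots> = ennreal (c ^ Suc L) * (\<integral>\<^sup>+ l. ennreal (weight l) \<partial>count_space (good (a + L)))"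
      by (rule nn_integral_cmult) simp
    finally show "emeasure M (B a L) \<le> ennreal (c ^ Suc L)"
      by (simp only: csum_restrict[where A = "good (a + L)"] good_sum mult_1_right)
  qed
  have null: "(\<Inter>L. B a L) \<in> null_sets M" for a
  proof (rule null_setsI)
    show "(\<Inter>L. B a L) \<in> events" using B by (intro sets.countable_INT) auto
    have "emeasure M (\<Inter>L. B a L) \<le> ennreal (c ^ Suc L)" for L
      using B[of a L] by (meson INT_lower UNIV_I emeasure_mono order_trans)
    moreover have "(\<lambda>L. ennreal (c ^ Suc L)) \<longlonglongrightarrow> ennreal 0"
      using c by (intro tendsto_ennrealI LIMSEQ_Suc LIMSEQ_power_zero) simp
    ultimately show "emeasure M (\<Inter>L. B a L) = 0"
      using LIMSEQ_le_const[of "\<lambda>L. ennreal (c ^ Suc L)" "ennreal 0"] by (metis ennreal_0 le_zero_eq)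
  qed
  have "AE \<omega> in M. \<forall>a. \<omega> \<notin> (\<Inter>L. B a L)"
    unfolding AE_all_countable by (intro allI AE_not_in null)
  with AE_good AE_space show ?thesis
  proof eventually_elim
    case (elim \<omega>)
    show ?case
      unfolding nonexplosive_def
    proof (rule allI, rule ccontr)
      fix a assume short: "\<not> (\<exists>m\<ge>a. 1 < H m \<omega>)"
      have sp: "\<omega> \<in> space M" using elim by blast
      have "\<omega> \<in> B a L" for L
      proof -
        let ?l = "map (\<lambda>m. Y m \<omega>) [0..<Suc (a + L)]"
        have "?l \<in> good (a + L)" using elim by blast
        moreover have "\<omega> \<in> cyl ?l (\<lambda>_. 0)" using cyl_0_iff[OF sp, of ?l "a + L"] by simp
        ultimately show ?thesis using short by (auto simp: B_def E_def not_less)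
      qed
      with elim show False by auto
    qed
  qed
qed

lemma AE_holding_time_finite:
  assumes "q y y < 0"
  shows "AE \<omega> in M. \<forall>n. Y n \<omega> = y \<longrightarrow> H n \<omega> \<noteq> \<infinity>"
proof -
  have null: "(\<Inter>k. cyl l ((\<lambda>_. 0)(n := real k))) \<in> null_sets M" if l: "l \<in> good n" "last l = y" for l n
  proof (rule null_setsI)
    let ?s = "\<lambda>k. (\<lambda>_. 0)(n := real k)"
    have ne: "l \<noteq> []" "weight l > 0" "length l = Suc n" using l by (auto simp: good_def)
    have ev: "cyl l (?s k) \<in> events" for k using ne by (intro cyl_measurable) auto
    then show "(\<Inter>k. cyl l (?s k)) \<in> events" by (intro sets.countable_INT) auto
    have pr: "prob (cyl l (?s k)) = weight l * exp (q y y) ^ k" for k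
    proof -
      have "prob (cyl l (?s k)) = weight l * (\<Prod>m<Suc n. exp (q (l ! m) (l ! m) * ?s k m))"
        using prob_cyl[OF ne(1), of "?s k"] ne by simp
      also have "(\<Prod>m<Suc n. exp (q (l ! m) (l ! m) * ?s k m)) = exp (q (l ! n) (l ! n) * real k)"
        by simp
      also have "l ! n = y" using l ne by (simp add: last_conv_nth)
      also have "exp (q y y * real k) = exp (q y y) ^ k" by (rule exp_of_nat2_mult)
      finally show ?thesis .
    qed
    have "prob (\<Inter>k. cyl l (?s k)) \<le> weight l * exp (q y y) ^ k" for k
      unfolding pr[symmetric] using ev by (intro finite_measure_mono) auto
    moreover have "(\<lambda>k. weight l * exp (q y y) ^ k) \<longlonglongrightarrow> weight l * 0"
      using assms by (intro tendsto_mult_left LIMSEQ_power_zero) simp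
    ultimately have "prob (\<Inter>k. cyl l (?s k)) \<le> weight l * 0"
      by (intro LIMSEQ_le_const) auto
    then have "prob (\<Inter>k. cyl l (?s k)) = 0" using measure_nonneg[of M] by (simp add: order_antisym)
    then show "emeasure M (\<Inter>k. cyl l (?s k)) = 0" by (simp add: emeasure_eq_measure)
  qed
  have "AE \<omega> in M. \<forall>n. \<forall>l. l \<in> good n \<and> last l = y \<longrightarrow> \<omega> \<notin> (\<Inter>k. cyl l ((\<lambda>_. 0)(n := real k)))"
    unfolding AE_all_countable
  proof (intro allI)
    fix n l
    show "AE \<omega> in M. l \<in> good n \<and> last l = y \<longrightarrow> \<omega> \<notin> (\<Inter>k. cyl l ((\<lambda>_. 0)(n := real k)))"
      using null[of l n] by (cases "l \<in> good n \<and> last l = y") (auto dest: AE_not_in)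
  qed
  with AE_good AE_space show ?thesis
  proof eventually_elim
    case (elim \<omega>)
    show ?case
    proof (intro allI impI notI)
      fix n assume n: "Y n \<omega> = y" "H n \<omega> = \<infinity>"
      let ?l = "map (\<lambda>m. Y m \<omega>) [0..<Suc n]"
      have "?l \<in> good n" "last ?l = y" using elim n by auto
      then obtain k where k: "\<omega> \<notin> cyl ?l ((\<lambda>_. 0)(n := real k))" using elim by blast
      have "\<omega> \<in> cyl ?l (\<lambda>_. 0)" using cyl_0_iff[of \<omega> ?l n] elim by simp
      then have "\<omega> \<in> cyl ?l ((\<lambda>_. 0)(n := real k))"
        using cyl_update[of n ?l "\<lambda>_. 0" "real k" \<omega>] n by simp
      with k show False by contradiction
    qed
  qed
qed

lemma nn_integral_exp_decay:
  assumes "0 < (r::real)"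
  shows "(\<integral>\<^sup>+ u. ennreal (exp (- r * u)) * indicator {0..} u \<partial>lborel) = ennreal (1 / r)"
proof -
  interpret E: prob_space "density lborel (exponential_density r)"
    by (rule prob_space_exponential_density[OF assms])
  have "1 = (\<integral>\<^sup>+ u. ennreal (exponential_density r u) \<partial>lborel)"
    using E.emeasure_space_1 by (simp add: emeasure_density)
  also have "\<dots> = (\<integral>\<^sup>+ u. ennreal r * (ennreal (exp (- r * u)) * indicator {0..} u) \<partial>lborel)"
    using assms by (intro nn_integral_cong)
      (auto simp: exponential_density_def ennreal_mult[symmetric] mult.commute split: split_indicator)
  also have "\<dots> = ennreal r * (\<integral>\<^sup>+ u. ennreal (exp (- r * u)) * indicator {0..} u \<partial>lborel)"
    by (rule nn_integral_cmult) measurable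
  finally have *: "ennreal r * (\<integral>\<^sup>+ u. ennreal (exp (- r * u)) * indicator {0..} u \<partial>lborel) = 1" by simp
  have "ennreal (1 / r) * (ennreal r * (\<integral>\<^sup>+ u. ennreal (exp (- r * u)) * indicator {0..} u \<partial>lborel))
      = (\<integral>\<^sup>+ u. ennreal (exp (- r * u)) * indicator {0..} u \<partial>lborel)"
    using assms by (simp add: mult.assoc[symmetric] ennreal_mult[symmetric])
  then show ?thesis unfolding * by simp
qed

text \<open>
  The \<open>n\<close>-th holding time on the event that the path is \<open>l\<close>, as an integral over time; its expectation
  follows by interchanging the integrals.
\<close>

definition last_holding :: "nat \<Rightarrow> 's list \<Rightarrow> 'w \<Rightarrow> ennreal" where
  "last_holding n l \<omega> = (\<integral>\<^sup>+ u. indicator (cyl l (\<lambda>_. 0)) \<omega> *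
      indicator {u. 0 \<le> u \<and> ereal u < H n \<omega>} u \<partial>lborel)"

lemma last_holding_measurable_integral:
  assumes l: "l \<in> good n" and neg: "q (last l) (last l) < 0"
  shows "last_holding n l \<in> borel_measurable M"
    and "(\<integral>\<^sup>+ \<omega>. last_holding n l \<omega> \<partial>M) = ennreal (weight l / - q (last l) (last l))"
proof -
  have ne: "l \<noteq> []" "weight l > 0" "length l = Suc n" using l by (auto simp: good_def)
  define X where "X \<omega> = (if \<omega> \<in> cyl l (\<lambda>_. 0) then H n \<omega> else 0)" for \<omega>
  have level: "{\<omega> \<in> space M. ereal r < X \<omega>} = cyl l ((\<lambda>_. 0)(n := r))" if "0 \<le> r" for r
  proof -
    have "\<omega> \<in> cyl l ((\<lambda>_. 0)(n := r)) \<longleftrightarrow> \<omega> \<in> space M \<and> ereal r < X \<omega>" for \<omega>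
    proof -
      have "\<omega> \<in> space M" if "\<omega> \<in> cyl l (\<lambda>_. 0)" using that by (simp add: cyl_def)
      then show ?thesis using that ne cyl_update[of n l "\<lambda>_. 0" r \<omega>] by (auto simp: X_def)
    qed
    then show ?thesis by auto
  qed
  have cyl_r: "cyl l ((\<lambda>_. 0)(n := r)) \<in> events" if "0 \<le> r" for r
    using that ne by (intro cyl_measurable) auto
  have X0: "0 \<le> X \<omega>" if "\<omega> \<in> space M" for \<omega>
    using holding_time_pos[OF right_cont_path[OF that], of n] by (simp add: X_def less_imp_le)
  have X [measurable]: "X \<in> borel_measurable M"
    unfolding borel_measurable_ereal_iff_Ioi
  proof
    fix a
    have "X -` {a<..} \<inter> space M = {\<omega> \<in> space M. a < X \<omega>}" by auto
    moreover have "{\<omega> \<in> space M. a < X \<omega>} \<in> events"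
    proof (cases a)
      case (real r)
      show ?thesis
      proof (cases "0 \<le> r")
        case True
        then show ?thesis using level cyl_r real by simp
      next
        case False
        then have "{\<omega> \<in> space M. a < X \<omega>} = space M"
          using X0 real by (auto intro: less_le_trans[of _ 0])
        then show ?thesis by simp
      qed
    next
      case MInf
      have "-\<infinity> < X \<omega>" if "\<omega> \<in> space M" for \<omega> using X0[OF that] by auto
      then have "{\<omega> \<in> space M. a < X \<omega>} = space M"
        using MInf by auto
      then show ?thesis by simp
    qed simp
    ultimately show "X -` {a<..} \<inter> space M \<in> events" by simp
  qed
  have eq: "last_holding n l \<omega> = (\<integral>\<^sup>+ u. indicator {(\<omega>, u). 0 \<le> u \<and> ereal u < X \<omega>} (\<omega>, u) \<partial>lborel)" for \<omega>
    unfolding last_holding_def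
    by (intro nn_integral_cong) (auto simp: X_def split: split_indicator)
  have [measurable]: "(\<lambda>p. indicator {(\<omega>, u). 0 \<le> u \<and> ereal u < X \<omega>} p :: ennreal)
      \<in> borel_measurable (M \<Otimes>\<^sub>M lborel)"
    by measurable
  have "(\<lambda>\<omega>. \<integral>\<^sup>+ u. indicator {(\<omega>, u). 0 \<le> u \<and> ereal u < X \<omega>} (\<omega>, u) \<partial>lborel) \<in> borel_measurable M"
    by measurable
  then show "last_holding n l \<in> borel_measurable M"
    unfolding eq[abs_def] .
  interpret pair_sigma_finite M "lborel :: real measure" ..
  have "(\<integral>\<^sup>+ \<omega>. last_holding n l \<omega> \<partial>M)
      = (\<integral>\<^sup>+ u. \<integral>\<^sup>+ \<omega>. indicator {(\<omega>, u). 0 \<le> u \<and> ereal u < X \<omega>} (\<omega>, u) \<partial>M \<partial>lborel)"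
    unfolding eq by (rule Fubini'[symmetric]) measurable
  also have "\<dots> = (\<integral>\<^sup>+ u. ennreal (weight l) * (ennreal (exp (- (- q (last l) (last l)) * u)) * indicator {0..} u) \<partial>lborel)"
  proof (intro nn_integral_cong)
    fix u :: real
    show "(\<integral>\<^sup>+ \<omega>. indicator {(\<omega>, u). 0 \<le> u \<and> ereal u < X \<omega>} (\<omega>, u) \<partial>M)
      = ennreal (weight l) * (ennreal (exp (- (- q (last l) (last l)) * u)) * indicator {0..} u)"
    proof (cases "0 \<le> u")
      case True
      have "(\<integral>\<^sup>+ \<omega>. indicator {(\<omega>, u). 0 \<le> u \<and> ereal u < X \<omega>} (\<omega>, u) \<partial>M)
          = (\<integral>\<^sup>+ \<omega>. indicator (cyl l ((\<lambda>_. 0)(n := u))) \<omega> \<partial>M)"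
        using True level[OF True] by (intro nn_integral_cong) (auto split: split_indicator)
      also have "\<dots> = prob (cyl l ((\<lambda>_. 0)(n := u)))"
        using cyl_r[OF True] by (simp add: emeasure_eq_measure)
      also have "prob (cyl l ((\<lambda>_. 0)(n := u))) = weight l * (\<Prod>m<Suc n. exp (q (l ! m) (l ! m) * ((\<lambda>_. 0)(n := u)) m))"
        using prob_cyl[OF ne(1), of "(\<lambda>_. 0)(n := u)"] ne True by simp
      also have "\<dots> = weight l * exp (q (last l) (last l) * u)"
        using ne by (simp add: last_conv_nth)
      finally show ?thesis using True weight_nonneg by (simp add: ennreal_mult)
    qed simp
  qed
  also have "\<dots> = ennreal (weight l) * (\<integral>\<^sup>+ u. ennreal (exp (- (- q (last l) (last l)) * u)) * indicator {0..} u \<partial>lborel)"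
    by (rule nn_integral_cmult) measurable
  also have "\<dots> = ennreal (weight l) * ennreal (1 / - q (last l) (last l))"
    using neg by (subst nn_integral_exp_decay) auto
  also have "\<dots> = ennreal (weight l / - q (last l) (last l))"
    using neg weight_nonneg[of l] by (simp add: ennreal_mult[symmetric] del: times_divide_eq_right)
       (simp add: divide_simps)
  finally show "(\<integral>\<^sup>+ \<omega>. last_holding n l \<omega> \<partial>M) = ennreal (weight l / - q (last l) (last l))" .
qed

end

section \<open>Expected occupation times and entrance laws\<close>

lemma borel_measurable_csum:
  fixes f :: "'s::countable \<Rightarrow> 'a \<Rightarrow> ennreal"
  assumes [measurable]: "\<And>l. f l \<in> borel_measurable M"
  shows "(\<lambda>\<omega>. csum (\<lambda>l. f l \<omega>)) \<in> borel_measurable M"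
proof -
  define g where "g i = (if i \<in> range (to_nat :: 's \<Rightarrow> nat) then f (from_nat i) else (\<lambda>_. 0))" for i
  have "csum (\<lambda>l. f l \<omega>) = (\<Sum>i. g i \<omega>)" for \<omega>
    unfolding nn_integral_count_space_nat[symmetric]
    by (subst csum_reindex[of to_nat]) (auto simp: g_def)
  moreover have [measurable]: "g i \<in> borel_measurable M" for i
    by (simp add: g_def)
  ultimately show ?thesis by simp
qed

context bounded_chain begin

text \<open>
  Each visit to \<open>y\<close> lasts \<open>1 / - q y y\<close> on average, and the expected number of visits before \<open>B\<close> is
  entered is a Green function of the jump chain.
\<close>

theorem expected_occupation:
  assumes "x \<notin> B" "y \<notin> B" "q y y < 0"
  shows "(\<integral>\<^sup>+ \<omega>. \<integral>\<^sup>+ s. indicator {s. 0 \<le> s \<and> ereal s \<le> entrance_time (path_of \<omega>) B \<and> Z s \<omega> = y} s \<partial>lborel \<partial>M)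
    = green (killed p (- B)) x y * ennreal (1 / - q y y)"
proof -
  define T where "T n = {l \<in> good n. set l \<subseteq> - B \<and> last l = y}" for n
  have "AE \<omega> in M. (\<integral>\<^sup>+ s. indicator {s. 0 \<le> s \<and> ereal s \<le> entrance_time (path_of \<omega>) B \<and> Z s \<omega> = y} s \<partial>lborel)
      = (\<Sum>n. csum (\<lambda>l. if l \<in> T n then last_holding n l \<omega> else 0))"
    using AE_space AE_good AE_nonexplosive AE_holding_time_finite[OF assms(3)]
  proof eventually_elim
    case (elim \<omega>)
    note rc = right_cont_path[OF elim(1)]
    have "(if Y n \<omega> = y \<and> (\<forall>m\<le>n. Y m \<omega> \<notin> B) then sojourn (path_of \<omega>) n else 0)
        = csum (\<lambda>l. if l \<in> T n then last_holding n l \<omega> else 0)" for n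
    proof -
      let ?l = "map (\<lambda>m. Y m \<omega>) [0..<Suc n]"
      have good: "?l \<in> good n" using elim by blast
      have other: "last_holding n l \<omega> = 0" if "l \<in> T n" "l \<noteq> ?l" for l
      proof -
        have "length l = Suc n" using that by (simp add: T_def good_def)
        then have "\<omega> \<notin> cyl l (\<lambda>_. 0)" using cyl_0_iff[OF elim(1)] that by blast
        then show ?thesis by (simp add: last_holding_def)
      qed
      have "csum (\<lambda>l. if l \<in> T n then last_holding n l \<omega> else 0)
          = (\<Sum>l\<in>{?l}. if l \<in> T n then last_holding n l \<omega> else 0)"
        using other by (intro csum_finite_support) auto
      also have "\<dots> = (if Y n \<omega> = y \<and> (\<forall>m\<le>n. Y m \<omega> \<notin> B) then last_holding n ?l \<omega> else 0)"
      proof -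
        have "set ?l \<subseteq> - B \<longleftrightarrow> (\<forall>m\<le>n. Y m \<omega> \<notin> B)"
          by (auto simp: image_subset_iff less_Suc_eq_le simp del: upt_Suc)
        moreover have "last ?l = Y n \<omega>" by simp
        ultimately show ?thesis using good by (auto simp: T_def simp del: upt_Suc)
      qed
      also have "\<dots> = (if Y n \<omega> = y \<and> (\<forall>m\<le>n. Y m \<omega> \<notin> B) then sojourn (path_of \<omega>) n else 0)"
      proof (cases "Y n \<omega> = y")
        case True
        have "jump_time (path_of \<omega>) n \<noteq> \<infinity>"
          using elim(4) True by (auto simp: holding_time_def)
        moreover have "\<omega> \<in> cyl ?l (\<lambda>_. 0)" using cyl_0_iff[OF elim(1), of ?l n] by simp
        ultimately have "last_holding n ?l \<omega> = sojourn (path_of \<omega>) n"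
          using sojourn_eq_holding_time[OF rc, of n] by (simp add: last_holding_def del: upt_Suc)
        then show ?thesis by (simp only:)
      qed simp
      finally show ?thesis by simp
    qed
    then show ?case
      using occupation_eq_suminf[OF rc elim(3) assms(2)] by simp
  qed
  then have "(\<integral>\<^sup>+ \<omega>. \<integral>\<^sup>+ s. indicator {s. 0 \<le> s \<and> ereal s \<le> entrance_time (path_of \<omega>) B \<and> Z s \<omega> = y} s \<partial>lborel \<partial>M)
     = (\<integral>\<^sup>+ \<omega>. (\<Sum>n. csum (\<lambda>l. if l \<in> T n then last_holding n l \<omega> else 0)) \<partial>M)"
    by (rule nn_integral_cong_AE)
  also have "\<dots> = (\<Sum>n. csum (\<lambda>l. ennreal (1 / - q y y) *
      (if length l = Suc n \<and> set l \<subseteq> - B \<and> last l = y then ennreal (weight l) else 0)))"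
  proof -
    have meas: "(\<lambda>\<omega>. if l \<in> T n then last_holding n l \<omega> else 0) \<in> borel_measurable M" for l n
    proof (cases "l \<in> T n")
      case True
      then have "l \<in> good n" "q (last l) (last l) < 0" using assms(3) by (auto simp: T_def)
      from last_holding_measurable_integral(1)[OF this] True show ?thesis by simp
    qed simp
    have int: "(\<integral>\<^sup>+ \<omega>. (if l \<in> T n then last_holding n l \<omega> else 0) \<partial>M) = ennreal (1 / - q y y) *
      (if length l = Suc n \<and> set l \<subseteq> - B \<and> last l = y then ennreal (weight l) else 0)" for l n
    proof (cases "l \<in> T n")
      case True
      then have "(\<integral>\<^sup>+ \<omega>. last_holding n l \<omega> \<partial>M) = ennreal (weight l / - q y y)"
        using last_holding_measurable_integral(2)[of l n] assms(3) by (simp add: T_def)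
      also have "weight l / - q y y = (1 / - q y y) * weight l" by simp
      also have "ennreal \<dots> = ennreal (1 / - q y y) * ennreal (weight l)"
        using assms(3) weight_nonneg by (intro ennreal_mult) (auto intro: divide_nonneg_neg)
      finally show ?thesis using True by (simp add: T_def good_def)
    next
      case False
      have "ennreal (weight l) = 0" if "length l = Suc n \<and> set l \<subseteq> - B \<and> last l = y"
        using that False weight_nonneg[of l] by (simp add: T_def good_def)
      with False show ?thesis by (simp cong: if_cong)
    qed
    have "(\<integral>\<^sup>+ \<omega>. (\<Sum>n. csum (\<lambda>l. if l \<in> T n then last_holding n l \<omega> else 0)) \<partial>M)
        = (\<Sum>n. \<integral>\<^sup>+ \<omega>. csum (\<lambda>l. if l \<in> T n then last_holding n l \<omega> else 0) \<partial>M)"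
      using meas by (intro nn_integral_suminf borel_measurable_csum)
    also have "\<dots> = (\<Sum>n. csum (\<lambda>l. \<integral>\<^sup>+ \<omega>. (if l \<in> T n then last_holding n l \<omega> else 0) \<partial>M))"
      using meas by (subst nn_integral_count_space_nn_integral) auto
    finally show ?thesis unfolding int .
  qed
  also have "\<dots> = (\<Sum>n. ennreal (1 / - q y y) * kpow (killed p (- B)) n x y)"
    unfolding csum_cmult using assms(1) by (subst weight_sum) auto
  also have "\<dots> = green (killed p (- B)) x y * ennreal (1 / - q y y)"
    by (simp add: green_def mult.commute)
  finally show ?thesis .
qed

text \<open>
  Being in \<open>y\<close> at a finite entrance time is an event, not only up to a null set, so its measure has
  the intended meaning: between the entrance time and some later rational time, the process takes only
  one value at rational times.
\<close>

lemma entrance_place_measurable: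
  "{\<omega> \<in> space M. entrance_time (path_of \<omega>) B < \<infinity> \<and> Z (real_of_ereal (entrance_time (path_of \<omega>) B)) \<omega> = y} \<in> events"
proof -
  define Q where "Q = {r \<in> \<rat>. (0::real) \<le> r}"
  have Q: "countable Q" unfolding Q_def by (intro countable_Collect countable_rat)
  define before where "before s = {\<omega> \<in> space M. \<exists>u\<in>Q. u < s \<and> Z u \<omega> \<in> B}" for s
  have Zm: "{\<omega> \<in> space M. Z t \<omega> \<in> C} \<in> events" if "0 \<le> t" for t C
  proof -
    have "Z t \<in> measurable M (count_space UNIV)" using chain that by (simp add: markov_chain_def)
    from measurable_sets[OF this, of C] show ?thesis
      by (simp add: vimage_def Int_def conj_commute)
  qed
  have before_ev: "before s \<in> events" for s
  proof -
    have "before s = (\<Union>u\<in>{u\<in>Q. u < s}. {\<omega> \<in> space M. Z u \<omega> \<in> B})" by (auto simp: before_def)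
    also have "\<dots> \<in> events"
    proof (rule sets.countable_UN')
      show "countable {u\<in>Q. u < s}" by (rule countable_subset[OF _ Q]) auto
    qed (use Zm in \<open>auto simp: Q_def\<close>)
    finally show ?thesis .
  qed
  have before_iff: "entrance_time (path_of \<omega>) B < ereal s \<longleftrightarrow> \<omega> \<in> before s" if w: "\<omega> \<in> space M" for \<omega> s
  proof
    assume "entrance_time (path_of \<omega>) B < ereal s"
    then obtain t where t: "0 \<le> t" "Z t \<omega> \<in> B" "t < s"
      by (auto simp: entrance_time_def Inf_less_iff)
    obtain b where b: "t < b" "\<And>u. t \<le> u \<Longrightarrow> u < b \<Longrightarrow> Z u \<omega> = Z t \<omega>"
      using right_contD[OF right_cont_path[OF w] t(1)] by blast
    obtain u where u: "u \<in> \<rat>" "t < u" "u < min b s" using Rats_dense_in_real[of t "min b s"] b(1) t by auto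
    then have "u \<in> Q" "u < s" "Z u \<omega> \<in> B" using t b(2)[of u] by (auto simp: Q_def)
    then show "\<omega> \<in> before s" using w by (auto simp: before_def)
  next
    assume "\<omega> \<in> before s"
    then obtain u where "u \<in> Q" "u < s" "Z u \<omega> \<in> B" by (auto simp: before_def)
    with entrance_time_le[of u "path_of \<omega>" B] show "entrance_time (path_of \<omega>) B < ereal s"
      by (auto simp: Q_def intro: le_less_trans)
  qed
  define E where "E = (\<Union>r\<in>Q. before r \<inter> (\<Inter>s\<in>{s\<in>Q. s < r} . {\<omega> \<in> space M. \<omega> \<in> before s \<longrightarrow> Z s \<omega> = y}) \<inter> space M)"
  have "{\<omega> \<in> space M. \<omega> \<in> before s \<longrightarrow> Z s \<omega> = y} \<in> events" if "s \<in> Q" for s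
  proof -
    have "{\<omega> \<in> space M. \<omega> \<in> before s \<longrightarrow> Z s \<omega> = y} = (space M - before s) \<union> {\<omega> \<in> space M. Z s \<omega> \<in> {y}}"
      by auto
    also have "\<dots> \<in> events" using before_ev Zm[of s "{y}"] that by (auto simp: Q_def)
    finally show ?thesis .
  qed
  note ev = this
  have "E = (\<Union>r\<in>Q. before r \<inter> {\<omega> \<in> space M. \<forall>s\<in>{s\<in>Q. s < r}. \<omega> \<in> before s \<longrightarrow> Z s \<omega> = y})"
    by (auto simp: E_def)
  also have "\<dots> \<in> events"
  proof (intro sets.countable_UN' Q subsetI, clarify, intro sets.Int before_ev)
    fix r assume "r \<in> Q"
    have "countable {s\<in>Q. s < r}" using Q by auto
    then show "{\<omega> \<in> space M. \<forall>s\<in>{s\<in>Q. s < r}. \<omega> \<in> before s \<longrightarrow> Z s \<omega> = y} \<in> events"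
      using ev by (intro sets.sets_Collect_countable_All') auto
  qed
  finally have E_ev: "E \<in> events" .
  have mem: "\<omega> \<in> E \<longleftrightarrow> entrance_time (path_of \<omega>) B < \<infinity> \<and> Z (real_of_ereal (entrance_time (path_of \<omega>) B)) \<omega> = y"
    if w: "\<omega> \<in> space M" for \<omega>
  proof -
    let ?\<tau> = "entrance_time (path_of \<omega>) B"
    note rc = right_cont_path[OF w]
    have "0 \<le> ?\<tau>" unfolding entrance_time_def by (intro Inf_greatest) auto
    then consider "?\<tau> = \<infinity>" | t where "?\<tau> = ereal t" "0 \<le> t" by (cases ?\<tau>) auto
    then show ?thesis
    proof cases
      case 1
      then show ?thesis using before_iff[OF w] by (auto simp: E_def)
    next
      case (2 t)
      have E_iff: "\<omega> \<in> E \<longleftrightarrow> (\<exists>r\<in>Q. t < r \<and> (\<forall>s\<in>Q. s < r \<longrightarrow> t < s \<longrightarrow> Z s \<omega> = y))"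
        using before_iff[OF w, symmetric] w 2 by (simp add: E_def) blast
      obtain b where b: "t < b" "\<And>u. t \<le> u \<Longrightarrow> u < b \<Longrightarrow> Z u \<omega> = Z t \<omega>"
        using right_contD[OF rc 2(2)] by blast
      have "\<omega> \<in> E \<longleftrightarrow> Z t \<omega> = y"
      proof
        assume "\<omega> \<in> E"
        then obtain r where r: "r \<in> Q" "t < r" "\<And>s. s \<in> Q \<Longrightarrow> s < r \<Longrightarrow> t < s \<Longrightarrow> Z s \<omega> = y"
          unfolding E_iff by blast
        obtain u where u: "u \<in> \<rat>" "t < u" "u < min b r" using Rats_dense_in_real[of t "min b r"] b(1) r(2) by auto
        then have "u \<in> Q" using 2 by (auto simp: Q_def)
        with r(3)[of u] b(2)[of u] u show "Z t \<omega> = y" by simp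
      next
        assume y: "Z t \<omega> = y"
        obtain r where r: "r \<in> \<rat>" "t < r" "r < b" using Rats_dense_in_real[of t b] b(1) by auto
        then have "r \<in> Q" using 2 by (auto simp: Q_def)
        moreover have "Z s \<omega> = y" if "s < r" "t < s" for s using b(2)[of s] that r y by simp
        ultimately show "\<omega> \<in> E" unfolding E_iff using r by blast
      qed
      then show ?thesis using 2 by simp
    qed
  qed
  have "E \<subseteq> space M" by (auto simp: E_def)
  with mem have "E = {\<omega> \<in> space M. entrance_time (path_of \<omega>) B < \<infinity> \<and>
      Z (real_of_ereal (entrance_time (path_of \<omega>) B)) \<omega> = y}"
    by blast
  with E_ev show ?thesis by (simp only:)
qed

theorem entrance_distribution:
  assumes "x \<notin> B" "y \<in> B"
  shows "emeasure M {\<omega> \<in> space M. entrance_time (path_of \<omega>) B < \<infinity> \<and>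
      Z (real_of_ereal (entrance_time (path_of \<omega>) B)) \<omega> = y}
    = csum (\<lambda>z. green (killed p (- B)) x z * p z y)"
proof -
  define T where "T n = {l \<in> good n. set (butlast l) \<subseteq> - B \<and> last l = y}" for n
  define E where "E n = (\<Union>l\<in>T n. cyl l (\<lambda>_. 0))" for n
  have Tg: "T n \<subseteq> good n" for n by (auto simp: T_def)
  have E_ev: "E n \<in> events" for n unfolding E_def by (rule emeasure_good_paths(1)[OF Tg])
  have E_iff: "\<omega> \<in> E n \<longleftrightarrow> Y n \<omega> = y \<and> (\<forall>m<n. Y m \<omega> \<notin> B)"
    if "\<omega> \<in> space M" "map (\<lambda>m. Y m \<omega>) [0..<Suc n] \<in> good n" for \<omega> n
  proof -
    have "\<omega> \<in> E n \<longleftrightarrow> map (\<lambda>m. Y m \<omega>) [0..<Suc n] \<in> T n"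
    proof
      assume "\<omega> \<in> E n"
      then obtain l where l: "l \<in> T n" "\<omega> \<in> cyl l (\<lambda>_. 0)" by (auto simp: E_def)
      then have "length l = Suc n" by (simp add: T_def good_def)
      with l cyl_0_iff[OF that(1)] show "map (\<lambda>m. Y m \<omega>) [0..<Suc n] \<in> T n" by metis
    next
      assume "map (\<lambda>m. Y m \<omega>) [0..<Suc n] \<in> T n"
      moreover have "\<omega> \<in> cyl (map (\<lambda>m. Y m \<omega>) [0..<Suc n]) (\<lambda>_. 0)"
        using cyl_0_iff[OF that(1), of "map (\<lambda>m. Y m \<omega>) [0..<Suc n]" n] by simp
      ultimately show "\<omega> \<in> E n" by (auto simp: E_def simp del: upt_Suc)
    qed
    also have "\<dots> \<longleftrightarrow> Y n \<omega> = y \<and> (\<forall>m<n. Y m \<omega> \<notin> B)"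
      using that(2) by (auto simp: T_def image_subset_iff)
    finally show ?thesis .
  qed
  let ?D = "{\<omega> \<in> space M. entrance_time (path_of \<omega>) B < \<infinity> \<and> Z (real_of_ereal (entrance_time (path_of \<omega>) B)) \<omega> = y}"
  have E0: "emeasure M (E 0) = 0"
  proof -
    have "T 0 = {}"
    proof (rule equals0I)
      fix l assume "l \<in> T 0"
      then obtain a where "l = [a]" "a = y" "weight l > 0" by (auto simp: T_def good_def length_Suc_conv)
      then show False using assms weight_single[of y] by (auto split: if_splits)
    qed
    then show ?thesis by (simp add: E_def)
  qed
  have Suc: "emeasure M (E (Suc n)) = csum (\<lambda>z. kpow (killed p (- B)) n x z * p z y)" for n
  proof -
    let ?P = "\<lambda>l. length l = Suc n \<and> set l \<subseteq> - B"
    have "emeasure M (E (Suc n)) = csum (\<lambda>l. if l \<in> T (Suc n) then ennreal (weight l) else 0)"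
      unfolding E_def by (rule emeasure_good_paths(2)[OF Tg])
    also have "\<dots> = csum (\<lambda>l. if l @ [y] \<in> T (Suc n) then ennreal (weight (l @ [y])) else 0)"
    proof (rule csum_reindex)
      show "inj (\<lambda>l. l @ [y])" by (simp add: inj_def)
      show "(if l \<in> T (Suc n) then ennreal (weight l) else 0) = 0" if "l \<notin> range (\<lambda>l. l @ [y])" for l
        using that by (cases l rule: rev_cases) (auto simp: T_def good_def)
    qed
    also have "\<dots> = csum (\<lambda>l. csum (\<lambda>z. (if last l = z then 1 else 0) *
        ((if ?P l then ennreal (weight l) else 0) * p z y)))"
    proof (intro nn_integral_cong)
      fix l :: "'s list"
      have ne: "l \<noteq> []" if "?P l" using that by auto
      have "(if l @ [y] \<in> T (Suc n) then ennreal (weight (l @ [y])) else 0)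
          = (if ?P l then ennreal (weight (l @ [y])) else 0)"
        using weight_nonneg[of "l @ [y]"] by (auto simp: T_def good_def less_le)
      also have "\<dots> = (if ?P l then ennreal (weight l) else 0) * p (last l) y"
        using ne by (auto simp: weight_snoc ennreal_mult weight_nonneg jump_nonneg)
      finally show "(if l @ [y] \<in> T (Suc n) then ennreal (weight (l @ [y])) else 0)
        = csum (\<lambda>z. (if last l = z then 1 else 0) * ((if ?P l then ennreal (weight l) else 0) * p z y))"
        by (simp only: csum_delta)
    qed
    also have "\<dots> = csum (\<lambda>z. csum (\<lambda>l. (if last l = z then 1 else 0) *
        ((if ?P l then ennreal (weight l) else 0) * p z y)))"
      by (rule csum_swap[symmetric])
    also have "\<dots> = csum (\<lambda>z. csum (\<lambda>l. if length l = Suc n \<and> set l \<subseteq> - B \<and> last l = z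
        then ennreal (weight l) else 0) * p z y)"
      unfolding csum_multc[symmetric] by (intro nn_integral_cong) auto
    finally show ?thesis using assms(1) by (simp add: weight_sum)
  qed
  have "AE \<omega> in M. \<omega> \<in> ?D \<longleftrightarrow> \<omega> \<in> (\<Union>n. E n)"
    using AE_space AE_good AE_nonexplosive
  proof eventually_elim
    case (elim \<omega>)
    then show ?case
      using entrance_place_iff[OF right_cont_path[OF elim(1)] elim(3) assms(2)] E_iff[OF elim(1)] by simp
  qed
  then have "emeasure M ?D = emeasure M (\<Union>n. E n)"
    by (rule emeasure_eq_AE) (use E_ev entrance_place_measurable[of B y] in auto)
  also have "\<dots> = (\<Sum>n. emeasure M (E n))"
  proof (rule suminf_emeasure[symmetric])
    have "E m \<inter> E n = {}" if "m < n" for m n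
    proof (rule ccontr)
      assume "E m \<inter> E n \<noteq> {}"
      then obtain \<omega> l k where w: "l \<in> T m" "\<omega> \<in> cyl l (\<lambda>_. 0)" "k \<in> T n" "\<omega> \<in> cyl k (\<lambda>_. 0)"
        by (auto simp: E_def)
      have len: "length l = Suc m" "length k = Suc n" using w by (auto simp: T_def good_def)
      have "l ! m = Y m \<omega>" "k ! m = Y m \<omega>" using w len that by (auto simp: cyl_def)
      moreover have "l ! m = y"
        using w len last_conv_nth[of l] by (cases "l = []") (auto simp: T_def)
      moreover have "k ! m \<in> set (butlast k)"
        using len that by (metis diff_Suc_1 length_butlast nth_butlast nth_mem)
      ultimately show False using w assms(2) by (auto simp: T_def)
    qed
    then show "disjoint_family E"
      unfolding disjoint_family_on_def by (metis inf_commute linorder_neqE_nat)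
  qed (use E_ev in auto)
  also have "\<dots> = emeasure M (E 0) + (\<Sum>n. emeasure M (E (Suc n)))"
    by (rule suminf_split_first)
  also have "emeasure M (E 0) + (\<Sum>n. emeasure M (E (Suc n)))
      = csum (\<lambda>z. green (killed p (- B)) x z * p z y)"
    unfolding E0 Suc by (simp add: csum_suminf[symmetric] green_def)
  finally show ?thesis .
qed

end

section \<open>The generator of a skip-free process\<close>

lemma csum_finite: "csum f = (\<Sum>j\<in>UNIV. f j)" for f :: "'n::finite \<Rightarrow> ennreal"
  by (rule csum_finite_support) auto

lemma csum_state:
  fixes f :: "(int \<times> 'n::finite) option \<Rightarrow> ennreal"
  shows "csum f = f None + csum (\<lambda>l. \<Sum>j\<in>UNIV. f (Some (l, j)))"
proof -
  have "csum f = csum (\<lambda>z. (if None = z then 1 else 0) * f z + (if z = None then 0 else f z))"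
    by (intro nn_integral_cong) auto
  also have "\<dots> = f None + csum (\<lambda>z. if z = None then 0 else f z)"
    by (simp only: csum_add csum_delta)
  also have "csum (\<lambda>z. if z = None then 0 else f z) = csum (\<lambda>z. if Some z = None then 0 else f (Some z))"
    by (rule csum_reindex) (auto simp: image_iff)
  also have "\<dots> = csum (\<lambda>z. f (Some z))" by simp
  also have "\<dots> = csum (\<lambda>l. csum (\<lambda>j. f (Some (l, j))))"
    by (rule nn_integral_fst_count_space[of "\<lambda>z. f (Some z)", symmetric])
  finally show ?thesis by (simp add: csum_finite)
qed

lemma csum_int_from:
  fixes f :: "int \<Rightarrow> ennreal"
  assumes "\<And>l. l < c \<Longrightarrow> f l = 0"
  shows "csum f = (\<Sum>n. f (c + int n))"
  unfolding nn_integral_count_space_nat[symmetric]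
proof (rule csum_reindex)
  show "inj (\<lambda>n. c + int n)" by (simp add: inj_def)
  show "f l = 0" if "l \<notin> range (\<lambda>n. c + int n)" for l
  proof (cases "l < c")
    case False
    then have "l = c + int (nat (l - c))" by simp
    then show ?thesis using that by blast
  qed (rule assms)
qed

lemma csum_int_below:
  fixes f :: "int \<Rightarrow> ennreal"
  assumes "\<And>l. l \<ge> 0 \<Longrightarrow> f l = 0"
  shows "csum f = (\<Sum>n. f (- int (Suc n)))"
  unfolding nn_integral_count_space_nat[symmetric]
proof (rule csum_reindex)
  show "inj (\<lambda>n. - int (Suc n))" by (simp add: inj_def)
  show "f l = 0" if "l \<notin> range (\<lambda>n. - int (Suc n))" for l
  proof (cases "l \<ge> 0")
    case False
    then have "l = - int (Suc (nat (- l - 1)))" by simp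
    then show ?thesis using that by blast
  qed (rule assms)
qed

lemma sums_from_ennreal:
  assumes "ennreal c = ennreal d + (\<Sum>n. ennreal (t n))" "\<And>n. 0 \<le> t n" "0 \<le> c" "0 \<le> d"
  shows "t sums (c - d)"
proof -
  have "(\<Sum>n. ennreal (t n)) \<le> ennreal c" using assms(1) by simp
  then have fin: "(\<Sum>n. ennreal (t n)) \<noteq> top" by (auto simp: top_unique)
  then have s: "summable t" using assms(2) by (intro summable_suminf_not_top) auto
  have "ennreal c = ennreal (d + suminf t)"
    using assms s by (simp add: suminf_ennreal2 suminf_nonneg)
  then have "c = d + suminf t"
    using assms(3,4) suminf_nonneg[OF s assms(2)] by (subst (asm) ennreal_inj) auto
  with s show ?thesis by (simp add: sums_iff)
qed

lemma sums_matrixI: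
  fixes f :: "nat \<Rightarrow> real^'n^'m"
  assumes "\<And>i j. (\<lambda>n. f n $ i $ j) sums (s $ i $ j)"
  shows "f sums s"
  using assms unfolding sums_def by (intro vec_tendstoI) (simp add: sum_component)

lemma sums_matrixD:
  fixes f :: "nat \<Rightarrow> real^'n^'m"
  shows "f sums s \<Longrightarrow> (\<lambda>n. f n $ i $ j) sums (s $ i $ j)"
  by (intro bounded_linear.sums[OF bounded_linear_vec_nth])

lemma kpow_conjugate:
  assumes "bij \<sigma>" "\<And>x y. K' (\<sigma> x) (\<sigma> y) = K x y"
  shows "kpow K' n (\<sigma> x) (\<sigma> y) = kpow K n x y"
proof (induction n arbitrary: y)
  case 0
  then show ?case using assms(1) by (auto simp: bij_def inj_eq)
next
  case (Suc n)
  have "kpow K' (Suc n) (\<sigma> x) (\<sigma> y) = csum (\<lambda>z. kpow K' n (\<sigma> x) (\<sigma> z) * K' (\<sigma> z) (\<sigma> y))"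
    using assms(1) unfolding kpow.simps
    by (intro csum_reindex) (auto simp: bij_def)
  then show ?case by (simp add: Suc assms(2))
qed

text \<open>Properties of the rates of a skip-free process.\<close>

locale skip_free =
  fixes A :: "int \<Rightarrow> real^'n^'n"
  assumes rates: "skip_free_rates A"
begin

abbreviation "p x y \<equiv> ennreal (jump_prob (generator A) x y)"
text \<open>The total rate of leaving a state of phase \<open>i\<close>, killing included.\<close>

definition lam :: "'n \<Rightarrow> real" where "lam i = - A 0 $ i $ i"

lemma lam_pos: "0 < lam i"
  using rates by (simp add: lam_def skip_free_rates_def)

lemma A_nonneg: "m \<noteq> 0 \<or> i \<noteq> j \<Longrightarrow> 0 \<le> A m $ i $ j"
  using rates by (simp add: skip_free_rates_def)

lemma A_zero: "m \<le> -2 \<Longrightarrow> A m = 0"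
  using rates by (simp add: skip_free_rates_def)

lemma killing_nonneg: "0 \<le> killing_rate A $ i"
  using rates by (simp add: skip_free_rates_def)

lemma A_sums: "(\<lambda>n. A (int n - 1)) sums phase_gen A"
  unfolding phase_gen_def using rates by (intro summable_sums) (simp add: skip_free_rates_def)

lemma row_sums: "(\<lambda>n. \<Sum>j\<in>UNIV. A (int n - 1) $ i $ j) sums (- killing_rate A $ i)"
proof -
  have "(\<lambda>n. \<Sum>j\<in>UNIV. A (int n - 1) $ i $ j) sums (\<Sum>j\<in>UNIV. phase_gen A $ i $ j)"
    by (intro sums_sum sums_matrixD A_sums)
  then show ?thesis by (simp add: killing_rate_def matrix_vector_mult_def)
qed

text \<open>The jump rates, with the diagonal removed.\<close>

definition off :: "int \<Rightarrow> 'n \<Rightarrow> 'n \<Rightarrow> real" where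
  "off m i j = (if m = 0 \<and> i = j then 0 else A m $ i $ j)"

lemma off_nonneg: "0 \<le> off m i j"
  by (auto simp: off_def A_nonneg)

lemma off_zero: "m \<le> -2 \<Longrightarrow> off m i j = 0"
  by (simp add: off_def A_zero)

lemma off_eq: "off m i j = A m $ i $ j + (if m = 0 \<and> i = j then lam i else 0)"
  by (simp add: off_def lam_def)

lemma sum_off_left:
  fixes f :: "'n \<Rightarrow> 'a::real_algebra_1"
  shows "(\<Sum>a\<in>UNIV. of_real (off m i a) * f a)
    = (\<Sum>a\<in>UNIV. of_real (A m $ i $ a) * f a) + (if m = 0 then of_real (lam i) * f i else 0)"
proof -
  have "of_real (off m i a) * f a = of_real (A m $ i $ a) * f a
      + (if i = a then if m = 0 then of_real (lam i) * f a else 0 else 0)" for a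
    by (simp add: off_eq distrib_right)
  then show ?thesis by (simp only: sum.distrib sum.delta' finite UNIV_I if_True)
qed

lemma sum_off_right:
  fixes f :: "'n \<Rightarrow> real"
  shows "(\<Sum>a\<in>UNIV. f a * off m a j) = (\<Sum>a\<in>UNIV. f a * A m $ a $ j) + (if m = 0 then f j * lam j else 0)"
proof -
  have "f a * off m a j = f a * A m $ a $ j + (if j = a then if m = 0 then f a * lam a else 0 else 0)" for a
    by (simp add: off_eq distrib_left)
  then show ?thesis by (simp only: sum.distrib sum.delta' finite UNIV_I if_True)
qed

lemma off_row_sum: "(\<Sum>j\<in>UNIV. off m i j) = (\<Sum>j\<in>UNIV. A m $ i $ j) + (if m = 0 then lam i else 0)"
  using sum_off_left[of m i "\<lambda>_. 1 :: real"] by simp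

lemma jump_prob_Some: "jump_prob (generator A) (Some (k, i)) (Some (l, j)) = off (l - k) i j / lam i"
  using lam_pos[of i] by (auto simp: jump_prob_def off_def lam_def)

lemma jump_prob_None: "jump_prob (generator A) (Some (k, i)) None = killing_rate A $ i / lam i"
  using lam_pos[of i] by (auto simp: jump_prob_def lam_def)

lemma jump_prob_from_None: "jump_prob (generator A) None y = (if y = None then 1 else 0)"
  by (auto simp: jump_prob_def)

lemma jump_prob_nonneg: "0 \<le> jump_prob (generator A) x y"
proof (cases x)
  case (Some a)
  then obtain k i where x: "x = Some (k, i)" by (cases a) auto
  show ?thesis
  proof (cases y)
    case None
    then show ?thesis using lam_pos[of i] killing_nonneg[of i] by (simp add: x jump_prob_None)
  next
    case (Some b)
    then show ?thesis using lam_pos[of i] off_nonneg by (cases b) (simp add: x jump_prob_Some)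
  qed
qed (simp add: jump_prob_from_None)

lemma jump_prob_sum: "csum (p x) = 1"
proof (cases x)
  case None
  have "csum (p x) = csum (\<lambda>z. (if x = z then 1 else 0) * 1)"
    unfolding None by (intro nn_integral_cong) (simp add: jump_prob_from_None)
  then show ?thesis unfolding csum_delta .
next
  case (Some a)
  then obtain k i where x: "x = Some (k, i)" by (cases a) auto
  let ?t = "\<lambda>n. (\<Sum>j\<in>UNIV. off (int n - 1) i j / lam i)"
  have t: "?t sums ((- killing_rate A $ i + lam i) / lam i)"
  proof -
    have "(\<lambda>n. (\<Sum>j\<in>UNIV. A (int n - 1) $ i $ j) + (if n = 1 then lam i else 0)) sums
        (- killing_rate A $ i + lam i)"
      by (intro sums_add row_sums sums_single)
    then have "(\<lambda>n. ((\<Sum>j\<in>UNIV. A (int n - 1) $ i $ j) + (if n = 1 then lam i else 0)) / lam i) sums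
        ((- killing_rate A $ i + lam i) / lam i)"
      by (rule sums_divide)
    moreover have "((\<Sum>j\<in>UNIV. A (int n - 1) $ i $ j) + (if n = 1 then lam i else 0)) / lam i = ?t n" for n
      by (simp add: sum_divide_distrib[symmetric] off_row_sum)
    ultimately show ?thesis by simp
  qed
  have "csum (p x) = ennreal (killing_rate A $ i / lam i) + csum (\<lambda>l. \<Sum>j\<in>UNIV. ennreal (off (l - k) i j / lam i))"
    unfolding x csum_state by (simp add: jump_prob_None jump_prob_Some)
  also have "csum (\<lambda>l. \<Sum>j\<in>UNIV. ennreal (off (l - k) i j / lam i))
      = (\<Sum>n. \<Sum>j\<in>UNIV. ennreal (off (k - 1 + int n - k) i j / lam i))"
    by (rule csum_int_from) (simp add: off_zero)
  also have "\<dots> = (\<Sum>n. ennreal (?t n))"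
    using lam_pos[of i] off_nonneg by (simp add: sum_ennreal)
  also have "\<dots> = ennreal ((- killing_rate A $ i + lam i) / lam i)"
    using t lam_pos[of i] off_nonneg
    by (intro suminf_ennreal_eq) (auto intro!: sum_nonneg divide_nonneg_pos)
  also have "ennreal (killing_rate A $ i / lam i) + \<dots> = ennreal (killing_rate A $ i / lam i + (- killing_rate A $ i + lam i) / lam i)"
  proof (rule ennreal_plus[symmetric])
    show "0 \<le> killing_rate A $ i / lam i" using lam_pos[of i] killing_nonneg[of i] by simp
    show "0 \<le> (- killing_rate A $ i + lam i) / lam i"
      using t lam_pos[of i] off_nonneg by (intro sums_le[OF _ sums_zero t]) (auto intro!: sum_nonneg divide_nonneg_pos)
  qed
  also have "killing_rate A $ i / lam i + (- killing_rate A $ i + lam i) / lam i = 1"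
    using lam_pos[of i] by (simp add: add_divide_distrib[symmetric])
  finally show ?thesis by simp
qed

lemma bounded_chainI:
  assumes "markov_chain M Z (generator A) x"
  shows "bounded_chain M Z (generator A) x (\<Sum>i\<in>UNIV. lam i)"
proof
  show "markov_chain M Z (generator A) x" by fact
  show "generator A y y \<le> 0" "- generator A y y \<le> (\<Sum>i\<in>UNIV. lam i)" for y
  proof -
    have "lam i \<le> (\<Sum>i\<in>UNIV. lam i)" for i
      by (rule member_le_sum) (auto intro: less_imp_le lam_pos)
    moreover have "0 \<le> (\<Sum>i\<in>UNIV. lam i)" by (intro sum_nonneg) (auto intro: less_imp_le lam_pos)
    moreover have "generator A y y = 0 \<or> (\<exists>i. generator A y y = - lam i)"
      by (cases y) (auto simp: lam_def)
    ultimately show "generator A y y \<le> 0" "- generator A y y \<le> (\<Sum>i\<in>UNIV. lam i)"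
      using lam_pos by (auto intro: less_imp_le)
  qed
  show "0 \<le> jump_prob (generator A) y z" for y z by (rule jump_prob_nonneg)
  show "csum (p y) = 1" for y by (rule jump_prob_sum)
qed

text \<open>
  A path of positive rates from \<open>D\<close> to its complement contains an initial part inside \<open>D\<close>, followed by
  a jump out of \<open>D\<close>.
\<close>

lemma exit_path:
  assumes "(x, y) \<in> {(u, v). u \<in> range Some \<and> v \<in> range Some \<and> u \<noteq> v \<and> generator A u v > 0}\<^sup>*"
    and "x \<in> D" "y \<notin> D"
  shows "\<exists>w u. (x, w) \<in> {(u, v). killed p D u v > 0}\<^sup>* \<and> w \<in> D \<and> u \<notin> D \<and> p w u > 0"
  using assms
proof (induction rule: converse_rtrancl_induct)
  case (step a b)
  have pos: "p a b > 0"
  proof -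
    obtain k i l j where "a = Some (k, i)" "b = Some (l, j)" using step by auto
    moreover have "(k, i) \<noteq> (l, j)" "A (l - k) $ i $ j > 0" using step calculation by auto
    ultimately show ?thesis using lam_pos[of i] by (auto simp: jump_prob_Some off_def)
  qed
  show ?case
  proof (cases "b \<in> D")
    case True
    then obtain w u where w: "(b, w) \<in> {(u, v). killed p D u v > 0}\<^sup>*" "w \<in> D" "u \<notin> D" "p w u > 0"
      using step by blast
    have "(a, b) \<in> {(u, v). killed p D u v > 0}" using pos True step by (simp add: killed_def)
    with w show ?thesis by (meson converse_rtrancl_into_rtrancl)
  next
    case False
    with pos step show ?thesis by blast
  qed
qed simp

text \<open>By irreducibility, the Green function of the chain killed outside a proper subset is finite.\<close>

lemma green_killed_finite:
  assumes D: "D \<subseteq> range Some" and y: "y \<in> range Some" "y \<notin> D" and "x \<in> D"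
  shows "green (killed p D) x0 x < \<infinity>"
proof -
  have "(x, y) \<in> {(u, v). u \<in> range Some \<and> v \<in> range Some \<and> u \<noteq> v \<and> generator A u v > 0}\<^sup>*"
  proof -
    have "irreducible_on (range Some) (generator A)"
      using rates by (simp add: skip_free_rates_def)
    moreover have "x \<in> range Some" using D \<open>x \<in> D\<close> by (rule subsetD)
    ultimately show ?thesis using y(1) unfolding irreducible_on_def by (elim ballE) auto
  qed
  from exit_path[OF this \<open>x \<in> D\<close> y(2)] obtain w u where
    w: "(x, w) \<in> {(u, v). killed p D u v > 0}\<^sup>*" "w \<in> D" "u \<notin> D" "p w u > 0" by blast
  have sub: "csum (killed p D z) \<le> 1" for z
  proof -
    have "csum (killed p D z) \<le> csum (p z)" by (intro nn_integral_mono) (simp add: killed_def)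
    then show ?thesis by (simp add: jump_prob_sum)
  qed
  have "csum (killed p D w) + p w u \<le> csum (\<lambda>z. killed p D w z + (if u = z then 1 else 0) * p w z)"
    by (simp only: csum_add csum_delta order_refl)
  also have "\<dots> \<le> csum (p w)" using w by (intro nn_integral_mono) (auto simp: killed_def)
  finally have le: "csum (killed p D w) + p w u \<le> 1" by (simp add: jump_prob_sum)
  have "csum (killed p D w) < 1"
  proof (rule ccontr)
    assume "\<not> csum (killed p D w) < 1"
    then have "csum (killed p D w) = 1" using sub[of w] by (simp add: antisym)
    with le w(4) show False using ennreal_add_left_cancel_le[of 1 "p w u" 0] by simp
  qed
  from green_finite_at_leak[of "killed p D" w x0, OF sub this] show ?thesis
    by (rule green_finite_along_path[OF w(1)])
qed

text \<open>The states of level less than \<open>c\<close>.\<close>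

definition below :: "int \<Rightarrow> 'n state set" where
  "below c = {Some (l, i) | l i. l < c}"

lemma below_iff [simp]: "Some (l, i) \<in> below c \<longleftrightarrow> l < c" "None \<notin> below c"
  by (auto simp: below_def)

lemma green_shift:
  "green (killed p (below (c + t))) (Some (l + t, i)) (Some (l' + t, j))
    = green (killed p (below c)) (Some (l, i)) (Some (l', j))"
proof -
  define \<sigma> :: "'n state \<Rightarrow> 'n state" where "\<sigma> = map_option (\<lambda>(l, i). (l + t, i))"
  have "bij \<sigma>"
    by (rule o_bij[of "map_option (\<lambda>(l, i). (l - t, i))"])
      (auto simp: \<sigma>_def fun_eq_iff option.map_comp o_def case_prod_beta intro: option.map_ident_strong)
  moreover have "killed p (below (c + t)) (\<sigma> x) (\<sigma> y) = killed p (below c) x y" for x y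
    by (cases x; cases y) (auto simp: \<sigma>_def killed_def jump_prob_Some)
  ultimately have "kpow (killed p (below (c + t))) n (\<sigma> x) (\<sigma> y) = kpow (killed p (below c)) n x y" for n x y
    by (rule kpow_conjugate)
  from this[of _ "Some (l, i)" "Some (l', j)"] show ?thesis
    by (simp add: green_def \<sigma>_def)
qed

end

section \<open>Block equations for the occupation times\<close>

lemma matrix_sums_left:
  fixes f :: "nat \<Rightarrow> real^'n^'m"
  assumes "f sums s" shows "(\<lambda>n. M ** f n) sums (M ** s)"
proof (rule sums_matrixI)
  fix i j
  have "(\<lambda>n. \<Sum>k\<in>UNIV. M $ i $ k * f n $ k $ j) sums (\<Sum>k\<in>UNIV. M $ i $ k * s $ k $ j)"
    by (intro sums_sum sums_mult sums_matrixD assms)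
  then show "(\<lambda>n. (M ** f n) $ i $ j) sums ((M ** s) $ i $ j)"
    by (simp add: matrix_matrix_mult_def)
qed

lemma matpow_add: "matpow M (m + n) = matpow M m ** matpow M n"
  by (induction m) (simp_all add: matrix_mul_assoc)

lemma matpow_nonneg:
  fixes M :: "real^'n^'n"
  shows "(\<And>i j. 0 \<le> M $ i $ j) \<Longrightarrow> 0 \<le> matpow M n $ i $ j"
proof (induction n arbitrary: i j)
  case 0
  then show ?case by (simp add: mat_def)
next
  case (Suc n)
  then show ?case by (auto simp: matrix_matrix_mult_def intro!: sum_nonneg mult_nonneg_nonneg)
qed

context skip_free begin

lemma below_range: "below c \<subseteq> range Some"
  by (auto simp: below_def)

lemma below_mono: "c \<le> d \<Longrightarrow> below c \<subseteq> below d"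
  by (auto simp: below_def)

text \<open>
  States at depth \<open>n\<close>, and the matrix \<open>occ x y\<close> of expected occupation times at depth \<open>y\<close> of the
  process started at depth \<open>x\<close> and killed when it reaches a level \<open>\<ge> 0\<close>; it is meant for \<open>y \<ge> 1\<close>.
\<close>

definition dep :: "nat \<Rightarrow> 'n \<Rightarrow> 'n state" where
  "dep n i = Some (- int n, i)"

abbreviation (input) "\<Gamma> \<equiv> green (killed p (below 0))"

definition occ :: "nat \<Rightarrow> nat \<Rightarrow> real^'n^'n" where
  "occ x y = (\<chi> i j. enn2real (\<Gamma> (dep x i) (dep y j)) / lam j)"

lemma dep_below [simp]: "dep n i \<in> below c \<longleftrightarrow> - int n < c"
  by (simp add: dep_def)

lemma jump_prob_dep: "jump_prob (generator A) (dep x i) (dep y j) = off (int x - int y) i j / lam i"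
  by (simp add: dep_def jump_prob_Some)

lemma occ_nonneg: "0 \<le> occ x y $ i $ j"
  using lam_pos[of j] by (simp add: occ_def)

lemma green_dep:
  assumes "1 \<le> y"
  shows "\<Gamma> x0 (dep y j) < \<infinity>"
    and "\<Gamma> (dep x i) (dep y j) = ennreal (lam j * occ x y $ i $ j)"
proof -
  show fin: "\<Gamma> x0 (dep y j) < \<infinity>" for x0
    using assms by (intro green_killed_finite[OF below_range, of "Some (0, j)"]) auto
  show "\<Gamma> (dep x i) (dep y j) = ennreal (lam j * occ x y $ i $ j)"
    using fin[of "dep x i"] lam_pos[of j] by (simp add: occ_def)
qed

lemma csum_depth:
  assumes "\<And>z. z \<notin> below 0 \<Longrightarrow> f z = 0"
  shows "csum f = (\<Sum>n. \<Sum>j\<in>UNIV. f (dep (Suc n) j))"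
proof -
  have "csum f = f None + csum (\<lambda>l. \<Sum>j\<in>UNIV. f (Some (l, j)))"
    by (rule csum_state)
  also have "csum (\<lambda>l. \<Sum>j\<in>UNIV. f (Some (l, j))) = (\<Sum>n. \<Sum>j\<in>UNIV. f (Some (- int (Suc n), j)))"
    by (rule csum_int_below) (simp add: assms)
  finally show ?thesis by (simp add: assms dep_def)
qed

lemma dep_eq_iff [simp]: "dep x i = dep y j \<longleftrightarrow> x = y \<and> i = j"
  by (simp add: dep_def)

lemma occ_forward_entry:
  assumes "1 \<le> x" "1 \<le> y"
  shows "(\<lambda>n. (occ x (Suc n) ** A (int (Suc n) - int y)) $ i $ j) sums (- (if x = y \<and> i = j then 1 else 0))"
proof -
  let ?t = "\<lambda>n. \<Sum>a\<in>UNIV. occ x (Suc n) $ i $ a * off (int (Suc n) - int y) a j"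
  have "ennreal (lam j * occ x y $ i $ j) = \<Gamma> (dep x i) (dep y j)"
    using assms by (simp add: green_dep)
  also have "\<dots> = ennreal (if x = y \<and> i = j then 1 else 0)
      + csum (\<lambda>z. \<Gamma> (dep x i) z * killed p (below 0) z (dep y j))"
    by (subst green_forward) simp
  also have "csum (\<lambda>z. \<Gamma> (dep x i) z * killed p (below 0) z (dep y j))
      = (\<Sum>n. \<Sum>a\<in>UNIV. \<Gamma> (dep x i) (dep (Suc n) a) * killed p (below 0) (dep (Suc n) a) (dep y j))"
    by (rule csum_depth) (simp add: killed_def)
  also have "\<dots> = (\<Sum>n. ennreal (?t n))"
  proof (intro suminf_cong)
    fix n
    have "\<Gamma> (dep x i) (dep (Suc n) a) * killed p (below 0) (dep (Suc n) a) (dep y j)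
        = ennreal (occ x (Suc n) $ i $ a * off (int (Suc n) - int y) a j)" for a
      using assms lam_pos[of a] off_nonneg occ_nonneg
      by (simp add: green_dep killed_def jump_prob_dep ennreal_mult[symmetric])
    then show "(\<Sum>a\<in>UNIV. \<Gamma> (dep x i) (dep (Suc n) a) * killed p (below 0) (dep (Suc n) a) (dep y j))
        = ennreal (?t n)"
      using off_nonneg occ_nonneg by (simp add: sum_ennreal)
  qed
  finally have "?t sums (lam j * occ x y $ i $ j - (if x = y \<and> i = j then 1 else 0))"
    using lam_pos[of j] occ_nonneg off_nonneg
    by (intro sums_from_ennreal) (auto intro!: sum_nonneg mult_nonneg_nonneg)
  moreover have "(\<lambda>n. if n = y - 1 then lam j * occ x y $ i $ j else 0) sums (lam j * occ x y $ i $ j)"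
    by (rule sums_single)
  ultimately have "(\<lambda>n. ?t n - (if n = y - 1 then lam j * occ x y $ i $ j else 0)) sums
      (lam j * occ x y $ i $ j - (if x = y \<and> i = j then 1 else 0) - lam j * occ x y $ i $ j)"
    by (rule sums_diff)
  moreover have "?t n - (if n = y - 1 then lam j * occ x y $ i $ j else 0)
      = (occ x (Suc n) ** A (int (Suc n) - int y)) $ i $ j" for n
  proof -
    have "int (Suc n) - int y = 0 \<longleftrightarrow> n = y - 1" using assms by auto
    then show ?thesis using assms by (auto simp: sum_off_right matrix_matrix_mult_def mult.commute)
  qed
  ultimately show ?thesis by simp
qed

lemma occ_forward:
  "1 \<le> x \<Longrightarrow> (\<lambda>n. occ x (Suc n) ** A (int (Suc n) - int x)) sums (- mat 1)"
  by (rule sums_matrixI) (use occ_forward_entry[of x x] in \<open>auto simp: mat_def\<close>)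

lemma occ_backward:
  assumes "1 \<le> x" "x < y"
  shows "(\<Sum>n=1..Suc x. A (int x - int n) ** occ n y) = 0"
proof -
  have entry: "(\<Sum>n<Suc x. (A (int x - int (Suc n)) ** occ (Suc n) y) $ i $ j) = 0" for i j
  proof -
    let ?t = "\<lambda>n. \<Sum>a\<in>UNIV. off (int x - int (Suc n)) i a * occ (Suc n) y $ a $ j"
    have "ennreal (lam j * occ x y $ i $ j) = \<Gamma> (dep x i) (dep y j)"
      using assms by (simp add: green_dep)
    also have "\<dots> = csum (\<lambda>z. killed p (below 0) (dep x i) z * \<Gamma> z (dep y j))"
      using assms by (subst green_backward) simp
    also have "\<dots> = (\<Sum>n. \<Sum>a\<in>UNIV. killed p (below 0) (dep x i) (dep (Suc n) a) * \<Gamma> (dep (Suc n) a) (dep y j))"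
      by (rule csum_depth) (simp add: killed_def)
    also have "\<dots> = (\<Sum>n. ennreal (lam j / lam i * ?t n))"
    proof (intro suminf_cong)
      fix n
      have "killed p (below 0) (dep x i) (dep (Suc n) a) * \<Gamma> (dep (Suc n) a) (dep y j)
          = ennreal (lam j / lam i * (off (int x - int (Suc n)) i a * occ (Suc n) y $ a $ j))" for a
        using assms lam_pos[of i] lam_pos[of j] off_nonneg occ_nonneg
        by (simp add: green_dep killed_def jump_prob_dep ennreal_mult[symmetric] mult_ac)
      then show "(\<Sum>a\<in>UNIV. killed p (below 0) (dep x i) (dep (Suc n) a) * \<Gamma> (dep (Suc n) a) (dep y j))
          = ennreal (lam j / lam i * ?t n)"
        using off_nonneg occ_nonneg lam_pos[of i] lam_pos[of j]
        by (simp add: sum_ennreal sum_distrib_left)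
    qed
    also have "\<dots> = (\<Sum>n<Suc x. ennreal (lam j / lam i * ?t n))"
      by (rule suminf_finite) (auto simp: off_zero)
    also have "\<dots> = ennreal (\<Sum>n<Suc x. lam j / lam i * ?t n)"
      using off_nonneg occ_nonneg lam_pos[of i] lam_pos[of j]
      by (intro sum_ennreal) (auto intro!: sum_nonneg mult_nonneg_nonneg divide_nonneg_pos)
    finally have enn: "ennreal (lam j * occ x y $ i $ j) = ennreal (\<Sum>n<Suc x. lam j / lam i * ?t n)" .
    have "0 \<le> lam j / lam i * ?t n" for n
      using off_nonneg occ_nonneg lam_pos[of i] lam_pos[of j]
      by (auto intro!: sum_nonneg mult_nonneg_nonneg divide_nonneg_pos)
    then have "0 \<le> (\<Sum>n<Suc x. lam j / lam i * ?t n)" by (intro sum_nonneg)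
    from ennreal_inj[OF mult_nonneg_nonneg[OF less_imp_le[OF lam_pos] occ_nonneg] this] enn
    have "lam j * occ x y $ i $ j = (\<Sum>n<Suc x. lam j / lam i * ?t n)" by blast
    also have "\<dots> = lam j / lam i * (\<Sum>n<Suc x. ?t n)" by (rule sum_distrib_left[symmetric])
    finally have "lam j * occ x y $ i $ j = lam j / lam i * (\<Sum>n<Suc x. ?t n)" .
    moreover have "a * u = s" if "b * u = b / a * s" "0 < a" "0 < b" for a b u s :: real
      using that by (simp add: field_simps)
    ultimately have eq: "lam i * occ x y $ i $ j = (\<Sum>n<Suc x. ?t n)"
      using lam_pos by blast
    have "?t n = (A (int x - int (Suc n)) ** occ (Suc n) y) $ i $ j
        + (if n = x - 1 then lam i * occ x y $ i $ j else 0)" for n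
    proof -
      have "int x - int (Suc n) = 0 \<longleftrightarrow> n = x - 1" using assms by auto
      then show ?thesis
        using assms sum_off_left[of "int x - int (Suc n)" i "\<lambda>a. occ (Suc n) y $ a $ j"]
        by (auto simp: matrix_matrix_mult_def)
    qed
    then have "(\<Sum>n<Suc x. ?t n) = (\<Sum>n<Suc x. (A (int x - int (Suc n)) ** occ (Suc n) y) $ i $ j)
        + (\<Sum>n<Suc x. if n = x - 1 then lam i * occ x y $ i $ j else 0)"
      by (simp only: sum.distrib)
    also have "(\<Sum>n<Suc x. if n = x - 1 then lam i * occ x y $ i $ j else 0) = lam i * occ x y $ i $ j"
      by (subst sum.delta) auto
    finally show ?thesis using eq by simp
  qed
  have "(\<Sum>n=1..Suc x. A (int x - int n) ** occ n y) = (\<Sum>n<Suc x. A (int x - int (Suc n)) ** occ (Suc n) y)"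
    by (rule sum.reindex_bij_witness[of _ Suc "\<lambda>n. n - 1"]) auto
  also have "\<dots> = 0"
    using entry by (simp add: vec_eq_iff sum_component)
  finally show ?thesis .
qed

text \<open>
  Last exit from depth \<open>y\<close>: the only way from depths at most \<open>y\<close> to greater ones is a jump from \<open>y\<close>
  to \<open>y + 1\<close>, and after the last one the process is, up to a shift, one that starts at depth 1.
\<close>

lemma occ_step:
  assumes "1 \<le> x" "x \<le> y"
  shows "occ x (Suc y) = occ x y ** A (-1) ** occ 1 1"
proof -
  have "occ x (Suc y) $ i $ j = (occ x y ** A (-1) ** occ 1 1) $ i $ j" for i j
  proof -
    let ?D = "below 0" and ?D' = "below (- int y)"
    let ?G' = "green (killed p ?D')"
    define src where "src u = (if u \<in> ?D' then csum (\<lambda>z. if z \<in> ?D - ?D' then \<Gamma> (dep x i) z * p z u else 0) else 0)" for u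
    have src_dep: "src (dep (Suc m) b) = (if m = y then ennreal ((occ x y ** A (-1)) $ i $ b) else 0)" for m b
    proof (cases "y \<le> m")
      case True
      have "src (dep (Suc m) b)
          = csum (\<lambda>z. if z \<in> ?D - ?D' then \<Gamma> (dep x i) z * p z (dep (Suc m) b) else 0)"
        using True by (simp add: src_def)
      also have "\<dots> = (\<Sum>n. \<Sum>a\<in>UNIV. if Suc n \<le> y
          then \<Gamma> (dep x i) (dep (Suc n) a) * p (dep (Suc n) a) (dep (Suc m) b) else 0)"
        by (subst csum_depth) (auto intro!: suminf_cong sum.cong)
      also have "\<dots> = (\<Sum>n\<in>{y - 1}. \<Sum>a\<in>UNIV. if Suc n \<le> y
          then \<Gamma> (dep x i) (dep (Suc n) a) * p (dep (Suc n) a) (dep (Suc m) b) else 0)"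
        using True by (intro suminf_finite) (auto simp: jump_prob_dep off_zero)
      also have "\<dots> = (\<Sum>a\<in>UNIV. \<Gamma> (dep x i) (dep y a) * p (dep y a) (dep (Suc m) b))"
        using assms by simp
      also have "\<dots> = (if m = y then ennreal ((occ x y ** A (-1)) $ i $ b) else 0)"
      proof (cases "m = y")
        case True
        have "\<Gamma> (dep x i) (dep y a) * p (dep y a) (dep (Suc m) b)
            = ennreal (occ x y $ i $ a * A (-1) $ a $ b)" for a
          using assms True lam_pos[of a] A_nonneg[of "-1" a b] occ_nonneg[of x y i a]
          by (simp add: green_dep jump_prob_dep off_def ennreal_mult[symmetric])
        then show ?thesis
          using True occ_nonneg A_nonneg[of "-1"] by (simp add: sum_ennreal matrix_matrix_mult_def)
      qed (use True in \<open>simp add: jump_prob_dep off_zero\<close>)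
      finally show ?thesis .
    next
      case False
      then show ?thesis by (simp add: src_def)
    qed
    have "\<Gamma> (dep x i) (dep (Suc y) j) = csum (\<lambda>u. src u * ?G' u (dep (Suc y) j))"
      unfolding src_def using assms by (intro last_exit_decomposition below_mono) auto
    also have "\<dots> = (\<Sum>m. \<Sum>b\<in>UNIV. src (dep (Suc m) b) * ?G' (dep (Suc m) b) (dep (Suc y) j))"
      by (rule csum_depth) (use below_mono[of "- int y" 0] in \<open>auto simp: src_def\<close>)
    also have "\<dots> = (\<Sum>m\<in>{y}. \<Sum>b\<in>UNIV. src (dep (Suc m) b) * ?G' (dep (Suc m) b) (dep (Suc y) j))"
      by (rule suminf_finite) (auto simp: src_dep)
    also have "\<dots> = (\<Sum>b\<in>UNIV. ennreal ((occ x y ** A (-1)) $ i $ b) * ennreal (lam j * occ 1 1 $ b $ j))"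
    proof -
      have "?G' (dep (Suc y) b) (dep (Suc y) j) = \<Gamma> (dep 1 b) (dep 1 j)" for b
        using green_shift[of 0 "- int y" "-1" b "-1" j] by (simp add: dep_def)
      then show ?thesis by (simp add: src_dep green_dep)
    qed
    also have "\<dots> = ennreal (lam j * (occ x y ** A (-1) ** occ 1 1) $ i $ j)"
    proof -
      have nn: "0 \<le> (occ x y ** A (-1)) $ i $ b" for b
        using occ_nonneg A_nonneg[of "-1"] by (auto simp: matrix_matrix_mult_def intro!: sum_nonneg)
      have "ennreal ((occ x y ** A (-1)) $ i $ b) * ennreal (lam j * occ 1 1 $ b $ j)
          = ennreal (lam j * ((occ x y ** A (-1)) $ i $ b * occ 1 1 $ b $ j))" for b
        using nn lam_pos[of j] occ_nonneg by (simp add: ennreal_mult[symmetric] mult_ac)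
      moreover have "(occ x y ** A (-1) ** occ 1 1) $ i $ j
          = (\<Sum>b\<in>UNIV. (occ x y ** A (-1)) $ i $ b * occ 1 1 $ b $ j)"
        by (subst matrix_matrix_mult_def) simp
      ultimately show ?thesis
        using nn lam_pos[of j] occ_nonneg
        by (simp add: sum_ennreal sum_distrib_left)
    qed
    finally have "ennreal (lam j * occ x (Suc y) $ i $ j) = ennreal (lam j * (occ x y ** A (-1) ** occ 1 1) $ i $ j)"
      by (simp add: green_dep)
    moreover have "0 \<le> (occ x y ** A (-1) ** occ 1 1) $ i $ j"
      using occ_nonneg A_nonneg[of "-1"]
      by (auto simp: matrix_matrix_mult_def intro!: sum_nonneg mult_nonneg_nonneg)
    ultimately show ?thesis
      using lam_pos[of j] occ_nonneg by (simp add: ennreal_inj)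
  qed
  then show ?thesis by (simp add: vec_eq_iff)
qed

end

section \<open>The matrix \<open>R\<close> and the scale matrices\<close>

lemma matrix_inv_cancel:
  fixes M :: "'a::field^'n^'n"
  assumes "invertible M"
  shows "M ** matrix_inv M = mat 1" "matrix_inv M ** M = mat 1"
proof -
  have "\<exists>M'. M ** M' = mat 1 \<and> M' ** M = mat 1" using assms by (simp add: invertible_def)
  from someI_ex[OF this] show "M ** matrix_inv M = mat 1" "matrix_inv M ** M = mat 1"
    by (simp_all add: matrix_inv_def)
qed

lemma matrix_inv_unique_right:
  fixes M :: "'a::field^'n^'n"
  assumes "M ** B = mat 1" shows "invertible M" "B = matrix_inv M"
proof -
  show inv: "invertible M" using assms matrix_left_right_inverse[of M B] by (auto simp: invertible_def)
  have "B = (matrix_inv M ** M) ** B" using matrix_inv_cancel[OF inv] by simp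
  also have "\<dots> = matrix_inv M" using assms by (simp add: matrix_mul_assoc[symmetric])
  finally show "B = matrix_inv M" .
qed

lemma matpow_Suc_right: "matpow M (Suc n) = matpow M n ** M"
  using matpow_add[of M n "Suc 0"] by simp

lemma matpow_inverse:
  assumes "M ** M' = mat 1" shows "matpow M n ** matpow M' n = mat 1"
proof (induction n)
  case (Suc n)
  have "matpow M (Suc n) ** matpow M' (Suc n) = matpow M n ** (M ** M') ** matpow M' n"
    unfolding matpow_Suc_right[of M] by (simp add: matrix_mul_assoc)
  then show ?case using Suc assms by simp
qed simp

lemma matrix_mult_sum_distrib_right:
  fixes f :: "'b \<Rightarrow> 'a::semiring_1^'n^'m"
  shows "(\<Sum>x\<in>S. f x) ** B = (\<Sum>x\<in>S. f x ** B)"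
  by (auto simp: vec_eq_iff matrix_matrix_mult_def sum_component sum_distrib_right intro: sum.swap)

context skip_free begin

text \<open>
  The rates of the jumps from depth 0 to depth 1, times the expected occupation times at depth 1 that
  follow; this is the minimal solution \<open>R\<close>.
\<close>

definition R0 :: "real^'n^'n" where "R0 = A (-1) ** occ 1 1"

lemma R0_nonneg: "0 \<le> R0 $ i $ j"
  using occ_nonneg A_nonneg[of "-1"] by (auto simp: R0_def matrix_matrix_mult_def intro!: sum_nonneg)

lemma occ_power: "1 \<le> x \<Longrightarrow> occ x (x + n) = occ x x ** matpow R0 n"
proof (induction n)
  case (Suc n)
  have "occ x (x + Suc n) = occ x (x + n) ** R0"
    using occ_step[of x "x + n"] Suc by (simp add: R0_def matrix_mul_assoc)
  then show ?case using Suc by (simp only: matpow_Suc_right matrix_mul_assoc)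
qed simp

lemma occ_first_sums: "(\<lambda>n. occ 1 1 ** (matpow R0 n ** A (int n))) sums (- mat 1)"
proof -
  have "occ 1 (Suc n) ** A (int (Suc n) - int 1) = occ 1 1 ** (matpow R0 n ** A (int n))" for n
    using occ_power[of 1 n] by (simp add: matrix_mul_assoc)
  with occ_forward[of 1] show ?thesis by (simp only: order_refl simp_thms)
qed

lemma R0_solution: "nonneg_solution A R0"
proof -
  have "(\<lambda>n. A (-1) ** (occ 1 1 ** (matpow R0 n ** A (int n)))) sums (A (-1) ** (- mat 1))"
    by (intro matrix_sums_left occ_first_sums)
  moreover have "A (-1) ** (- mat 1) = - A (-1)"
    by (simp add: vec_eq_iff matrix_matrix_mult_def mat_def if_distrib sum_negf cong: if_cong)
  moreover have "A (-1) ** (occ 1 1 ** (matpow R0 n ** A (int n))) = matpow R0 (Suc n) ** A (int (Suc n) - 1)" for n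
    by (simp add: R0_def matrix_mul_assoc)
  ultimately have "(\<lambda>n. matpow R0 (Suc n) ** A (int (Suc n) - 1)) sums (- A (-1))" by simp
  from sums_Suc[OF this] have "(\<lambda>n. matpow R0 n ** A (int n - 1)) sums 0" by simp
  then show ?thesis using R0_nonneg by (simp add: nonneg_solution_def)
qed

lemma R0_minimal:
  assumes "nonneg_solution A R'" shows "R0 $ i $ j \<le> R' $ i $ j"
proof -
  have R': "0 \<le> R' $ i $ j" "(\<lambda>n. matpow R' n ** A (int n - 1)) sums 0" for i j
    using assms by (auto simp: nonneg_solution_def)
  note pow_nonneg = matpow_nonneg[of R', OF R'(1)]
  \<comment> \<open>Row \<open>i\<close> of \<open>R'\<^sup>n\<close>, in terms of visits instead of times, is a measure on the states of depth \<open>n\<close>;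
    it balances the flow out of depth 0, that is, the source \<open>\<mu>\<close>.\<close>
  define \<nu> where "\<nu> z = (case z of None \<Rightarrow> 0 | Some (l, a) \<Rightarrow>
      if l < 0 then ennreal (matpow R' (nat (- l)) $ i $ a * lam a) else 0)" for z
  define \<mu> where "\<mu> z = (case z of None \<Rightarrow> 0 | Some (l, a) \<Rightarrow>
      if l = -1 then ennreal (A (-1) $ i $ a) else 0)" for z :: "'n state"
  have \<nu>_dep: "\<nu> (dep m a) = ennreal (matpow R' m $ i $ a * lam a)" if "1 \<le> m" for m a
    using that by (simp add: \<nu>_def dep_def)
  have \<mu>_dep: "\<mu> (dep m a) = (if m = 1 then ennreal (A (-1) $ i $ a) else 0)" for m a
    by (auto simp: \<mu>_def dep_def)
  have outside: "\<nu> z = 0" "\<mu> z = 0" if "z \<notin> below 0" for z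
    using that by (cases z; force simp: \<nu>_def \<mu>_def)+
  have balance: "(\<lambda>n. matpow R' (Suc n) ** A (int (Suc n) - int m)) sums (- (if m = 1 then A (-1) else 0))"
    if m: "1 \<le> m" for m
  proof -
    have "(\<lambda>n. matpow R' (m - 1) ** (matpow R' n ** A (int n - 1))) sums (matpow R' (m - 1) ** 0)"
      by (rule matrix_sums_left[OF R'(2)])
    moreover have "matpow R' (m - 1) ** (matpow R' n ** A (int n - 1))
        = matpow R' (n + (m - 1)) ** A (int (n + (m - 1)) - int m)" for n
    proof -
      have "int n - 1 = int (n + (m - 1)) - int m" using m by auto
      then show ?thesis by (simp only: matrix_mul_assoc matpow_add[symmetric] add.commute)
    qed
    ultimately have "(\<lambda>n. matpow R' (n + (m - 1)) ** A (int (n + (m - 1)) - int m)) sums 0"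
      by (simp add: matrix_matrix_mult_def zero_vec_def)
    then have "(\<lambda>n. matpow R' n ** A (int n - int m)) sums 0"
    proof (subst (asm) sums_iff_shift)
      have "(\<Sum>n<m - 1. matpow R' n ** A (int n - int m)) = 0"
        by (intro sum.neutral) (auto simp: A_zero matrix_matrix_mult_def zero_vec_def)
      then show "(\<lambda>n. matpow R' n ** A (int n - int m)) sums (0 + (\<Sum>n<m - 1. matpow R' n ** A (int n - int m)))
          \<Longrightarrow> (\<lambda>n. matpow R' n ** A (int n - int m)) sums 0" by simp
    qed
    then have "(\<lambda>n. matpow R' (Suc n) ** A (int (Suc n) - int m)) sums (0 - matpow R' 0 ** A (int 0 - int m))"
      by (subst sums_Suc_iff) simp
    moreover have "A (- int m) = (if m = 1 then A (-1) else 0)"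
      using m by (auto simp: A_zero)
    ultimately show ?thesis by simp
  qed
  have eq: "\<mu> (dep m j) + csum (\<lambda>z. \<nu> z * killed p (below 0) z (dep m j)) = \<nu> (dep m j)"
    if m: "1 \<le> m" for m j
  proof -
    let ?t = "\<lambda>n. \<Sum>a\<in>UNIV. matpow R' (Suc n) $ i $ a * off (int (Suc n) - int m) a j"
    have t_nonneg: "0 \<le> ?t n" for n
      by (intro sum_nonneg mult_nonneg_nonneg pow_nonneg off_nonneg)
    have t_sums: "?t sums (matpow R' m $ i $ j * lam j - (if m = 1 then A (-1) $ i $ j else 0))"
    proof -
      have "(\<lambda>n. (matpow R' (Suc n) ** A (int (Suc n) - int m)) $ i $ j
          + (if n = m - 1 then matpow R' m $ i $ j * lam j else 0))
          sums ((- (if m = 1 then A (-1) else 0)) $ i $ j + matpow R' m $ i $ j * lam j)"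
        by (intro sums_add sums_matrixD balance[OF m] sums_single)
      moreover have "(matpow R' (Suc n) ** A (int (Suc n) - int m)) $ i $ j
          + (if n = m - 1 then matpow R' m $ i $ j * lam j else 0) = ?t n" for n
      proof -
        have "int (Suc n) - int m = 0 \<longleftrightarrow> n = m - 1" using m by auto
        then show ?thesis
          using m by (auto simp: sum_off_right matrix_matrix_mult_def simp del: matpow.simps)
      qed
      ultimately show ?thesis
        by (simp split: if_splits)
    qed
    have "csum (\<lambda>z. \<nu> z * killed p (below 0) z (dep m j))
        = (\<Sum>n. \<Sum>a\<in>UNIV. \<nu> (dep (Suc n) a) * killed p (below 0) (dep (Suc n) a) (dep m j))"
      by (rule csum_depth) (simp add: killed_def)
    also have "\<dots> = (\<Sum>n. ennreal (?t n))"
    proof (intro suminf_cong)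
      fix n
      have "\<nu> (dep (Suc n) a) * killed p (below 0) (dep (Suc n) a) (dep m j)
          = ennreal (matpow R' (Suc n) $ i $ a * off (int (Suc n) - int m) a j)" for a
        using m lam_pos[of a] off_nonneg pow_nonneg
        by (simp add: \<nu>_dep killed_def jump_prob_dep ennreal_mult[symmetric] del: matpow.simps)
      then show "(\<Sum>a\<in>UNIV. \<nu> (dep (Suc n) a) * killed p (below 0) (dep (Suc n) a) (dep m j)) = ennreal (?t n)"
        using off_nonneg pow_nonneg by (simp add: sum_ennreal del: matpow.simps)
    qed
    also have "\<dots> = ennreal (matpow R' m $ i $ j * lam j - (if m = 1 then A (-1) $ i $ j else 0))"
      by (rule suminf_ennreal_eq[OF t_nonneg t_sums])
    finally have "csum (\<lambda>z. \<nu> z * killed p (below 0) z (dep m j))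
        = ennreal (matpow R' m $ i $ j * lam j - (if m = 1 then A (-1) $ i $ j else 0))" .
    moreover have "0 \<le> matpow R' m $ i $ j * lam j - (if m = 1 then A (-1) $ i $ j else 0)"
      by (rule sums_le[OF t_nonneg sums_zero t_sums])
    ultimately have "ennreal (if m = 1 then A (-1) $ i $ j else 0) + csum (\<lambda>z. \<nu> z * killed p (below 0) z (dep m j))
        = ennreal ((if m = 1 then A (-1) $ i $ j else 0) + (matpow R' m $ i $ j * lam j - (if m = 1 then A (-1) $ i $ j else 0)))"
      using A_nonneg[of "-1" i j] by (subst ennreal_plus) auto
    moreover have "\<mu> (dep m j) = ennreal (if m = 1 then A (-1) $ i $ j else 0)"
      by (simp add: \<mu>_dep)
    ultimately show ?thesis by (simp only: \<nu>_dep[OF m] add_diff_cancel_left' add_diff_eq)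
  qed
  have "csum (\<lambda>z. \<mu> z * \<Gamma> z (dep 1 j)) \<le> \<nu> (dep 1 j)"
  proof (rule green_minimal_measure[where \<mu> = \<mu> and \<nu> = \<nu>])
    fix z
    show "\<mu> z + csum (\<lambda>u. \<nu> u * killed p (below 0) u z) \<le> \<nu> z"
    proof (cases "z \<in> below 0")
      case True
      then obtain l a where "z = Some (l, a)" "l < 0" by (auto simp: below_def)
      then have z: "z = dep (nat (- l)) a" and l: "1 \<le> nat (- l)" by (simp_all add: dep_def)
      show ?thesis unfolding z eq[OF l] by (rule order_refl)
    next
      case False
      then show ?thesis by (simp add: outside killed_def)
    qed
  qed
  also have "csum (\<lambda>z. \<mu> z * \<Gamma> z (dep 1 j)) = (\<Sum>n. \<Sum>a\<in>UNIV. \<mu> (dep (Suc n) a) * \<Gamma> (dep (Suc n) a) (dep 1 j))"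
    by (rule csum_depth) (simp add: outside)
  also have "\<dots> = (\<Sum>n\<in>{0}. \<Sum>a\<in>UNIV. \<mu> (dep (Suc n) a) * \<Gamma> (dep (Suc n) a) (dep 1 j))"
    by (rule suminf_finite) (auto simp: \<mu>_dep)
  also have "\<dots> = (\<Sum>a\<in>UNIV. ennreal (A (-1) $ i $ a) * ennreal (lam j * occ 1 1 $ a $ j))"
    by (simp add: \<mu>_dep green_dep)
  also have "\<dots> = ennreal (lam j * R0 $ i $ j)"
  proof -
    have "ennreal (A (-1) $ i $ a) * ennreal (lam j * occ 1 1 $ a $ j)
        = ennreal (lam j * (A (-1) $ i $ a * occ 1 1 $ a $ j))" for a
      using lam_pos[of j] occ_nonneg A_nonneg[of "-1"] by (simp add: ennreal_mult[symmetric] mult_ac)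
    then show ?thesis
      using lam_pos[of j] occ_nonneg A_nonneg[of "-1"]
      by (simp add: sum_ennreal sum_distrib_left R0_def matrix_matrix_mult_def)
  qed
  finally have "ennreal (lam j * R0 $ i $ j) \<le> ennreal (R' $ i $ j * lam j)"
    using \<nu>_dep[of 1 j] by simp
  then have "lam j * R0 $ i $ j \<le> R' $ i $ j * lam j"
    using lam_pos[of j] R'(1)[of i j] by (simp add: ennreal_le_iff)
  then show ?thesis using lam_pos[of j] by (simp add: mult.commute)
qed

lemma R_mat_eq: "R_mat A = R0"
  unfolding R_mat_def
proof (rule the_equality)
  show "nonneg_solution A R0 \<and> (\<forall>R'. nonneg_solution A R' \<longrightarrow> (\<forall>i j. R0 $ i $ j \<le> R' $ i $ j))"
    using R0_solution R0_minimal by blast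
  fix R assume "nonneg_solution A R \<and> (\<forall>R'. nonneg_solution A R' \<longrightarrow> (\<forall>i j. R $ i $ j \<le> R' $ i $ j))"
  then have "R $ i $ j = R0 $ i $ j" for i j
    using R0_solution R0_minimal[of R i j] by (meson antisym)
  then show "R = R0" by (simp add: vec_eq_iff)
qed

text \<open>A row vector that annihilates \<open>occ 1 1\<close> annihilates the limit \<open>- mat 1\<close> in \<open>occ_first_sums\<close>.\<close>

lemma occ_first_invertible: "invertible (occ 1 1)"
proof -
  have "c i = 0" if "(\<Sum>k\<in>UNIV. c k *s row k (occ 1 1)) = 0" for c i
  proof -
    have c: "(\<Sum>k\<in>UNIV. c k * occ 1 1 $ k $ l) = 0" for l
      using arg_cong[OF that, of "\<lambda>v. v $ l"] by (simp add: row_def)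
    have "(\<lambda>n. \<Sum>k\<in>UNIV. c k * (occ 1 1 ** (matpow R0 n ** A (int n))) $ k $ i) sums
        (\<Sum>k\<in>UNIV. c k * (- mat 1 :: real^'n^'n) $ k $ i)"
      by (intro sums_sum sums_mult sums_matrixD occ_first_sums)
    moreover have "(\<Sum>k\<in>UNIV. c k * (occ 1 1 ** M) $ k $ i) = 0" for M :: "real^'n^'n"
    proof -
      have "(\<Sum>k\<in>UNIV. c k * (occ 1 1 ** M) $ k $ i) = (\<Sum>k\<in>UNIV. \<Sum>l\<in>UNIV. c k * occ 1 1 $ k $ l * M $ l $ i)"
        by (simp add: matrix_matrix_mult_def sum_distrib_left mult.assoc)
      also have "\<dots> = (\<Sum>l\<in>UNIV. (\<Sum>k\<in>UNIV. c k * occ 1 1 $ k $ l) * M $ l $ i)"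
        by (subst sum.swap) (simp add: sum_distrib_right)
      finally show ?thesis by (simp only: c mult_zero_left sum.neutral_const)
    qed
    ultimately have "(\<lambda>n. 0) sums (\<Sum>k\<in>UNIV. c k * (- mat 1 :: real^'n^'n) $ k $ i)"
      by (simp only:)
    then have "(\<Sum>k\<in>UNIV. c k * (- mat 1 :: real^'n^'n) $ k $ i) = 0"
      by (rule sums_unique2) (rule sums_zero)
    moreover have "(\<Sum>k\<in>UNIV. c k * (- mat 1 :: real^'n^'n) $ k $ i) = - c i"
      by (simp add: mat_def if_distrib sum_negf cong: if_cong)
    ultimately show ?thesis by simp
  qed
  then show ?thesis
    using matrix_right_invertible_independent_rows[of "occ 1 1"] matrix_inv_unique_right(1) by blast
qed

lemma R0_invertible: "invertible (A (-1)) \<Longrightarrow> invertible R0"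
  unfolding R0_def by (intro invertible_mult occ_first_invertible)

text \<open>The matrices \<open>W(k)\<close>, for \<open>k \<ge> 1\<close>.\<close>

definition scale :: "nat \<Rightarrow> real^'n^'n" where
  "scale k = occ k k ** matpow (matrix_inv R0) k"

lemma scale_1:
  assumes inv: "invertible (A (-1))" shows "scale 1 = matrix_inv (A (-1))"
proof (rule matrix_inv_unique_right(2))
  show "A (-1) ** scale 1 = mat 1"
    using matrix_inv_cancel(1)[OF R0_invertible[OF inv]] by (simp add: scale_def R0_def matrix_mul_assoc)
qed

lemma scale_recursion:
  assumes inv: "invertible (A (-1))" and k: "1 \<le> k"
  shows "scale (k + 1) = - (matrix_inv (A (-1)) ** (\<Sum>\<nu>=1..k. A (int k - int \<nu>) ** scale \<nu>))"
proof -
  let ?Ri = "matrix_inv R0"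
  have RR: "matpow R0 n ** matpow ?Ri n = mat 1" for n
    using matrix_inv_cancel(1)[OF R0_invertible[OF inv]] by (rule matpow_inverse)
  have occ_scale: "occ n (k + 1) ** matpow ?Ri (k + 1) = scale n" if "1 \<le> n" "n \<le> k + 1" for n
  proof -
    have "occ n (n + (k + 1 - n)) ** matpow ?Ri ((k + 1 - n) + n)
        = occ n n ** (matpow R0 (k + 1 - n) ** matpow ?Ri (k + 1 - n)) ** matpow ?Ri n"
      by (simp only: occ_power[OF that(1)] matpow_add matrix_mul_assoc)
    then show ?thesis using that by (simp add: RR scale_def)
  qed
  have "0 = (\<Sum>n=1..Suc k. A (int k - int n) ** occ n (k + 1)) ** matpow ?Ri (k + 1)"
    using occ_backward[of k "k + 1"] k by (simp add: matrix_matrix_mult_def zero_vec_def del: matpow.simps)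
  also have "\<dots> = (\<Sum>n=1..Suc k. A (int k - int n) ** (occ n (k + 1) ** matpow ?Ri (k + 1)))"
    by (simp only: matrix_mult_sum_distrib_right matrix_mul_assoc)
  also have "\<dots> = (\<Sum>n=1..Suc k. A (int k - int n) ** scale n)"
    by (intro sum.cong) (auto simp: occ_scale[simplified])
  also have "\<dots> = (\<Sum>n=1..k. A (int k - int n) ** scale n) + A (-1) ** scale (k + 1)"
    by simp
  finally have "A (-1) ** scale (k + 1) = - (\<Sum>n=1..k. A (int k - int n) ** scale n)"
    by (simp add: eq_neg_iff_add_eq_0 add.commute)
  then have "matrix_inv (A (-1)) ** (A (-1) ** scale (k + 1)) = matrix_inv (A (-1)) ** (- (\<Sum>n=1..k. A (int k - int n) ** scale n))"
    by (rule arg_cong)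
  moreover have "M ** (- B) = - (M ** B)" for M B :: "real^'n^'n"
    by (simp add: vec_eq_iff matrix_matrix_mult_def sum_negf)
  ultimately show ?thesis
    by (simp add: matrix_mul_assoc matrix_inv_cancel[OF inv])
qed

lemma kpow_None_start: "y \<noteq> None \<Longrightarrow> kpow (killed p D) n None y = 0"
proof (induction n arbitrary: y)
  case (Suc n)
  have "kpow (killed p D) (Suc n) None y = csum (\<lambda>z. killed p D None z * kpow (killed p D) n z y)"
    by (rule kpow_Suc_left)
  also have "\<dots> = csum (\<lambda>z :: 'n state. 0)"
  proof (intro nn_integral_cong)
    fix z
    show "killed p D None z * kpow (killed p D) n z y = 0"
    proof (cases z)
      case None
      then show ?thesis using Suc.IH[OF Suc.prems] by simp
    next
      case (Some a)
      then have "killed p D None z = 0" by (simp add: killed_def jump_prob_from_None)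
      then show ?thesis by simp
    qed
  qed
  finally show ?case by simp
qed auto

lemma expected_local_time_eq:
  assumes "markov_chain (P i) Z (generator A) (Some (0, i))" "1 \<le> k"
  shows "expected_local_time P Z k i j = ennreal (occ k k $ i $ j)"
proof -
  interpret C: bounded_chain "P i" Z "generator A" "Some (0, i)" "\<Sum>i\<in>UNIV. lam i"
    by (rule bounded_chainI) fact
  let ?B = "{Some (l, j) | l j. l \<ge> int k} :: 'n state set"
  have "up_time (\<lambda>t. Z t \<omega>) (int k) = entrance_time (\<lambda>t. Z t \<omega>) ?B" for \<omega>
    by (simp add: up_time_def entrance_time_def)
  then have "expected_local_time P Z k i j
      = green (killed p (- ?B)) (Some (0, i)) (Some (0, j)) * ennreal (1 / - generator A (Some (0, j)) (Some (0, j)))"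
    unfolding expected_local_time_def local_time_def
    using C.expected_occupation[of ?B "Some (0, j)"] assms(2) lam_pos[of j] by (simp add: lam_def)
  also have "green (killed p (- ?B)) (Some (0, i)) (Some (0, j)) = green (killed p (below (int k))) (Some (0, i)) (Some (0, j))"
  proof -
    have point: "csum (\<lambda>u. f u * (if Some (0, j) = u then 1 else 0)) = f (Some (0, j))" for f :: "'n state \<Rightarrow> ennreal"
      using csum_delta[of "Some (0, j)" f] by (simp add: mult.commute)
    have compl: "- ?B - below (int k) = {None}" "below (int k) \<subseteq> - ?B"
      by (auto simp: below_def)
    have "kpow (killed p (- ?B)) n (Some (0, i)) (Some (0, j)) = kpow (killed p (below (int k))) n (Some (0, i)) (Some (0, j))" for n
    proof -
      have "csum (\<lambda>u. kpow (killed p (- ?B)) n (Some (0, i)) u * (if Some (0, j) = u then 1 else 0))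
          = csum (\<lambda>u. kpow (killed p (below (int k))) n (Some (0, i)) u * (if Some (0, j) = u then 1 else 0))"
      proof (rule kpow_killed_cong[OF compl(2)])
        fix x z n assume "z \<in> - ?B - below (int k)"
        then have "z = None" unfolding compl by simp
        then show "p x z = 0 \<or> csum (\<lambda>u. kpow (killed p (- ?B)) n z u * (if Some (0, j) = u then 1 else 0)) = 0"
          unfolding point by (simp add: kpow_None_start)
      qed (use assms(2) in simp)
      then show ?thesis unfolding point .
    qed
    then show ?thesis by (simp add: green_def)
  qed
  also have "\<dots> = \<Gamma> (dep k i) (dep k j)"
    using green_shift[of 0 "int k" "- int k" i "- int k" j] by (simp add: dep_def)
  also have "\<dots> * ennreal (1 / - generator A (Some (0, j)) (Some (0, j))) = ennreal (occ k k $ i $ j)"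
    using assms(2) lam_pos[of j] occ_nonneg
    by (simp add: green_dep ennreal_mult[symmetric] lam_def[symmetric])
  finally show ?thesis .
qed

end

section \<open>Hitting level -1\<close>

lemma subharmonic_iterate:
  fixes K :: "'s::countable \<Rightarrow> 's \<Rightarrow> ennreal"
  assumes "\<And>x. \<phi> x \<le> csum (\<lambda>y. K x y * \<phi> y)"
  shows "\<phi> x \<le> csum (\<lambda>y. kpow K n x y * \<phi> y)"
proof (induction n)
  case 0
  then show ?case by (simp add: csum_delta)
next
  case (Suc n)
  also have "csum (\<lambda>y. kpow K n x y * \<phi> y) \<le> csum (\<lambda>y. kpow K n x y * csum (\<lambda>z. K y z * \<phi> z))"
    by (intro nn_integral_mono mult_left_mono assms) simp
  also have "\<dots> = csum (\<lambda>y. kpow K (Suc n) x y * \<phi> y)"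
    unfolding kpow.simps by (rule csum_mult_assoc[symmetric])
  finally show ?case .
qed

lemma kpow_mass_le:
  fixes K :: "'s::countable \<Rightarrow> 's \<Rightarrow> ennreal"
  assumes "\<And>x. csum (K x) \<le> 1" shows "csum (kpow K n x) \<le> 1"
proof (induction n)
  case 0
  have "csum (kpow K 0 x) = csum (\<lambda>y. (if x = y then 1 else 0) * 1)"
    by (intro nn_integral_cong) simp
  then show ?case unfolding csum_delta by simp
next
  case (Suc n)
  have "csum (kpow K (Suc n) x) = csum (\<lambda>y. csum (\<lambda>z. kpow K n x z * K z y))" by simp
  also have "\<dots> = csum (\<lambda>z. kpow K n x z * csum (K z))"
    by (subst csum_swap) (simp add: csum_cmult)
  also have "\<dots> \<le> csum (\<lambda>z. kpow K n x z * 1)"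
    by (intro nn_integral_mono mult_left_mono assms) simp
  finally show ?case using Suc by simp
qed

text \<open>The tail of a finite potential vanishes along the iterates of the kernel.\<close>

lemma potential_tail:
  fixes K :: "'s::countable \<Rightarrow> 's \<Rightarrow> ennreal" and h :: "'s \<Rightarrow> ennreal"
  defines "f \<equiv> \<lambda>x. csum (\<lambda>z. green K x z * h z)"
  assumes fin: "f x < \<infinity>"
  shows "(\<lambda>n. csum (\<lambda>y. kpow K n x y * f y)) \<longlonglongrightarrow> 0"
    and "f x = h x + csum (\<lambda>y. K x y * f y)"
proof -
  have f: "f u = h u + csum (\<lambda>y. K u y * f y)" for u
  proof -
    have "f u = csum (\<lambda>z. (if u = z then 1 else 0) * h z + csum (\<lambda>y. K u y * green K y z) * h z)"
      unfolding f_def by (subst green_backward) (simp add: distrib_right)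
    also have "\<dots> = h u + csum (\<lambda>y. K u y * f y)"
      unfolding csum_add csum_delta csum_mult_assoc f_def ..
    finally show ?thesis .
  qed
  show "f x = h x + csum (\<lambda>y. K x y * f y)" by (rule f)
  define \<beta> where "\<beta> n = csum (\<lambda>y. kpow K n x y * h y)" for n
  define T where "T n = csum (\<lambda>y. kpow K n x y * f y)" for n
  have T0: "T 0 = f x" by (simp add: T_def csum_delta)
  have step: "T n = \<beta> n + T (Suc n)" for n
  proof -
    have "T n = csum (\<lambda>y. kpow K n x y * (h y + csum (\<lambda>z. K y z * f z)))"
      unfolding T_def by (subst f) (rule refl)
    also have "\<dots> = \<beta> n + csum (\<lambda>y. kpow K n x y * csum (\<lambda>z. K y z * f z))"
      by (simp add: distrib_left csum_add \<beta>_def)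
    also have "csum (\<lambda>y. kpow K n x y * csum (\<lambda>z. K y z * f z)) = T (Suc n)"
      unfolding T_def kpow.simps by (rule csum_mult_assoc[symmetric])
    finally show ?thesis .
  qed
  have total: "f x = (\<Sum>k<n. \<beta> k) + T n" for n
    by (induction n) (auto simp: T0 step[symmetric] add.assoc)
  have "f x = (\<Sum>n. \<beta> n)"
    unfolding f_def green_def \<beta>_def by (simp add: csum_suminf[symmetric])
  then have "(\<lambda>n. \<Sum>k<n. \<beta> k) \<longlonglongrightarrow> f x"
    using summable_LIMSEQ[OF summableI, of \<beta>] by simp
  then have "(\<lambda>n. f x - (\<Sum>k<n. \<beta> k)) \<longlonglongrightarrow> f x - f x"
    using fin by (intro tendsto_diff_ennreal tendsto_const) auto
  moreover have "f x - (\<Sum>k<n. \<beta> k) = T n" for n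
  proof -
    have "(\<Sum>k<n. \<beta> k) \<le> f x" by (subst total[of n]) simp
    then have "(\<Sum>k<n. \<beta> k) < \<infinity>" using fin by (rule le_less_trans)
    then have "(\<Sum>k<n. \<beta> k) \<noteq> top" by (metis infinity_ennreal_def less_irrefl)
    then show ?thesis using total[of n] by (simp add: ennreal_add_diff_cancel_left)
  qed
  ultimately have "T \<longlonglongrightarrow> 0" using fin by (simp add: T_def[abs_def])
  then show "(\<lambda>n. csum (\<lambda>y. kpow K n x y * f y)) \<longlonglongrightarrow> 0" by (simp add: T_def[abs_def])
qed

lemma ennreal_terms_tendsto_0:
  assumes "(\<Sum>n. f n) < (\<infinity> :: ennreal)" shows "f \<longlonglongrightarrow> 0"
proof -
  have fin: "f n < \<infinity>" for n
    using assms by (metis ennreal_suminf_lessD infinity_ennreal_def)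
  then have f: "f n = ennreal (enn2real (f n))" for n by simp
  have "(\<Sum>n. ennreal (enn2real (f n))) \<noteq> top" using assms f by simp
  then have "summable (\<lambda>n. enn2real (f n))" by (intro summable_suminf_not_top) auto
  then have "(\<lambda>n. ennreal (enn2real (f n))) \<longlonglongrightarrow> ennreal 0"
    by (intro tendsto_ennrealI summable_LIMSEQ_zero)
  then show ?thesis using f by simp
qed

context skip_free begin

text \<open>The states of nonnegative level.\<close>

definition above :: "'n state set" where
  "above = {Some (l, i) | l i. l \<ge> 0}"

lemma above_iff [simp]: "Some (l, i) \<in> above \<longleftrightarrow> 0 \<le> l" "None \<notin> above"
  by (auto simp: above_def)

lemma above_range: "above \<subseteq> range Some"
  by (auto simp: above_def)

text \<open>
  The probability to jump to \<open>(-1, j)\<close> at once, and the probability that level \<open>-1\<close> is first hit in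
  phase \<open>j\<close>; both are set to 0 when the process starts outside the nonnegative levels.
\<close>

definition enter :: "'n \<Rightarrow> 'n state \<Rightarrow> ennreal" where
  "enter j x = (if x \<in> above then p x (Some (-1, j)) else 0)"

definition hit :: "'n \<Rightarrow> 'n state \<Rightarrow> ennreal" where
  "hit j x = csum (\<lambda>z. green (killed p above) x z * enter j z)"

lemma killed_mass_le: "csum (killed p D x) \<le> 1"
proof -
  have "csum (killed p D x) \<le> csum (p x)" by (intro nn_integral_mono) (simp add: killed_def)
  then show ?thesis by (simp add: jump_prob_sum)
qed

lemma hit_sum_le_1: "(\<Sum>j\<in>UNIV. hit j x) \<le> 1"
proof -
  have "(\<Sum>j\<in>UNIV. hit j x) = csum (\<lambda>z. green (killed p above) x z * (\<Sum>j\<in>UNIV. enter j z))"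
    unfolding hit_def by (simp add: sum_distrib_left nn_integral_sum)
  also have "\<dots> \<le> 1"
  proof (rule green_minimal_function[where f = "\<lambda>_. 1"])
    fix x
    show "(\<Sum>j\<in>UNIV. enter j x) + csum (\<lambda>z. killed p above x z * 1) \<le> 1"
    proof (cases "x \<in> above")
      case True
      have "(\<Sum>j\<in>UNIV. enter j x) = csum (\<lambda>z. \<Sum>j\<in>UNIV. (if Some (-1, j) = z then 1 else 0) * p x z)"
        using True by (subst nn_integral_sum) (auto simp: csum_delta enter_def)
      then have "(\<Sum>j\<in>UNIV. enter j x) + csum (\<lambda>z. killed p above x z * 1)
          = csum (\<lambda>z. (\<Sum>j\<in>UNIV. (if Some (-1, j) = z then 1 else 0) * p x z) + killed p above x z)"
        by (simp add: csum_add)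
      also have "\<dots> \<le> csum (p x)"
      proof (intro nn_integral_mono)
        fix z
        show "(\<Sum>j\<in>UNIV. (if Some (-1, j) = z then 1 else 0) * p x z) + killed p above x z \<le> p x z"
        proof (cases "\<exists>k. z = Some (-1, k)")
          case True
          then obtain k where z: "z = Some (-1, k)" by blast
          have "(\<Sum>j\<in>UNIV. (if Some (-1, j) = z then 1 else 0) * p x z) = (\<Sum>j\<in>UNIV. if k = j then p x z else 0)"
            unfolding z by (intro sum.cong) auto
          then show ?thesis by (simp add: killed_def z)
        next
          case False
          then have eq: "(\<Sum>j\<in>UNIV. (if Some (-1, j) = z then 1 else 0) * p x z) = 0" by (intro sum.neutral) auto
          show ?thesis unfolding eq by (simp add: killed_def)
        qed
      qed
      finally show ?thesis by (simp add: jump_prob_sum)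
    next
      case False
      then have "(\<Sum>j\<in>UNIV. enter j x) + csum (\<lambda>z. killed p above x z * 1) = 0"
        by (simp add: enter_def killed_def)
      then show ?thesis by simp
    qed
  qed
  finally show ?thesis .
qed

lemma hit_le_1: "hit j x \<le> 1"
proof -
  have "hit j x \<le> (\<Sum>j\<in>UNIV. hit j x)" by (rule member_le_sum) auto
  then show ?thesis using hit_sum_le_1 order_trans by blast
qed

lemma hit_finite: "hit j x < \<infinity>"
  using hit_le_1[of j x] by (metis ennreal_one_less_top infinity_ennreal_def order_le_less_trans)

lemma hit_tail: "(\<lambda>n. csum (\<lambda>y. kpow (killed p above) n x y * hit j y)) \<longlonglongrightarrow> 0"
  using potential_tail(1)[where K = "killed p above" and h = "enter j" and x = x] hit_finite[of j x] by (simp add: hit_def)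

lemma hit_eq: "hit j x = enter j x + csum (\<lambda>y. killed p above x y * hit j y)"
  using potential_tail(2)[where K = "killed p above" and h = "enter j" and x = x] hit_finite[of j x] by (simp add: hit_def)

lemma G_mat_entry:
  assumes "markov_chain (P i) Z (generator A) (Some (0, i))"
  shows "G_mat P Z $ i $ j = enn2real (hit j (Some (0, i)))"
proof -
  interpret C: bounded_chain "P i" Z "generator A" "Some (0, i)" "\<Sum>i\<in>UNIV. lam i"
    by (rule bounded_chainI) fact
  let ?B = "{Some (-1, j) | j. True} :: 'n state set"
  have ht: "hit_time (\<lambda>t. Z t \<omega>) (-1) = entrance_time (\<lambda>t. Z t \<omega>) ?B" for \<omega>
    by (simp add: hit_time_def entrance_time_def)
  have "{\<omega> \<in> space (P i). hit_time (\<lambda>t. Z t \<omega>) (-1) < \<infinity> \<and>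
        map_option snd (Z (real_of_ereal (hit_time (\<lambda>t. Z t \<omega>) (-1))) \<omega>) = Some j}
      = {\<omega> \<in> space (P i). entrance_time (\<lambda>t. Z t \<omega>) ?B < \<infinity> \<and>
        Z (real_of_ereal (entrance_time (\<lambda>t. Z t \<omega>) ?B)) \<omega> = Some (-1, j)}" (is "?L = ?E")
  proof -
    have "map_option snd (Z (real_of_ereal (entrance_time (\<lambda>t. Z t \<omega>) ?B)) \<omega>) = Some j \<longleftrightarrow>
        Z (real_of_ereal (entrance_time (\<lambda>t. Z t \<omega>) ?B)) \<omega> = Some (-1, j)"
      if w: "\<omega> \<in> space (P i)" and fin: "entrance_time (\<lambda>t. Z t \<omega>) ?B < \<infinity>" for \<omega>
    proof -
      have "0 \<le> entrance_time (\<lambda>t. Z t \<omega>) ?B"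
        unfolding entrance_time_def by (intro Inf_greatest) auto
      then obtain t where t: "entrance_time (\<lambda>t. Z t \<omega>) ?B = ereal t"
        using fin by (cases "entrance_time (\<lambda>t. Z t \<omega>) ?B") auto
      have "Z t \<omega> \<in> ?B" using entrance_time_attained(2)[OF C.right_cont_path[OF w] t] .
      then show ?thesis using t by auto
    qed
    then show ?thesis unfolding ht by blast
  qed
  then have "G_mat P Z $ i $ j = enn2real (emeasure (P i) ?E)"
    by (simp add: G_mat_def measure_def)
  also have "emeasure (P i) ?E = csum (\<lambda>z. green (killed p (- ?B)) (Some (0, i)) z * p z (Some (-1, j)))"
    by (rule C.entrance_distribution) auto
  also have "\<dots> = (\<Sum>n. csum (\<lambda>z. kpow (killed p (- ?B)) n (Some (0, i)) z * p z (Some (-1, j))))"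
    by (simp add: green_def csum_suminf[symmetric])
  also have "\<dots> = (\<Sum>n. csum (\<lambda>z. kpow (killed p above) n (Some (0, i)) z * p z (Some (-1, j))))"
  proof (intro suminf_cong kpow_killed_cong)
    show "above \<subseteq> - ?B" by (auto simp: above_def)
    show "Some (0, i) \<in> above" by simp
    fix x z n assume x: "x \<in> above" and z: "z \<in> - ?B - above"
    show "p x z = 0 \<or> csum (\<lambda>u. kpow (killed p (- ?B)) n z u * p u (Some (-1, j))) = 0"
    proof (cases z)
      case None
      have "csum (\<lambda>u. kpow (killed p (- ?B)) n None u * p u (Some (-1, j))) = csum (\<lambda>u :: 'n state. 0)"
      proof (intro nn_integral_cong)
        fix u
        show "kpow (killed p (- ?B)) n None u * p u (Some (-1, j)) = 0"
          by (cases "u = None") (simp_all add: kpow_None_start jump_prob_from_None)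
      qed
      then show ?thesis by (simp add: None)
    next
      case (Some a)
      obtain l b where a: "a = (l, b)" by (cases a)
      obtain k c where xk: "x = Some (k, c)" "0 \<le> k" using x by (auto simp: above_def)
      have "l < 0" using z by (simp add: Some a)
      moreover have "l \<noteq> -1" using z by (auto simp: Some a)
      ultimately have "l < -1" by linarith
      then show ?thesis using xk by (simp add: Some a jump_prob_Some off_zero)
    qed
  qed
  also have "\<dots> = (\<Sum>n. csum (\<lambda>z. kpow (killed p above) n (Some (0, i)) z * enter j z))"
  proof (intro suminf_cong nn_integral_cong)
    fix n z
    show "kpow (killed p above) n (Some (0, i)) z * p z (Some (-1, j)) = kpow (killed p above) n (Some (0, i)) z * enter j z"
      by (cases "z \<in> above") (auto simp: enter_def killed_kpow_outside)
  qed
  also have "\<dots> = hit j (Some (0, i))"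
    by (simp add: hit_def green_def csum_suminf[symmetric])
  finally show ?thesis .
qed

end

section \<open>The kernel of \<open>F(z)\<close>\<close>

context skip_free begin

text \<open>States by level plus one, so that the index 0 stands for level \<open>-1\<close>.\<close>

definition lev :: "nat \<Rightarrow> 'n \<Rightarrow> 'n state" where
  "lev n i = Some (int n - 1, i)"

lemma lev_above [simp]: "lev n i \<in> above \<longleftrightarrow> 1 \<le> n"
  by (auto simp: lev_def)

lemma jump_prob_lev: "jump_prob (generator A) (lev m i) (lev n j) = off (int n - int m) i j / lam i"
  by (simp add: lev_def jump_prob_Some)

lemma csum_from_lev:
  assumes "f None = 0" "\<And>k a. p (lev (Suc l) i) (Some (k, a)) = 0 \<Longrightarrow> f (Some (k, a)) = 0"
  shows "csum f = (\<Sum>n. \<Sum>a\<in>UNIV. f (lev (l + n) a))"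
proof -
  have "csum f = csum (\<lambda>k. \<Sum>a\<in>UNIV. f (Some (k, a)))"
    using assms(1) by (simp add: csum_state)
  also have "\<dots> = (\<Sum>n. \<Sum>a\<in>UNIV. f (Some (int l - 1 + int n, a)))"
  proof (rule csum_int_from)
    fix k assume "k < int l - 1"
    then have "p (lev (Suc l) i) (Some (k, a)) = 0" for a
      by (simp add: lev_def jump_prob_Some off_zero)
    then show "(\<Sum>a\<in>UNIV. f (Some (k, a))) = 0" using assms(2) by simp
  qed
  finally show ?thesis by (simp add: lev_def algebra_simps)
qed

text \<open>
  Hitting probabilities of level \<open>-1\<close>, extended by their boundary values at index 0 to a function that
  is harmonic at all other indices.
\<close>

definition hitp :: "nat \<Rightarrow> 'n \<Rightarrow> 'n \<Rightarrow> real" where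
  "hitp n i j = (if n = 0 then (if i = j then 1 else 0) else enn2real (hit j (lev n i)))"

lemma hitp_nonneg: "0 \<le> hitp n i j"
  by (simp add: hitp_def)

lemma hitp_le_1: "hitp n i j \<le> 1"
proof -
  have "enn2real (hit j x) \<le> 1" for x
    using enn2real_mono[OF hit_le_1[of j x]] by simp
  then show ?thesis by (simp add: hitp_def)
qed

lemma hit_lev: "1 \<le> n \<Longrightarrow> hit j (lev n i) = ennreal (hitp n i j)"
  using hit_finite[of j "lev n i"] by (simp add: hitp_def)

lemma hitp_harmonic: "(\<lambda>n. \<Sum>a\<in>UNIV. A (int n - 1) $ i $ a * hitp (l + n) a j) sums 0"
proof -
  define u where "u y = (if y \<in> above then hit j y else if Some (-1, j) = y then 1 else 0)" for y
  have u_lev: "u (lev n a) = ennreal (hitp n a j)" for n a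
  proof (cases n)
    case 0
    then show ?thesis by (auto simp: u_def lev_def hitp_def)
  next
    case (Suc k)
    then show ?thesis using hit_lev[of n j a] by (simp add: u_def)
  qed
  let ?t = "\<lambda>n. \<Sum>a\<in>UNIV. off (int n - 1) i a / lam i * hitp (l + n) a j"
  have "ennreal (hitp (Suc l) i j) = hit j (lev (Suc l) i)"
    by (simp add: hit_lev)
  also have "\<dots> = enter j (lev (Suc l) i) + csum (\<lambda>y. killed p above (lev (Suc l) i) y * hit j y)"
    by (rule hit_eq)
  also have "\<dots> = csum (\<lambda>y. (if Some (-1, j) = y then 1 else 0) * p (lev (Suc l) i) y
      + killed p above (lev (Suc l) i) y * hit j y)"
    unfolding csum_add csum_delta by (simp add: enter_def)
  also have "\<dots> = csum (\<lambda>y. p (lev (Suc l) i) y * u y)"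
    by (intro nn_integral_cong) (auto simp: u_def killed_def)
  also have "\<dots> = (\<Sum>n. \<Sum>a\<in>UNIV. p (lev (Suc l) i) (lev (l + n) a) * u (lev (l + n) a))"
  proof (rule csum_from_lev[where f = "\<lambda>y. p (lev (Suc l) i) y * u y" and i = i])
    show "p (lev (Suc l) i) None * u None = 0" by (simp add: u_def)
    show "p (lev (Suc l) i) (Some (k, a)) * u (Some (k, a)) = 0" if "p (lev (Suc l) i) (Some (k, a)) = 0" for k a
      using that by simp
  qed
  also have "\<dots> = (\<Sum>n. ennreal (?t n))"
  proof (intro suminf_cong)
    fix n
    have "p (lev (Suc l) i) (lev (l + n) a) * u (lev (l + n) a)
        = ennreal (off (int n - 1) i a / lam i * hitp (l + n) a j)" for a
      using lam_pos[of i] off_nonneg hitp_nonneg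
      by (simp add: u_lev jump_prob_lev ennreal_mult[symmetric])
    then show "(\<Sum>a\<in>UNIV. p (lev (Suc l) i) (lev (l + n) a) * u (lev (l + n) a)) = ennreal (?t n)"
      using lam_pos[of i] off_nonneg hitp_nonneg by (simp add: sum_ennreal)
  qed
  finally have "?t sums (hitp (Suc l) i j - 0)"
    using lam_pos[of i] off_nonneg hitp_nonneg
    by (intro sums_from_ennreal) (auto intro!: sum_nonneg mult_nonneg_nonneg divide_nonneg_pos)
  then have "(\<lambda>n. lam i * ?t n) sums (lam i * (hitp (Suc l) i j - 0))"
    by (rule sums_mult)
  from sums_diff[OF this sums_single[of 1 "\<lambda>_. lam i * hitp (Suc l) i j"]]
  have "(\<lambda>n. lam i * ?t n - (if n = 1 then lam i * hitp (Suc l) i j else 0)) sums 0"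
    by simp
  moreover have "lam i * ?t n - (if n = 1 then lam i * hitp (Suc l) i j else 0)
      = (\<Sum>a\<in>UNIV. A (int n - 1) $ i $ a * hitp (l + n) a j)" for n
  proof -
    have "lam i * ?t n = (\<Sum>a\<in>UNIV. off (int n - 1) i a * hitp (l + n) a j)"
      using lam_pos[of i] by (simp add: sum_distrib_left)
    also have "\<dots> = (\<Sum>a\<in>UNIV. A (int n - 1) $ i $ a * hitp (l + n) a j)
        + (if n = 1 then lam i * hitp (l + n) i j else 0)"
      using sum_off_left[of "int n - 1" i "\<lambda>a. hitp (l + n) a j"] by simp
    finally show ?thesis by simp
  qed
  ultimately show ?thesis by (simp only:)
qed

lemma off_summable: "summable (\<lambda>n. off (int n - 1) i a)"
proof -
  have "(\<lambda>n. A (int n - 1) $ i $ a + (if n = 1 then if i = a then lam i else 0 else 0)) sums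
      (phase_gen A $ i $ a + (if i = a then lam i else 0))"
    by (intro sums_add sums_single sums_matrixD A_sums)
  moreover have "A (int n - 1) $ i $ a + (if n = 1 then if i = a then lam i else 0 else 0) = off (int n - 1) i a" for n
    by (auto simp: off_eq)
  ultimately show ?thesis by (simp add: sums_iff)
qed

lemma F_mat_summable:
  assumes "cmod z \<le> 1"
  shows "summable (\<lambda>n. norm (z ^ n * complex_of_real (A (int n - 1) $ i $ j)))"
proof -
  have "summable (\<lambda>n. norm (A (int n - 1) $ i $ j))"
  proof -
    have bd: "norm (A (int n - 1) $ i $ j) \<le> off (int n - 1) i j + (if n = 1 then lam i else 0)" for n
      using off_nonneg[of "int n - 1" i j] lam_pos[of i] by (auto simp: off_def lam_def split: if_splits)
    have "summable (\<lambda>n. off (int n - 1) i j + (if n = 1 then lam i else 0))"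
      by (intro summable_add off_summable summable_single)
    then show ?thesis
      by (rule summable_comparison_test'[where N = 0]) (simp only: real_norm_def abs_abs bd[unfolded real_norm_def])
  qed
  then show ?thesis
  proof (rule summable_comparison_test'[of _ 0])
    fix n
    have "cmod z ^ n \<le> 1" using assms by (simp add: power_le_one)
    then show "norm (norm (z ^ n * complex_of_real (A (int n - 1) $ i $ j))) \<le> norm (A (int n - 1) $ i $ j)"
      by (simp add: norm_mult norm_power mult_left_le_one_le)
  qed
qed

lemma F_mat_sums:
  assumes "cmod z \<le> 1"
  shows "(\<lambda>n. z ^ n * complex_of_real (A (int n - 1) $ i $ j)) sums (F_mat A z $ i $ j)"
  using summable_norm_cancel[OF F_mat_summable[OF assms]] by (simp add: F_mat_def summable_sums)

text \<open>
  The conclusion says that \<open>G v = z v\<close>.  The functions \<open>z\<^sup>n v\<close> and \<open>hitp n v\<close> of the index \<open>n\<close> are both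
  harmonic, they agree at \<open>n = 0\<close>, and \<open>\<epsilon> n\<close> is their difference.
\<close>

lemma kernel_F_mat_eigenvector:
  assumes z: "z \<noteq> 0" "cmod z < 1" and Fv: "F_mat A z *v v = 0"
  shows "z * v $ i = (\<Sum>j\<in>UNIV. complex_of_real (hitp 1 i j) * v $ j)"
proof -
  define r where "r = cmod z"
  have r: "0 < r" "r < 1" using z by (auto simp: r_def)
  define \<epsilon> where "\<epsilon> n a = z ^ n * v $ a - (\<Sum>j\<in>UNIV. complex_of_real (hitp n a j) * v $ j)" for n a
  define V where "V = (\<Sum>a\<in>UNIV. cmod (v $ a))"
  have V: "0 \<le> V" "cmod (v $ a) \<le> V" for a
    unfolding V_def by (auto intro!: sum_nonneg member_le_sum)
  have \<epsilon>0: "\<epsilon> 0 a = 0" for a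
  proof -
    have "(\<Sum>j\<in>UNIV. complex_of_real (hitp 0 a j) * v $ j) = (\<Sum>j\<in>UNIV. if a = j then v $ j else 0)"
      by (intro sum.cong) (auto simp: hitp_def)
    then show ?thesis by (simp add: \<epsilon>_def)
  qed
  have \<epsilon>_bound: "cmod (\<epsilon> n a) \<le> V * (r ^ n + (\<Sum>j\<in>UNIV. hitp n a j))" for n a
  proof -
    have "cmod (\<epsilon> n a) \<le> cmod (z ^ n * v $ a) + cmod (\<Sum>j\<in>UNIV. complex_of_real (hitp n a j) * v $ j)"
      unfolding \<epsilon>_def by (rule norm_triangle_ineq4)
    also have "cmod (z ^ n * v $ a) \<le> V * r ^ n"
      using V(2)[of a] r by (simp add: norm_mult norm_power r_def mult.commute mult_right_mono)
    also have "cmod (\<Sum>j\<in>UNIV. complex_of_real (hitp n a j) * v $ j) \<le> (\<Sum>j\<in>UNIV. V * hitp n a j)"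
      using V(2) hitp_nonneg by (intro sum_norm_le) (simp add: norm_mult mult.commute mult_right_mono)
    finally show ?thesis by (simp add: distrib_left sum_distrib_left)
  qed
  have \<epsilon>_bounded: "cmod (\<epsilon> n a) \<le> V * (1 + real CARD('n))" for n a
  proof -
    have "(\<Sum>j\<in>UNIV. hitp n a j) \<le> (\<Sum>j\<in>(UNIV :: 'n set). 1)" by (intro sum_mono hitp_le_1)
    moreover have "r ^ n \<le> 1" using r by (simp add: power_le_one)
    ultimately have "V * (r ^ n + (\<Sum>j\<in>UNIV. hitp n a j)) \<le> V * (1 + real CARD('n))"
      using V(1) by (intro mult_left_mono) auto
    with \<epsilon>_bound[of n a] show ?thesis by linarith
  qed
  have harmonic: "(\<lambda>n. \<Sum>a\<in>UNIV. complex_of_real (off (int n - 1) i a) * \<epsilon> (l + n) a) sums (complex_of_real (lam i) * \<epsilon> (Suc l) i)"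
    for l i
  proof -
    have "(\<lambda>n. \<Sum>a\<in>UNIV. z ^ n * complex_of_real (A (int n - 1) $ i $ a) * v $ a) sums
        (\<Sum>a\<in>UNIV. F_mat A z $ i $ a * v $ a)"
      using z by (intro sums_sum sums_mult2 F_mat_sums) simp
    moreover have "(\<Sum>a\<in>UNIV. F_mat A z $ i $ a * v $ a) = 0"
      using arg_cong[OF Fv, of "\<lambda>w. w $ i"] by (simp add: matrix_vector_mult_def)
    ultimately have "(\<lambda>n. z ^ l * (\<Sum>a\<in>UNIV. z ^ n * complex_of_real (A (int n - 1) $ i $ a) * v $ a)) sums (z ^ l * 0)"
      by (intro sums_mult) simp
    moreover have "(\<lambda>n. \<Sum>j\<in>UNIV. complex_of_real (\<Sum>a\<in>UNIV. A (int n - 1) $ i $ a * hitp (l + n) a j) * v $ j) sums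
        (\<Sum>j\<in>UNIV. complex_of_real 0 * v $ j)"
      by (intro sums_sum sums_mult2 sums_of_real hitp_harmonic)
    ultimately have base: "(\<lambda>n. z ^ l * (\<Sum>a\<in>UNIV. z ^ n * complex_of_real (A (int n - 1) $ i $ a) * v $ a)
        - (\<Sum>j\<in>UNIV. complex_of_real (\<Sum>a\<in>UNIV. A (int n - 1) $ i $ a * hitp (l + n) a j) * v $ j)) sums
        (z ^ l * 0 - (\<Sum>j\<in>UNIV. complex_of_real 0 * v $ j))"
      by (rule sums_diff)
    have eq: "z ^ l * (\<Sum>a\<in>UNIV. z ^ n * complex_of_real (A (int n - 1) $ i $ a) * v $ a)
          - (\<Sum>j\<in>UNIV. complex_of_real (\<Sum>a\<in>UNIV. A (int n - 1) $ i $ a * hitp (l + n) a j) * v $ j)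
        = (\<Sum>a\<in>UNIV. complex_of_real (A (int n - 1) $ i $ a) * \<epsilon> (l + n) a)" for n
    proof -
      have "(\<Sum>j\<in>UNIV. complex_of_real (\<Sum>a\<in>UNIV. A (int n - 1) $ i $ a * hitp (l + n) a j) * v $ j)
          = (\<Sum>j\<in>UNIV. \<Sum>a\<in>UNIV. complex_of_real (A (int n - 1) $ i $ a) * (complex_of_real (hitp (l + n) a j) * v $ j))"
        by (simp add: sum_distrib_right mult.assoc)
      also have "\<dots> = (\<Sum>a\<in>UNIV. complex_of_real (A (int n - 1) $ i $ a) * (\<Sum>j\<in>UNIV. complex_of_real (hitp (l + n) a j) * v $ j))"
        by (subst sum.swap) (simp add: sum_distrib_left)
      finally have eq1: "(\<Sum>j\<in>UNIV. complex_of_real (\<Sum>a\<in>UNIV. A (int n - 1) $ i $ a * hitp (l + n) a j) * v $ j)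
          = (\<Sum>a\<in>UNIV. complex_of_real (A (int n - 1) $ i $ a) * (\<Sum>j\<in>UNIV. complex_of_real (hitp (l + n) a j) * v $ j))" .
      have eq2: "z ^ l * (\<Sum>a\<in>UNIV. z ^ n * complex_of_real (A (int n - 1) $ i $ a) * v $ a)
          = (\<Sum>a\<in>UNIV. complex_of_real (A (int n - 1) $ i $ a) * (z ^ (l + n) * v $ a))"
        by (simp add: sum_distrib_left power_add mult_ac)
      show ?thesis
        unfolding eq1 eq2 \<epsilon>_def by (simp only: sum_subtractf[symmetric] right_diff_distrib)
    qed
    have "(\<lambda>n. \<Sum>a\<in>UNIV. complex_of_real (A (int n - 1) $ i $ a) * \<epsilon> (l + n) a) sums 0"
      using base unfolding eq by simp
    from sums_add[OF this sums_single[of 1 "\<lambda>_. complex_of_real (lam i) * \<epsilon> (Suc l) i"]]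
    have "(\<lambda>n. (\<Sum>a\<in>UNIV. complex_of_real (A (int n - 1) $ i $ a) * \<epsilon> (l + n) a)
        + (if n = 1 then complex_of_real (lam i) * \<epsilon> (Suc l) i else 0)) sums (complex_of_real (lam i) * \<epsilon> (Suc l) i)"
      by simp
    moreover have "(\<Sum>a\<in>UNIV. complex_of_real (A (int n - 1) $ i $ a) * \<epsilon> (l + n) a)
        + (if n = 1 then complex_of_real (lam i) * \<epsilon> (Suc l) i else 0)
        = (\<Sum>a\<in>UNIV. complex_of_real (off (int n - 1) i a) * \<epsilon> (l + n) a)" for n
      unfolding sum_off_left by simp
    ultimately show ?thesis by (simp only:)
  qed
  \<comment> \<open>The modulus of the difference is subharmonic, as the difference vanishes at level \<open>-1\<close>.\<close>
  define \<phi> where "\<phi> x = (case x of None \<Rightarrow> 0 | Some (k, a) \<Rightarrow>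
      if 0 \<le> k then ennreal (cmod (\<epsilon> (nat (k + 1)) a)) else 0)" for x
  have \<phi>_lev: "\<phi> (lev n a) = ennreal (cmod (\<epsilon> n a))" for n a
  proof (cases n)
    case (Suc k)
    have "nat (int (Suc k) - 1 + 1) = Suc k" by simp
    then show ?thesis unfolding Suc \<phi>_def lev_def by simp
  qed (simp add: \<phi>_def lev_def \<epsilon>0)
  have \<phi>_outside: "\<phi> x = 0" if "x \<notin> above" for x
    using that by (cases x; force simp: \<phi>_def)
  have above_lev: "\<exists>n a. x = lev (Suc n) a" if x: "x \<in> above" for x
  proof -
    obtain k a where "x = Some (k, a)" "0 \<le> k" using x unfolding above_def by blast
    then have "x = lev (Suc (nat k)) a" by (simp add: lev_def)
    then show ?thesis by blast
  qed
  have sub: "\<phi> x \<le> csum (\<lambda>y. killed p above x y * \<phi> y)" for x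
  proof (cases "x \<in> above")
    case True
    then obtain l i where x: "x = lev (Suc l) i" using above_lev by blast
    let ?u = "\<lambda>n. \<Sum>a\<in>UNIV. off (int n - 1) i a * cmod (\<epsilon> (l + n) a)"
    have u_nonneg: "0 \<le> ?u n" for n using off_nonneg by (intro sum_nonneg mult_nonneg_nonneg) auto
    have u_sum: "summable ?u"
    proof (intro summable_sum)
      fix a
      show "summable (\<lambda>n. off (int n - 1) i a * cmod (\<epsilon> (l + n) a))"
      proof (rule summable_comparison_test'[of "\<lambda>n. off (int n - 1) i a * (V * (1 + real CARD('n)))" 0])
        show "summable (\<lambda>n. off (int n - 1) i a * (V * (1 + real CARD('n))))"
          by (intro summable_mult2 off_summable)
        show "norm (off (int n - 1) i a * cmod (\<epsilon> (l + n) a)) \<le> off (int n - 1) i a * (V * (1 + real CARD('n)))" for n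
          using off_nonneg[of "int n - 1" i a] \<epsilon>_bounded[of "l + n" a] by (simp add: mult_left_mono)
      qed
    qed
    have "cmod (complex_of_real (lam i) * \<epsilon> (Suc l) i) \<le> suminf ?u"
    proof -
      have "cmod (\<Sum>n. \<Sum>a\<in>UNIV. complex_of_real (off (int n - 1) i a) * \<epsilon> (l + n) a) \<le> suminf ?u"
        by (intro norm_suminf_le u_sum sum_norm_le) (simp add: norm_mult off_nonneg)
      then show ?thesis using sums_unique[OF harmonic[of i l]] by simp
    qed
    then have "cmod (\<epsilon> (Suc l) i) \<le> (\<Sum>n. ?u n / lam i)"
      using lam_pos[of i] u_sum by (simp add: norm_mult suminf_divide field_simps)
    then have "\<phi> x \<le> ennreal (\<Sum>n. ?u n / lam i)"
      by (simp add: x \<phi>_lev ennreal_leI)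
    also have "\<dots> = (\<Sum>n. ennreal (?u n / lam i))"
      using u_sum u_nonneg lam_pos[of i] by (intro suminf_ennreal2[symmetric] summable_divide) auto
    also have "\<dots> = (\<Sum>n. \<Sum>a\<in>UNIV. killed p above x (lev (l + n) a) * \<phi> (lev (l + n) a))"
    proof (intro suminf_cong)
      fix n
      have "killed p above x (lev (l + n) a) * \<phi> (lev (l + n) a)
          = ennreal (off (int n - 1) i a * cmod (\<epsilon> (l + n) a) / lam i)" for a
      proof (cases "l + n = 0")
        case True
        then show ?thesis by (simp add: \<phi>_lev \<epsilon>0)
      next
        case False
        then have "1 \<le> l + n" by arith
        then show ?thesis
          using off_nonneg[of "int n - 1" i a] lam_pos[of i]
          by (simp add: x killed_def \<phi>_lev jump_prob_lev ennreal_mult[symmetric])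
      qed
      then show "ennreal (?u n / lam i) = (\<Sum>a\<in>UNIV. killed p above x (lev (l + n) a) * \<phi> (lev (l + n) a))"
        using off_nonneg lam_pos[of i] by (simp add: sum_ennreal sum_divide_distrib)
    qed
    also have "\<dots> = csum (\<lambda>y. killed p above x y * \<phi> y)"
    proof (rule csum_from_lev[where f = "\<lambda>y. killed p above x y * \<phi> y" and l = l and i = i, symmetric])
      show "killed p above x None * \<phi> None = 0" by (simp add: \<phi>_def)
      show "killed p above x (Some (k, a)) * \<phi> (Some (k, a)) = 0" if "p (lev (Suc l) i) (Some (k, a)) = 0" for k a
        using that by (simp add: x killed_def)
    qed
    finally show ?thesis .
  qed (simp add: \<phi>_outside)
  let ?K = "killed p above"
  \<comment> \<open>\<open>S N\<close> is finite, and \<open>r ^ N\<close> bounds the geometric part outside it.\<close>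
  define S where "S N = (\<Union>n\<in>{1..<N}. range (lev n))" for N
  have S_fin: "finite (S N)" for N by (simp add: S_def)
  have majorant: "\<phi> y \<le> ennreal V * (indicator (S N) y + ennreal (r ^ N) + (\<Sum>j\<in>UNIV. hit j y))" for y N
  proof (cases "y \<in> above")
    case True
    then obtain n a where y: "y = lev (Suc n) a" using above_lev by blast
    have "\<phi> y \<le> ennreal (V * (r ^ Suc n + (\<Sum>j\<in>UNIV. hitp (Suc n) a j)))"
      using \<epsilon>_bound[of "Suc n" a] by (simp add: y \<phi>_lev ennreal_leI del: power_Suc)
    also have "\<dots> = ennreal V * (ennreal (r ^ Suc n) + (\<Sum>j\<in>UNIV. hit j y))"
      using V(1) r hitp_nonneg
      by (simp add: y hit_lev ennreal_mult sum_nonneg sum_ennreal ennreal_plus del: power_Suc)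
    also have "ennreal (r ^ Suc n) \<le> indicator (S N) y + ennreal (r ^ N)"
    proof (cases "Suc n < N")
      case True
      then have "Suc n \<in> {1..<N}" by simp
      then have "y \<in> S N" unfolding S_def y by (rule UN_I) (rule rangeI)
      moreover have "r ^ Suc n \<le> 1" using r by (intro power_le_one) auto
      ultimately have "ennreal (r ^ Suc n) \<le> indicator (S N) y"
        using ennreal_leI[of "r ^ Suc n" 1] by (simp del: power_Suc)
      then show ?thesis by (rule add_increasing2[OF zero_le])
    next
      case False
      then have "r ^ Suc n \<le> r ^ N" using r by (intro power_decreasing) auto
      then have "ennreal (r ^ Suc n) \<le> ennreal (r ^ N)" by (rule ennreal_leI)
      then show ?thesis by (rule add_increasing[OF zero_le])
    qed
    finally show ?thesis by (simp add: add_right_mono mult_left_mono)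
  qed (simp add: \<phi>_outside)
  have "\<phi> x \<le> ennreal (V * r ^ N)" for x N
  proof -
    define B where "B n = ennreal V * ((\<Sum>y\<in>S N. kpow ?K n x y) + ennreal (r ^ N)
        + (\<Sum>j\<in>UNIV. csum (\<lambda>y. kpow ?K n x y * hit j y)))" for n
    have "\<phi> x \<le> B n" for n
    proof -
      have "\<phi> x \<le> csum (\<lambda>y. kpow ?K n x y * \<phi> y)" by (rule subharmonic_iterate[OF sub])
      also have "\<dots> \<le> csum (\<lambda>y. kpow ?K n x y * (ennreal V * (indicator (S N) y + ennreal (r ^ N) + (\<Sum>j\<in>UNIV. hit j y))))"
        by (intro nn_integral_mono mult_left_mono majorant) simp
      also have "\<dots> = csum (\<lambda>y. ennreal V * (kpow ?K n x y * indicator (S N) y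
          + kpow ?K n x y * ennreal (r ^ N) + (\<Sum>j\<in>UNIV. kpow ?K n x y * hit j y)))"
        unfolding sum_distrib_left[symmetric] distrib_left[symmetric]
        by (intro nn_integral_cong mult.left_commute)
      also have "\<dots> = ennreal V * (csum (\<lambda>y. kpow ?K n x y * indicator (S N) y)
          + csum (kpow ?K n x) * ennreal (r ^ N) + (\<Sum>j\<in>UNIV. csum (\<lambda>y. kpow ?K n x y * hit j y)))"
        by (simp only: csum_cmult csum_add csum_multc) (simp add: nn_integral_sum)
      also have "csum (\<lambda>y. kpow ?K n x y * indicator (S N) y) = (\<Sum>y\<in>S N. kpow ?K n x y)"
        using csum_finite_support[OF S_fin[of N], of "\<lambda>y. kpow ?K n x y * indicator (S N) y"] by simp
      also have "csum (kpow ?K n x) * ennreal (r ^ N) \<le> 1 * ennreal (r ^ N)"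
        by (intro mult_right_mono kpow_mass_le killed_mass_le) simp
      finally show ?thesis unfolding B_def by (simp add: add_left_mono add_right_mono mult_left_mono)
    qed
    moreover have "B \<longlonglongrightarrow> ennreal V * ((\<Sum>y\<in>S N. 0) + ennreal (r ^ N) + (\<Sum>j\<in>(UNIV :: 'n set). 0))"
      unfolding B_def
    proof (intro ennreal_tendsto_cmult tendsto_add tendsto_sum tendsto_const hit_tail)
      fix y assume "y \<in> S N"
      then have "y \<in> above" by (auto simp: S_def)
      then have "green ?K x y < \<infinity>"
        by (intro green_killed_finite[OF above_range, of "Some (-1, undefined)"]) auto
      then show "(\<lambda>n. kpow ?K n x y) \<longlonglongrightarrow> 0"
        unfolding green_def by (rule ennreal_terms_tendsto_0)
    qed simp
    ultimately have "\<phi> x \<le> ennreal V * ((\<Sum>y\<in>S N. 0) + ennreal (r ^ N) + (\<Sum>j\<in>(UNIV :: 'n set). 0))"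
      by (intro LIMSEQ_le_const) auto
    then show ?thesis using V r by (simp add: ennreal_mult)
  qed
  moreover have "(\<lambda>N. ennreal (V * r ^ N)) \<longlonglongrightarrow> ennreal (V * 0)"
    using r by (intro tendsto_ennrealI tendsto_mult_left LIMSEQ_power_zero) simp
  ultimately have "\<phi> x \<le> ennreal (V * 0)" for x
    by (intro LIMSEQ_le_const) auto
  from this[of "lev 1 i"] have "ennreal (cmod (\<epsilon> 1 i)) \<le> ennreal 0" by (simp only: \<phi>_lev mult_zero_right)
  then have "\<epsilon> 1 i = 0" by (simp add: ennreal_le_iff)
  then show ?thesis by (simp add: \<epsilon>_def)
qed

end

section \<open>Spectrum and power series\<close>

lemma invertible_iff_kernel:
  fixes M :: "'a::field^'n^'n"
  shows "invertible M \<longleftrightarrow> (\<forall>v. M *v v = 0 \<longrightarrow> v = 0)"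
  unfolding invertible_left_inverse matrix_left_invertible_ker ..

lemma complex_mat_mult: "complex_mat (M ** N) = complex_mat M ** complex_mat N"
  by (simp add: complex_mat_def matrix_matrix_mult_def vec_eq_iff)

lemma complex_mat_invertible:
  fixes M :: "real^'n^'n"
  assumes "invertible M" shows "invertible (complex_mat M)"
proof -
  have "complex_mat M ** complex_mat (matrix_inv M) = complex_mat (mat 1)"
    using matrix_inv_cancel(1)[OF assms] by (simp add: complex_mat_mult[symmetric])
  also have "complex_mat (mat 1) = mat 1" by (simp add: complex_mat_def mat_def vec_eq_iff)
  finally show ?thesis by (rule matrix_inv_unique_right)
qed

lemma mat_mult_vector: "mat c *v v = c *s v" for v :: "'a::comm_semiring_1^'n"
proof -
  have "(\<Sum>j\<in>UNIV. (if i = j then c else 0) * v $ j) = (\<Sum>j\<in>UNIV. if i = j then c * v $ j else 0)" for i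
    by (intro sum.cong) auto
  then show ?thesis by (simp add: matrix_vector_mult_def mat_def vec_eq_iff)
qed

lemma sp_iff_det: "c \<in> sp M \<longleftrightarrow> det (mat c - complex_mat M) = 0"
proof -
  have "(mat c - complex_mat M) *v v = 0 \<longleftrightarrow> complex_mat M *v v = c *s v" for v
    by (auto simp: matrix_vector_mult_diff_rdistrib mat_mult_vector)
  then have "invertible (mat c - complex_mat M) \<longleftrightarrow> c \<notin> sp M"
    unfolding invertible_iff_kernel sp_def by auto
  then show ?thesis by (simp add: invertible_det_nz)
qed

lemma poly_det: "poly (det Q) c = det (\<chi> i j. poly (Q $ i $ j) c)"
  for Q :: "complex poly^'n^'n"
proof -
  have "poly (of_int (sign f)) c = of_int (sign f)" for f :: "'n \<Rightarrow> 'n"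
    by (simp add: sign_def)
  then show ?thesis by (simp add: det_def poly_sum poly_prod)
qed

text \<open>The characteristic polynomial over the complex numbers.\<close>

definition charpoly :: "real^'n^'n \<Rightarrow> complex poly" where
  "charpoly M = det (\<chi> i j. [: - complex_mat M $ i $ j, if i = j then 1 else 0 :])"

lemma poly_charpoly: "poly (charpoly M) c = det (mat c - complex_mat M)"
proof -
  have "(\<chi> i j. poly [: - complex_mat M $ i $ j, if i = j then 1 else 0 :] c) = mat c - complex_mat M"
    by (simp add: vec_eq_iff mat_def)
  then show ?thesis by (simp add: charpoly_def poly_det)
qed

lemma sp_eq_roots: "sp M = {c. poly (charpoly M) c = 0}"
  by (auto simp: sp_iff_det poly_charpoly)

text \<open>
  Near infinity the characteristic polynomial behaves like \<open>z\<^sup>N\<close> with \<open>N \<ge> 1\<close>, so it is not constant.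
\<close>

lemma sp_nonempty: "sp (M :: real^'n^'n) \<noteq> {}"
proof
  assume empty: "sp M = {}"
  then have "constant (poly (charpoly M))"
    using Fundamental_Theorem_Algebra.fundamental_theorem_of_algebra[of "charpoly M"] by (auto simp: sp_eq_roots)
  then obtain d where d: "\<And>z. det (mat z - complex_mat M) = d"
    unfolding constant_def poly_charpoly by metis
  define f where "f w = det (\<chi> i j. (if i = j then 1 else 0) - w * complex_mat M $ i $ j)" for w
  have scale: "d = of_nat (Suc n) ^ CARD('n) * f (1 / of_nat (Suc n))" for n
  proof -
    let ?z = "of_nat (Suc n) :: complex"
    have "?z \<noteq> 0" by (simp only: of_nat_eq_0_iff)
    then have "(mat ?z - complex_mat M) $ i $ j = ?z * ((if i = j then 1 else 0) - 1 / ?z * complex_mat M $ i $ j)" for i j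
      by (simp add: mat_def right_diff_distrib del: of_nat_Suc)
    then have "det (mat ?z - complex_mat M) = ?z ^ CARD('n) * f (1 / ?z)"
      unfolding f_def det_def by (simp add: prod.distrib sum_distrib_left mult_ac del: of_nat_Suc)
    then show ?thesis using d by metis
  qed
  have inv_lim: "(\<lambda>n. 1 / of_nat (Suc n) :: complex) \<longlonglongrightarrow> 0"
    using LIMSEQ_Suc[OF lim_1_over_n[where 'a = complex]] by simp
  have "(\<lambda>n. f (1 / of_nat (Suc n))) \<longlonglongrightarrow> f 0"
    unfolding f_def det_def
    by (intro tendsto_sum tendsto_mult tendsto_const tendsto_prod)
       (simp only: vec_lambda_beta, intro tendsto_diff tendsto_mult tendsto_const inv_lim)
  moreover have "f 0 = 1"
  proof -
    have "(\<chi> i j. (if i = j then 1 else 0) - 0 * complex_mat M $ i $ j) = mat 1"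
      by (simp add: vec_eq_iff mat_def)
    then show ?thesis unfolding f_def by simp
  qed
  moreover have eq: "f (1 / of_nat (Suc n)) = d * (1 / of_nat (Suc n)) ^ CARD('n)" for n
  proof -
    have "(of_nat (Suc n) :: complex) \<noteq> 0" by (simp only: of_nat_eq_0_iff)
    then show ?thesis by (subst scale[of n]) (simp add: power_divide del: of_nat_Suc)
  qed
  moreover have "(\<lambda>n. d * (1 / of_nat (Suc n)) ^ CARD('n)) \<longlonglongrightarrow> d * 0 ^ CARD('n)"
    by (intro tendsto_intros inv_lim)
  ultimately have "(1 :: complex) = d * 0 ^ CARD('n)"
    unfolding eq by (auto dest: LIMSEQ_unique)
  then show False by (simp add: power_0_left)
qed

lemma sp_bounded:
  fixes M :: "real^'n^'n"
  assumes "\<And>i j. 0 \<le> M $ i $ j" "\<And>i. (\<Sum>j\<in>UNIV. M $ i $ j) \<le> 1" "c \<in> sp M"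
  shows "cmod c \<le> 1"
proof -
  obtain v where v: "v \<noteq> 0" "complex_mat M *v v = c *s v" using assms(3) by (auto simp: sp_def)
  define m where "m = Max (range (\<lambda>i. cmod (v $ i)))"
  have m: "cmod (v $ i) \<le> m" for i unfolding m_def by (intro Max_ge) auto
  have "m \<in> range (\<lambda>i. cmod (v $ i))" unfolding m_def by (intro Max_in) auto
  then obtain i where i: "m = cmod (v $ i)" by blast
  have "m > 0"
  proof -
    obtain k where "v $ k \<noteq> 0" using v(1) by (auto simp: vec_eq_iff)
    then show ?thesis using m[of k] by (meson less_le_trans zero_less_norm_iff)
  qed
  have "cmod c * m = cmod ((complex_mat M *v v) $ i)"
    by (simp add: v(2) i norm_mult)
  also have "\<dots> \<le> (\<Sum>j\<in>UNIV. M $ i $ j * m)"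
    unfolding matrix_vector_mult_def complex_mat_def
    using m assms(1) by (simp add: norm_mult sum_norm_le mult_left_mono)
  also have "\<dots> \<le> 1 * m"
    unfolding sum_distrib_right[symmetric] using assms(2)[of i] \<open>m > 0\<close> by (intro mult_right_mono) auto
  finally show ?thesis using \<open>m > 0\<close> by simp
qed

lemma sp_finite:
  fixes M :: "real^'n^'n"
  assumes "\<And>c. c \<in> sp M \<Longrightarrow> cmod c \<le> 1"
  shows "finite (sp M)"
proof -
  have "2 \<notin> sp M" using assms[of 2] by auto
  then have "charpoly M \<noteq> 0" by (auto simp: sp_eq_roots)
  then show ?thesis unfolding sp_eq_roots by (rule poly_roots_finite)
qed

lemma matrix_inv_entry:
  fixes M :: "'a::field^'n^'n"
  assumes "invertible M"
  shows "matrix_inv M $ i $ j = det (\<chi> a b. if b = i then (if a = j then 1 else 0) else M $ a $ b) / det M"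
proof -
  let ?x = "column j (matrix_inv M)" and ?e = "(\<chi> a. if a = j then 1 else 0) :: 'a^'n"
  have "M *v ?x = ?e"
    using matrix_inv_cancel(1)[OF assms]
    by (simp add: vec_eq_iff matrix_vector_mult_def column_def matrix_matrix_mult_def mat_def)
  moreover have "det M \<noteq> 0" using assms by (simp add: invertible_det_nz)
  ultimately have "?x = (\<chi> k. det (\<chi> a b. if b = k then ?e $ a else M $ a $ b) / det M)"
    using cramer[of M ?x ?e] by simp
  from arg_cong[OF this, of "\<lambda>x. x $ i"] show ?thesis by (simp add: column_def cong: if_cong)
qed

lemma holomorphic_on_det:
  fixes f :: "complex \<Rightarrow> complex^'n^'n"
  assumes "\<And>i j. (\<lambda>z. f z $ i $ j) holomorphic_on S"
  shows "(\<lambda>z. det (f z)) holomorphic_on S"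
  unfolding det_def by (intro holomorphic_intros assms)

lemma holomorphic_on_matrix_inv:
  fixes f :: "complex \<Rightarrow> complex^'n^'n"
  assumes "\<And>i j. (\<lambda>z. f z $ i $ j) holomorphic_on S" "\<And>z. z \<in> S \<Longrightarrow> invertible (f z)"
  shows "(\<lambda>z. matrix_inv (f z) $ i $ j) holomorphic_on S"
proof -
  have "(\<lambda>z. det (\<chi> a b. if b = i then (if a = j then 1 else 0) else f z $ a $ b) / det (f z)) holomorphic_on S"
  proof (intro holomorphic_on_divide holomorphic_on_det)
    show "(\<lambda>z. (\<chi> a b. if b = i then (if a = j then 1 else 0) else f z $ a $ b) $ a $ b) holomorphic_on S" for a b
      using assms(1)[of a b] by (cases "b = i") auto
    show "det (f z) \<noteq> 0" if "z \<in> S" for z using assms(2)[OF that] by (simp add: invertible_det_nz)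
  qed (rule assms)
  then show ?thesis
    by (rule holomorphic_transform) (simp add: matrix_inv_entry assms(2))
qed

lemma powser_const_coeffs:
  fixes d :: "nat \<Rightarrow> complex"
  assumes "0 < r" "\<And>z. cmod z < r \<Longrightarrow> (\<lambda>k. d k * z ^ k) sums t"
  shows "d k = (if k = 0 then t else 0)"
proof -
  have d0: "d 0 = t"
    using assms(2)[of 0] assms(1) sums_unique2[OF _ powser_sums_zero[of d]] by fastforce
  have "d m = 0" if m: "0 < m" for m
  proof (rule ccontr)
    assume dm: "d m \<noteq> 0"
    let ?a = "\<lambda>k. d k - (if k = 0 then t else 0)"
    have ps: "(\<lambda>k. ?a k * (z - 0) ^ k) sums 0" if "cmod (z - 0) < r" for z
    proof -
      have "(\<lambda>k. d k * z ^ k - (if k = 0 then t else 0)) sums (t - t)"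
        using that by (intro sums_diff assms(2) sums_single) simp
      moreover have "d k * z ^ k - (if k = 0 then t else 0) = ?a k * (z - 0) ^ k" for k by auto
      ultimately show ?thesis by simp
    qed
    obtain s where s: "0 < s" "\<And>z. z \<in> cball 0 s - {0} \<Longrightarrow> (\<lambda>_ :: complex. 0 :: complex) z \<noteq> 0"
      by (rule powser_0_nonzero[OF assms(1) ps refl, where m = m]) (use dm m in auto)
    from s(2)[of "complex_of_real s"] s(1) show False by simp
  qed
  with d0 show ?thesis by auto
qed

text \<open>A convolution equation with invertible leading coefficient has one solution.\<close>

lemma convolution_unique:
  fixes B X X' :: "nat \<Rightarrow> 'a::field^'n^'n"
  assumes "invertible (B 0)"
    and "\<And>k. (\<Sum>m\<le>k. B m ** X (k - m)) = T k" "\<And>k. (\<Sum>m\<le>k. B m ** X' (k - m)) = T k"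
  shows "X k = X' k"
proof (induction k rule: less_induct)
  case (less k)
  have split: "(\<Sum>m\<le>k. B m ** Y (k - m)) = B 0 ** Y k + (\<Sum>m\<in>{..k} - {0}. B m ** Y (k - m))" for Y
    by (subst sum.remove[of _ 0]) auto
  have "(\<Sum>m\<in>{..k} - {0}. B m ** X (k - m)) = (\<Sum>m\<in>{..k} - {0}. B m ** X' (k - m))"
    using less by (intro sum.cong) auto
  then have "B 0 ** X k + (\<Sum>m\<in>{..k} - {0}. B m ** X' (k - m))
      = B 0 ** X' k + (\<Sum>m\<in>{..k} - {0}. B m ** X' (k - m))"
    using assms(2)[of k] assms(3)[of k] unfolding split by simp
  then have "B 0 ** X k = B 0 ** X' k" by (rule add_right_imp_eq)
  then have "matrix_inv (B 0) ** (B 0 ** X k) = matrix_inv (B 0) ** (B 0 ** X' k)" by simp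
  then show ?case by (simp add: matrix_mul_assoc matrix_inv_cancel[OF assms(1)])
qed

context skip_free begin

abbreviation (input) "G0 \<equiv> (\<chi> i j. hitp 1 i j) :: real^'n^'n"

lemma F_mat_0: "F_mat A 0 = complex_mat (A (-1))"
proof -
  have "F_mat A 0 $ i $ j = complex_mat (A (-1)) $ i $ j" for i j
    using F_mat_sums[of 0 i j] powser_sums_zero[of "\<lambda>n. complex_of_real (A (int n - 1) $ i $ j)"]
    by (simp add: mult.commute complex_mat_def sums_iff)
  then show ?thesis by (simp add: vec_eq_iff)
qed

lemma F_mat_invertible:
  assumes "invertible (A (-1))" "cmod z < 1" "z \<notin> sp G0"
  shows "invertible (F_mat A z)"
proof (cases "z = 0")
  case True
  then show ?thesis using assms(1) by (simp add: F_mat_0 complex_mat_invertible)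
next
  case False
  show ?thesis
    unfolding invertible_iff_kernel
  proof (intro allI impI, rule ccontr)
    fix v assume v: "F_mat A z *v v = 0" "v \<noteq> 0"
    have "complex_mat G0 *v v = z *s v"
      using kernel_F_mat_eigenvector[OF False assms(2) v(1)]
      by (simp add: vec_eq_iff matrix_vector_mult_def complex_mat_def)
    with v(2) assms(3) show False by (auto simp: sp_def)
  qed
qed

lemma hitp_row_sum: "(\<Sum>j\<in>UNIV. hitp 1 i j) \<le> 1"
proof -
  have "ennreal (\<Sum>j\<in>UNIV. hitp 1 i j) = (\<Sum>j\<in>UNIV. hit j (lev 1 i))"
    using hitp_nonneg by (simp add: hit_lev sum_ennreal)
  also have "\<dots> \<le> ennreal 1" using hit_sum_le_1 by simp
  finally show ?thesis by (subst (asm) ennreal_le_iff) auto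
qed

text \<open>
  The entries of the inverse are holomorphic by Cramer's rule.  Multiplying their Taylor series by that of
  \<open>F\<close> gives the convolution equation that \<open>scale_1\<close> and \<open>scale_recursion\<close> express for \<open>scale\<close>.
\<close>

lemma F_mat_inverse_sums:
  assumes inv: "invertible (A (-1))" and \<rho>: "0 < \<rho>" "\<rho> \<le> 1"
    and F: "\<And>z. cmod z < \<rho> \<Longrightarrow> invertible (F_mat A z)" and z: "cmod z < \<rho>"
  shows "(\<lambda>k. complex_of_real (scale (k + 1) $ i $ j) * z ^ k) sums (matrix_inv (F_mat A z) $ i $ j)"
proof -
  have "(\<lambda>z. F_mat A z $ i $ j) holomorphic_on ball 0 \<rho>" for i j
  proof (rule power_series_holomorphic[of _ _ "\<lambda>n. complex_of_real (A (int n - 1) $ i $ j)"])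
    fix w :: complex assume "w \<in> ball 0 \<rho>"
    then have "cmod w \<le> 1" using \<rho> by simp
    from F_mat_sums[OF this, of i j]
    show "(\<lambda>n. complex_of_real (A (int n - 1) $ i $ j) * (w - 0) ^ n) sums (F_mat A w $ i $ j)"
      by (simp add: mult.commute)
  qed
  then have "(\<lambda>z. matrix_inv (F_mat A z) $ i $ j) holomorphic_on ball 0 \<rho>" for i j
    by (rule holomorphic_on_matrix_inv) (simp add: F)
  note hol = this
  define c where "c n i j = (deriv ^^ n) (\<lambda>z. matrix_inv (F_mat A z) $ i $ j) 0 / fact n" for n i j
  have c_sums: "(\<lambda>n. c n i j * z ^ n) sums (matrix_inv (F_mat A z) $ i $ j)" if "cmod z < \<rho>" for z i j
    using holomorphic_power_series[OF hol, of z i j] that by (simp add: c_def)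
  have c_abs: "summable (\<lambda>n. norm (c n i j * z ^ n))" if "cmod z < \<rho>" for z i j
  proof (rule powser_insidea)
    let ?x = "complex_of_real ((cmod z + \<rho>) / 2)"
    have x: "cmod ?x = (cmod z + \<rho>) / 2" using \<rho> by (simp only: norm_of_real) simp
    show "summable (\<lambda>n. c n i j * ?x ^ n)"
      by (rule sums_summable[OF c_sums]) (use that x in simp)
    show "cmod z < cmod ?x" using that x by simp
  qed
  have "(\<lambda>k. (\<Sum>a\<in>UNIV. \<Sum>m\<le>k. complex_of_real (A (int m - 1) $ i $ a) * c (k - m) a j) * z ^ k) sums
      (if i = j then 1 else 0)" if z: "cmod z < \<rho>" for z i j
  proof -
    have z1: "cmod z \<le> 1" using z \<rho> by simp
    have "(\<lambda>k. \<Sum>a\<in>UNIV. \<Sum>m\<le>k. (z ^ m * complex_of_real (A (int m - 1) $ i $ a)) * (c (k - m) a j * z ^ (k - m))) sums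
        (\<Sum>a\<in>UNIV. F_mat A z $ i $ a * matrix_inv (F_mat A z) $ a $ j)"
    proof (rule sums_sum)
      fix a
      show "(\<lambda>k. \<Sum>m\<le>k. (z ^ m * complex_of_real (A (int m - 1) $ i $ a)) * (c (k - m) a j * z ^ (k - m))) sums
          (F_mat A z $ i $ a * matrix_inv (F_mat A z) $ a $ j)"
        using Cauchy_product_sums[OF F_mat_summable[OF z1, of i a] c_abs[OF z, of a j]]
        by (simp add: sums_unique[OF F_mat_sums[OF z1], symmetric] sums_unique[OF c_sums[OF z], symmetric])
    qed
    moreover have "(\<Sum>m\<le>k. (z ^ m * complex_of_real (A (int m - 1) $ i $ a)) * (c (k - m) a j * z ^ (k - m)))
        = (\<Sum>m\<le>k. complex_of_real (A (int m - 1) $ i $ a) * c (k - m) a j) * z ^ k" for k a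
      unfolding sum_distrib_right
    proof (intro sum.cong refl)
      fix m assume "m \<in> {..k}"
      then have "z ^ k = z ^ m * z ^ (k - m)" by (simp add: power_add[symmetric])
      then show "(z ^ m * complex_of_real (A (int m - 1) $ i $ a)) * (c (k - m) a j * z ^ (k - m))
          = complex_of_real (A (int m - 1) $ i $ a) * c (k - m) a j * z ^ k" by simp
    qed
    moreover have "(\<Sum>a\<in>UNIV. F_mat A z $ i $ a * matrix_inv (F_mat A z) $ a $ j) = (if i = j then 1 else 0)"
      using arg_cong[OF matrix_inv_cancel(1)[OF F[OF z]], of "\<lambda>M. M $ i $ j"]
      by (simp add: matrix_matrix_mult_def mat_def)
    ultimately show ?thesis by (simp add: sum_distrib_right)
  qed
  from powser_const_coeffs[OF \<rho>(1) this]
  have conv: "(\<Sum>a\<in>UNIV. \<Sum>m\<le>k. complex_of_real (A (int m - 1) $ i $ a) * c (k - m) a j)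
      = (if k = 0 then if i = j then 1 else 0 else 0)" for k i j .
  let ?B = "\<lambda>m. complex_mat (A (int m - 1))"
  let ?C = "\<lambda>k. (\<chi> i j. c k i j) :: complex^'n^'n"
  let ?T = "\<lambda>k. if k = (0::nat) then mat 1 else 0 :: complex^'n^'n"
  have "?C k = complex_mat (scale (k + 1))" for k
  proof (rule convolution_unique[of ?B ?C ?T "\<lambda>k. complex_mat (scale (k + 1))"])
    show "invertible (?B 0)" using inv by (simp add: complex_mat_invertible)
    show "(\<Sum>m\<le>k. ?B m ** ?C (k - m)) = ?T k" for k
    proof -
      have "(\<Sum>m\<le>k. ?B m ** ?C (k - m)) $ i $ j = ?T k $ i $ j" for i j
        using conv[of i k j] by (simp add: sum_component matrix_matrix_mult_def complex_mat_def mat_def sum.swap[of _ _ "{..k}"])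
      then show ?thesis by (simp add: vec_eq_iff)
    qed
    show "(\<Sum>m\<le>k. ?B m ** complex_mat (scale (k - m + 1))) = ?T k" for k
    proof (cases k)
      case 0
      then show ?thesis
        using scale_1[OF inv] matrix_inv_cancel(1)[OF inv]
        by (simp add: complex_mat_mult[symmetric]) (simp add: complex_mat_def mat_def vec_eq_iff)
    next
      case (Suc k')
      then have k: "1 \<le> k" by simp
      have neg: "M ** (- N) = - (M ** N)" for M N :: "real^'n^'n"
        by (simp add: vec_eq_iff matrix_matrix_mult_def sum_negf)
      have "A (-1) ** scale (k + 1) = - (\<Sum>\<nu>=1..k. A (int k - int \<nu>) ** scale \<nu>)"
        unfolding scale_recursion[OF inv k] by (simp add: neg matrix_mul_assoc matrix_inv_cancel[OF inv])
      also have "(\<Sum>\<nu>=1..k. A (int k - int \<nu>) ** scale \<nu>) = (\<Sum>m\<in>{..k} - {0}. A (int m - 1) ** scale (k - m + 1))"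
        by (rule sum.reindex_bij_witness[of _ "\<lambda>m. k - m + 1" "\<lambda>\<nu>. k - \<nu> + 1"]) (auto simp: of_nat_diff)
      finally have "A (-1) ** scale (k + 1) + (\<Sum>m\<in>{..k} - {0}. A (int m - 1) ** scale (k - m + 1)) = 0"
        by simp
      moreover have "(\<Sum>m\<le>k. A (int m - 1) ** scale (k - m + 1))
          = A (-1) ** scale (k + 1) + (\<Sum>m\<in>{..k} - {0}. A (int m - 1) ** scale (k - m + 1))"
        by (subst sum.remove[of _ 0]) auto
      ultimately have zero: "(\<Sum>m\<le>k. A (int m - 1) ** scale (k - m + 1)) = 0" by (simp only:)
      have "(\<Sum>m\<le>k. ?B m ** complex_mat (scale (k - m + 1))) = complex_mat (\<Sum>m\<le>k. A (int m - 1) ** scale (k - m + 1))"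
        unfolding complex_mat_mult[symmetric] by (simp add: complex_mat_def vec_eq_iff sum_component)
      also have "\<dots> = 0" unfolding zero by (simp add: complex_mat_def vec_eq_iff)
      finally show ?thesis using Suc by simp
    qed
  qed
  then have "c k i j = complex_of_real (scale (k + 1) $ i $ j)" for k
    by (simp add: vec_eq_iff complex_mat_def)
  with c_sums[OF z, of i j] show ?thesis by simp
qed

end

theorem lemma6p8:
  fixes A :: "int \<Rightarrow> real^'n^'n"
    and P :: "'n \<Rightarrow> 'w measure"
    and Z :: "real \<Rightarrow> 'w \<Rightarrow> 'n state"
  assumes "skip_free_MAP A P Z"
    and "invertible (A (-1))"
  shows "invertible (R_mat A) \<and>
    (\<forall>k\<ge>1. \<forall>i j. expected_local_time P Z k i j < \<infinity>) \<and>
    W_mat A P Z 1 = matrix_inv (A (-1)) \<and>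
    (\<forall>k\<ge>1. W_mat A P Z (k + 1) =
       - (matrix_inv (A (-1)) ** (\<Sum>\<nu>=1..k. A (int k - int \<nu>) ** W_mat A P Z \<nu>))) \<and>
    (\<forall>z. cmod z < Min (cmod ` sp (G_mat P Z)) \<longrightarrow>
       invertible (F_mat A z) \<and>
       (\<forall>i j. (\<lambda>k. complex_of_real (W_mat A P Z (k + 1) $ i $ j) * z ^ (k + 1))
                sums (z * matrix_inv (F_mat A z) $ i $ j)))"
proof -
  interpret skip_free A
    using assms(1) by unfold_locales (simp add: skip_free_MAP_def)
  have chain: "markov_chain (P i) Z (generator A) (Some (0, i))" for i
    using assms(1) by (simp add: skip_free_MAP_def)
  note inv = assms(2)
  have W: "W_mat A P Z k = scale k" if "1 \<le> k" for k
  proof -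
    have "Xi_mat P Z k = occ k k"
      using expected_local_time_eq[where P = P, OF chain that] occ_nonneg by (simp add: Xi_mat_def vec_eq_iff)
    then show ?thesis by (simp add: W_mat_def scale_def R_mat_eq)
  qed
  have G: "G_mat P Z = (\<chi> i j. hitp 1 i j)"
    using G_mat_entry[where P = P, OF chain] by (simp add: vec_eq_iff hitp_def lev_def)
  define S where "S = sp (G_mat P Z)"
  have S_le: "cmod c \<le> 1" if "c \<in> S" for c
    using sp_bounded[of "G_mat P Z" c] that hitp_nonneg hitp_row_sum by (simp add: S_def G)
  have S: "finite S" "S \<noteq> {}"
    using sp_finite[of "G_mat P Z"] S_le sp_nonempty[of "G_mat P Z"] by (auto simp: S_def)
  define \<rho> where "\<rho> = Min (cmod ` S)"
  have "\<rho> \<in> cmod ` S" unfolding \<rho>_def using S by (intro Min_in) auto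
  then have \<rho>1: "\<rho> \<le> 1" using S_le by auto
  have Finv: "invertible (F_mat A z)" if "cmod z < \<rho>" for z
  proof (rule F_mat_invertible[OF inv])
    show "cmod z < 1" using that \<rho>1 by simp
    have "z \<notin> S"
    proof
      assume "z \<in> S"
      then have "\<rho> \<le> cmod z" unfolding \<rho>_def using S by (intro Min_le) auto
      with that show False by simp
    qed
    then show "z \<notin> sp (\<chi> i j. hitp 1 i j)" by (simp add: S_def G)
  qed
  have series: "(\<lambda>k. complex_of_real (W_mat A P Z (k + 1) $ i $ j) * z ^ (k + 1))
      sums (z * matrix_inv (F_mat A z) $ i $ j)" if "cmod z < \<rho>" for z i j
  proof -
    have "0 < \<rho>" using that by (meson norm_ge_zero order_le_less_trans)
    from sums_mult[OF F_mat_inverse_sums[OF inv this \<rho>1 Finv that, of i j], of z]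
    show ?thesis by (simp add: W mult_ac)
  qed
  have rec: "W_mat A P Z (k + 1) = - (matrix_inv (A (-1)) ** (\<Sum>\<nu>=1..k. A (int k - int \<nu>) ** W_mat A P Z \<nu>))"
    if "1 \<le> k" for k
  proof -
    have "(\<Sum>\<nu>=1..k. A (int k - int \<nu>) ** W_mat A P Z \<nu>) = (\<Sum>\<nu>=1..k. A (int k - int \<nu>) ** scale \<nu>)"
      by (intro sum.cong) (auto simp: W)
    then show ?thesis using scale_recursion[OF inv that] that by (simp add: W)
  qed
  have "expected_local_time P Z k i j < \<infinity>" if "1 \<le> k" for k i j
    using expected_local_time_eq[where P = P, OF chain that] by simp
  moreover have "invertible (R_mat A)" using R0_invertible[OF inv] by (simp add: R_mat_eq)
  moreover have "W_mat A P Z 1 = matrix_inv (A (-1))" using W[of 1] scale_1[OF inv] by simp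
  ultimately show ?thesis
    using rec series Finv unfolding \<rho>_def S_def by blast
qed

end
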